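(* Let $1<p<\infty$, $R>0$, $\lambda\in\mathbb{R}$ and $p-1<q\leq p-1+\frac{p}{Q}$. If $\frac{2Q}{Q+1}\leq p<2$ and $c>\left(\frac{p-1}{p}\right)^{p}$, then the problem $$\begin{cases}\frac{\partial u}{\partial t}=\nabla_\gamma\cdot\left(|\nabla_\gamma u|^{p-2}\nabla_\gamma u\right)+c\,\frac{|x|^{\gamma p}}{(R-\rho)^{p}\rho^{\gamma p}}u^{p-1}+\lambda u^q&\text{in }B_{R}\times(0,T),\\ u(z,0)=u_0(z)\geq0&\text{in }B_{R},\\ u(z,t)=0&\text{on }\partial B_{R}\times(0,T)\end{cases}$$ has no general positive local solution.
   Context: Baouendi–Grushin setting: $m,k\ge 1$ are integers, $\gamma\geq0$ is a real number, points are $z=(x,y)\in\mathbb{R}^{m}\times\mathbb{R}^{k}=\mathbb{R}^{m+k}$, $|\cdot|$ is the Euclidean norm. Vector fields: $X_i=\partial/\partial x_i$ ($1\le i\le m$), $Y_j=|x|^{\gamma}\,\partial/\partial y_j$ ($1\le j\le k$); $\nabla_{\gamma}=(X_1,\ldots,X_m,Y_1,\ldots,Y_k)=(\nabla_x,|x|^{\gamma}\nabla_y)$; for $F=(F_1,\ldots,F_{m+k})$, $\nabla_\gamma\cdot F=\sum_{i=1}^m X_iF_i+\sum_{j=1}^k Y_jF_{m+j}$. The homogeneous dimension is $Q=m+(1+\gamma)k$, $$\rho=\rho(z)=\left(|x|^{2(1+\gamma)}+(1+\gamma)^2|y|^2\right)^{\frac{1}{2(1+\gamma)}},$$ and $B_R=\{z\in\mathbb{R}^{m+k}:\rho(z)<R\}$.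 With $\Omega=B_R$, a function $u$ is a general (also called generalized) positive local solution of the problem if: (i) $u:[0,T)\to L^{1}(\Omega)$ is continuous for some $T>0$; (ii) $u(z,t)$ is positive and locally bounded on $\Omega\times(0,T)$; (iii) $1/u(z,t)$ is locally bounded on $\Omega\times(0,T)$; (iv) $\lim_{t\to0}u(\cdot,t)=u_{0}$ in the sense of distributions; (v) $\nabla_{\gamma}u\in L^{p}_{\mathrm{loc}}(\Omega)$ and $u$ is a solution of the PDE in the sense of distributions. *)

theory Defs
  imports "HOL-Analysis.Analysis"
begin

type_synonym ('m, 'k) gpoint = "(real ^ 'm) \<times> (real ^ 'k)"

section \<open>Baouendi--Grushin geometry\<close>

text \<open>Real power of a nonnegative base with exponent \<open>\<ge> 0\<close> and the convention \<open>0\<^sup>0 = 1\<close>;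
  \<open>powr\<close> has \<open>0 powr 0 = 0\<close>, which would be wrong for \<open>|x|\<^sup>\<gamma>\<close> at \<open>\<gamma> = 0\<close>.\<close>

definition rpow :: "real \<Rightarrow> real \<Rightarrow> real" where
  "rpow b a = (if a = 0 then 1 else b powr a)"

definition X_field :: "'m \<Rightarrow> (('m::finite, 'k::finite) gpoint \<Rightarrow> real) \<Rightarrow> ('m, 'k) gpoint \<Rightarrow> real" where
  "X_field i f z = frechet_derivative f (at z) (axis i 1, 0)"

definition Y_field ::
  "real \<Rightarrow> 'k \<Rightarrow> (('m::finite, 'k::finite) gpoint \<Rightarrow> real) \<Rightarrow> ('m, 'k) gpoint \<Rightarrow> real" where
  "Y_field \<gamma> j f z = rpow (norm (fst z)) \<gamma> * frechet_derivative f (at z) (0, axis j 1)"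

definition grad_\<gamma> ::
  "real \<Rightarrow> (('m::finite, 'k::finite) gpoint \<Rightarrow> real) \<Rightarrow> ('m, 'k) gpoint \<Rightarrow> ('m, 'k) gpoint" where
  "grad_\<gamma> \<gamma> f z = ((\<chi> i. X_field i f z), (\<chi> j. Y_field \<gamma> j f z))"

definition hom_dim :: "'m::finite itself \<Rightarrow> 'k::finite itself \<Rightarrow> real \<Rightarrow> real" where
  "hom_dim _ _ \<gamma> = real CARD('m) + (1 + \<gamma>) * real CARD('k)"

definition rho :: "real \<Rightarrow> ('m::finite, 'k::finite) gpoint \<Rightarrow> real" where
  "rho \<gamma> z = (norm (fst z) powr (2 * (1 + \<gamma>)) + (1 + \<gamma>)\<^sup>2 * (norm (snd z))\<^sup>2)
               powr (1 / (2 * (1 + \<gamma>)))"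

definition rho_ball :: "real \<Rightarrow> real \<Rightarrow> ('m::finite, 'k::finite) gpoint set" where
  "rho_ball \<gamma> R = {z. rho \<gamma> z < R}"

definition potential :: "real \<Rightarrow> real \<Rightarrow> real \<Rightarrow> ('m::finite, 'k::finite) gpoint \<Rightarrow> real" where
  "potential \<gamma> p R z =
     rpow (norm (fst z)) (\<gamma> * p) / ((R - rho \<gamma> z) powr p * rpow (rho \<gamma> z) (\<gamma> * p))"

section \<open>Test functions and local function spaces\<close>

text \<open>All iterated directional derivatives exist and are everywhere (Frechet) differentiable;
  in finite dimension this is \<open>C\<^sup>\<infinity>\<close>.\<close>

definition smooth :: "('a::euclidean_space \<Rightarrow> real) \<Rightarrow> bool" where
  "smooth f \<longleftrightarrow>
     (\<forall>vs. foldr (\<lambda>v g x. frechet_derivative g (at x) v) vs f differentiable_on UNIV)"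

definition test_functions :: "'a::euclidean_space set \<Rightarrow> ('a \<Rightarrow> real) set" where
  "test_functions U =
     {\<psi>. smooth \<psi> \<and> compact (closure {x. \<psi> x \<noteq> 0}) \<and> closure {x. \<psi> x \<noteq> 0} \<subseteq> U}"

definition locally_integrable_on :: "('a::euclidean_space \<Rightarrow> real) \<Rightarrow> 'a set \<Rightarrow> bool" where
  "locally_integrable_on f U \<longleftrightarrow> (\<forall>K. compact K \<and> K \<subseteq> U \<longrightarrow> set_integrable lebesgue K f)"

definition Lp_loc_on ::
  "real \<Rightarrow> ('a::euclidean_space \<Rightarrow> 'b::euclidean_space) \<Rightarrow> 'a set \<Rightarrow> bool" where
  "Lp_loc_on p f U \<longleftrightarrow> (\<forall>K. compact K \<and> K \<subseteq> U \<longrightarrow>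
     set_borel_measurable lebesgue K f \<and> set_integrable lebesgue K (\<lambda>x. norm (f x) powr p))"

definition ess_locally_bounded_on :: "('a::euclidean_space \<Rightarrow> real) \<Rightarrow> 'a set \<Rightarrow> bool" where
  "ess_locally_bounded_on f U \<longleftrightarrow>
     (\<forall>K. compact K \<and> K \<subseteq> U \<longrightarrow> (\<exists>C. AE x in lebesgue. x \<in> K \<longrightarrow> \<bar>f x\<bar> \<le> C))"

section \<open>The parabolic problem\<close>

text \<open>Functions of space and time are written \<open>u t z\<close>; on space-time they become functions of \<open>(z, t)\<close>.\<close>

abbreviation st :: "(real \<Rightarrow> 'a \<Rightarrow> real) \<Rightarrow> 'a \<times> real \<Rightarrow> real" where
  "st u \<equiv> \<lambda>w. u (snd w) (fst w)"

definition continuous_into_L1 ::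
  "(real \<Rightarrow> 'a::euclidean_space \<Rightarrow> real) \<Rightarrow> 'a set \<Rightarrow> real \<Rightarrow> bool" where
  "continuous_into_L1 u \<Omega> T \<longleftrightarrow>
     (\<forall>t\<in>{0..<T}. set_integrable lebesgue \<Omega> (u t) \<and>
        ((\<lambda>s. LINT z:\<Omega>|lebesgue. \<bar>u s z - u t z\<bar>) \<longlongrightarrow> 0) (at t within {0..<T}))"

definition initial_value_distr ::
  "(real \<Rightarrow> 'a::euclidean_space \<Rightarrow> real) \<Rightarrow> ('a \<Rightarrow> real) \<Rightarrow> 'a set \<Rightarrow> bool" where
  "initial_value_distr u u0 \<Omega> \<longleftrightarrow> locally_integrable_on u0 \<Omega> \<and>
     (\<forall>\<phi>\<in>test_functions \<Omega>.
        ((\<lambda>t. LINT z:\<Omega>|lebesgue. u t z * \<phi> z) \<longlongrightarrow> (LINT z:\<Omega>|lebesgue. u0 z * \<phi> z)) (at_right 0))"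

text \<open>\<open>G\<close> is the distributional \<open>\<nabla>\<^sub>\<gamma> u\<close> on the space-time set \<open>W\<close>. As \<open>|x|\<^sup>\<gamma>\<close> does not depend
  on \<open>y\<close>, each of \<open>X\<^sub>i\<close> and \<open>Y\<^sub>j\<close> is minus its own formal adjoint.\<close>

definition distr_grad_\<gamma> ::
  "real \<Rightarrow> (real \<Rightarrow> ('m::finite, 'k::finite) gpoint \<Rightarrow> real) \<Rightarrow>
   (('m, 'k) gpoint \<times> real \<Rightarrow> ('m, 'k) gpoint) \<Rightarrow> (('m, 'k) gpoint \<times> real) set \<Rightarrow> bool" where
  "distr_grad_\<gamma> \<gamma> u G W \<longleftrightarrow>
     (\<forall>\<psi>\<in>test_functions W.
        (LINT w:W|lebesgue. st u w *\<^sub>R grad_\<gamma> \<gamma> (\<lambda>z. \<psi> (z, snd w)) (fst w))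
          = - (LINT w:W|lebesgue. \<psi> w *\<^sub>R G w))"

text \<open>The equation \<open>\<partial>u/\<partial>t = \<nabla>\<^sub>\<gamma> \<cdot> (|G|\<^sup>p\<^sup>-\<^sup>2 G) + c V u\<^sup>p\<^sup>-\<^sup>1 + \<lambda> u\<^sup>q\<close> tested against \<open>C\<^sub>c\<^sup>\<infinity>(W)\<close>, where
  \<open>V\<close> is the potential and \<open>G\<close> the horizontal gradient of \<open>u\<close>. For \<open>p < 2\<close> the flux is read as \<open>0\<close>
  where \<open>G = 0\<close>.\<close>

definition distr_solution ::
  "real \<Rightarrow> real \<Rightarrow> real \<Rightarrow> real \<Rightarrow> real \<Rightarrow> real \<Rightarrow>
   (real \<Rightarrow> ('m::finite, 'k::finite) gpoint \<Rightarrow> real) \<Rightarrow>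
   (('m, 'k) gpoint \<times> real \<Rightarrow> ('m, 'k) gpoint) \<Rightarrow> (('m, 'k) gpoint \<times> real) set \<Rightarrow> bool" where
  "distr_solution \<gamma> p q c lam R u G W \<longleftrightarrow>
     (\<forall>\<psi>\<in>test_functions W.
        - (LINT w:W|lebesgue. st u w * deriv (\<lambda>t. \<psi> (fst w, t)) (snd w)) =
        - (LINT w:W|lebesgue.
             (norm (G w) powr (p - 2) *\<^sub>R G w) \<bullet> grad_\<gamma> \<gamma> (\<lambda>z. \<psi> (z, snd w)) (fst w))
        + (LINT w:W|lebesgue.
             (c * potential \<gamma> p R (fst w) * st u w powr (p - 1) + lam * st u w powr q) * \<psi> w))"

text \<open>Positivity and local boundedness are understood almost everywhere, since \<open>u t\<close> is an element
  of \<open>L\<^sup>1\<close>; local integrability of \<open>u\<close> on space-time (which contains joint measurability) makes it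
  a distribution. No notion of trace is attached to the boundary condition: it is
  the pointwise condition of the problem.\<close>

definition general_positive_local_solution ::
  "real \<Rightarrow> real \<Rightarrow> real \<Rightarrow> real \<Rightarrow> real \<Rightarrow> real \<Rightarrow>
   (('m::finite, 'k::finite) gpoint \<Rightarrow> real) \<Rightarrow> real \<Rightarrow>
   (real \<Rightarrow> ('m, 'k) gpoint \<Rightarrow> real) \<Rightarrow> bool" where
  "general_positive_local_solution \<gamma> p q c lam R u0 T u \<longleftrightarrow>
     (let \<Omega> = rho_ball \<gamma> R; W = \<Omega> \<times> {0<..<T} in
        0 < T \<and>
        continuous_into_L1 u \<Omega> T \<and>
        locally_integrable_on (st u) W \<and>
        (AE w in lebesgue. w \<in> W \<longrightarrow> 0 < st u w) \<and>
        ess_locally_bounded_on (st u) W \<and>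
        ess_locally_bounded_on (\<lambda>w. 1 / st u w) W \<and>
        initial_value_distr u u0 \<Omega> \<and>
        (\<exists>G. distr_grad_\<gamma> \<gamma> u G W \<and> Lp_loc_on p G W \<and> distr_solution \<gamma> p q c lam R u G W) \<and>
        (\<forall>z\<in>frontier \<Omega>. \<forall>t\<in>{0<..<T}. u t z = 0))"

end

theory Submission
  imports Defs
begin

text \<open>
  Test the equation with \<open>\<zeta> u\<^sup>1\<^sup>-\<^sup>p\<close>, where \<open>\<zeta>(z, t) = \<phi>(z)\<^sup>p \<eta>(t)\<close>. Picone's inequality (here Young's
  inequality applied to \<open>|G| \<phi> / u\<close>) bounds the diffusion term from below by \<open>- |\<nabla>\<^sub>\<gamma> \<phi>|\<^sup>p \<eta>\<close>, whatever
  \<open>u\<close> is, and the singular term becomes \<open>c V \<phi>\<^sup>p \<eta>\<close> because \<open>u\<^sup>p\<^sup>-\<^sup>1 u\<^sup>1\<^sup>-\<^sup>p = 1\<close>. Hence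
  \<open>(\<integral> \<eta>) (c \<integral> V \<phi>\<^sup>p - \<integral> |\<nabla>\<^sub>\<gamma> \<phi>|\<^sup>p)\<close> is at most
  \<open>\<integral> u\<^sup>2\<^sup>-\<^sup>p \<phi>\<^sup>p |\<eta>'| / (2 - p) + |\<lambda>| \<integral> u\<^sup>q\<^sup>-\<^sup>p\<^sup>+\<^sup>1 \<phi>\<^sup>p \<eta>\<close>. Both exponents of \<open>u\<close> lie in \<open>(0, 1]\<close>: the
  first as \<open>1 < p < 2\<close>, the second as \<open>q - p + 1 \<le> p / Q\<close> and \<open>Q \<ge> 2 > p\<close>. So the right-hand side is
  controlled by \<open>sup \<phi>\<^sup>p\<close> and by the integral of \<open>1 + u\<close> over \<open>B\<^sub>R\<close> and a compact time interval, which is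
  finite since \<open>u\<close> is continuous into \<open>L\<^sup>1\<close> (\<open>spacetime_integral_finite\<close>).

  It remains to find bounded \<open>\<phi>\<close> for which the left-hand side is arbitrarily large. With
  \<open>s = R - \<rho>\<close> and \<open>a = (p - 1) / p\<close> take \<open>\<phi> = (|x|\<^sup>2 - \<kappa>\<^sup>2)\<^sub>+ (s\<^sup>a - \<epsilon>\<^sup>a)\<^sub>+\<close>. Since
  \<open>|\<nabla>\<^sub>\<gamma> \<rho>| = (|x| / \<rho>)\<^sup>\<gamma>\<close> is the weight in \<open>V\<close>, for \<open>s\<close> much larger than \<open>\<epsilon>\<close> the integrand is, up to a
  bounded term, about \<open>(c - a\<^sup>p) / s\<close> times a positive weight, while the strip \<open>s \<approx> \<epsilon>\<close> costs a bounded amount. Because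
  \<open>c > a\<^sup>p\<close> and \<open>1 / s\<close> has infinite integral near the boundary, the left-hand side grows like
  \<open>log (1 / \<epsilon>)\<close> (\<open>hardy_energy_unbounded\<close>), while the right-hand side is bounded
  independently of \<open>\<epsilon>\<close>.

  The first factor of \<open>\<phi>\<close> keeps its support away from \<open>x = 0\<close>, where \<open>|x|\<^sup>\<gamma>\<close> need not be smooth. On that
  support the equation reads \<open>\<partial>\<^sub>t u = div H + f\<close> with \<open>H \<in> L\<^sup>p\<^sup>'\<close>, \<open>\<nabla> u = D \<in> L\<^sup>p\<close> and \<open>u\<close> bounded above and
  below. To use the test function \<open>\<zeta> u\<^sup>1\<^sup>-\<^sup>p\<close>, which is not smooth, mollify \<open>u\<close>, \<open>D\<close>, \<open>H\<close>, \<open>f\<close>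
  in space-time: the mollified functions satisfy the equation pointwise, the classical chain rule applies, and the
  product \<open>H \<bullet> D\<close> passes to the limit because mollification converges in \<open>L\<^sup>p\<close> and in \<open>L\<^sup>p\<^sup>'\<close>
  (\<open>weak_chain_rule\<close>, made applicable by \<open>solution_chain_rule\<close>).
\<close>

section \<open>Smooth bumps\<close>

text \<open>The functions \<open>P(1/t) exp(-1/t)\<close>, extended by \<open>0\<close> to \<open>t \<le> 0\<close>. Allowing an arbitrary polynomial
  \<open>P\<close> makes the class closed under differentiation, so that smoothness of
  all orders follows at once.\<close>
definition flat :: "real poly \<Rightarrow> real \<Rightarrow> real" where
  "flat P t = (if t > 0 then poly P (1 / t) * exp (- (1 / t)) else 0)"

lemma poly_times_exp_tendsto_0:
  fixes P :: "real poly"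
  shows "((\<lambda>x. poly P x * exp (- x)) \<longlongrightarrow> 0) at_top"
proof -
  have "((\<lambda>x. \<Sum>i\<le>degree P. coeff P i * (x ^ i / exp x)) \<longlongrightarrow> (\<Sum>i\<le>degree P. coeff P i * 0)) at_top"
    by (intro tendsto_intros tendsto_power_div_exp_0)
  also have "(\<lambda>x. \<Sum>i\<le>degree P. coeff P i * (x ^ i / exp x)) = (\<lambda>x. poly P x * exp (- x))"
    by (auto simp: poly_altdef sum_divide_distrib exp_minus divide_inverse sum_distrib_right mult.assoc intro!: sum.cong)
  finally show ?thesis by simp
qed

lemma flat_tendsto_0: "(flat P \<longlongrightarrow> 0) (at 0)"
proof -
  have "((\<lambda>t. poly P (1 / t) * exp (- (1 / t))) \<longlongrightarrow> 0) (at_right 0)"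
    using filterlim_compose[OF poly_times_exp_tendsto_0 filterlim_inverse_at_top_right]
    by (simp add: inverse_eq_divide)
  moreover have "\<forall>\<^sub>F t in at_right 0. poly P (1 / t) * exp (- (1 / t)) = flat P t"
    by (auto simp: eventually_at_filter flat_def)
  ultimately have r: "(flat P \<longlongrightarrow> 0) (at_right 0)"
    by (rule Lim_transform_eventually)
  have "\<forall>\<^sub>F t in at_left 0. 0 = flat P t"
    by (auto simp: eventually_at_filter flat_def)
  then have l: "(flat P \<longlongrightarrow> 0) (at_left 0)"
    by (rule Lim_transform_eventually[OF tendsto_const])
  show ?thesis using l r filterlim_split_at by blast
qed

lemma DERIV_flat:
  "(flat P has_real_derivative flat ([:0, 0, 1:] * (P - pderiv P)) t) (at t)"
proof (cases t "0 :: real" rule: linorder_cases)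
  case less
  have "((\<lambda>_. 0) has_real_derivative 0) (at t)" by simp
  then have "(flat P has_real_derivative 0) (at t)"
    by (rule has_field_derivative_transform_within_open[where S="{..<0}"])
       (use less in \<open>auto simp: flat_def\<close>)
  then show ?thesis using less by (simp add: flat_def)
next
  case equal
  have "\<forall>\<^sub>F h in at 0. flat ([:0, 1:] * P) h = (flat P (0 + h) - flat P 0) / h"
    by (auto simp: eventually_at_filter flat_def)
  from Lim_transform_eventually[OF flat_tendsto_0 this]
  have "(flat P has_real_derivative 0) (at 0)" by (simp add: DERIV_def)
  then show ?thesis using equal by (simp add: flat_def)
next
  case greater
  have "((\<lambda>t. poly P (1 / t) * exp (- (1 / t))) has_real_derivative
     flat ([:0, 0, 1:] * (P - pderiv P)) t) (at t)"
    using greater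
    by (auto intro!: derivative_eq_intros simp: flat_def field_simps power2_eq_square)
  then show ?thesis
    by (rule has_field_derivative_transform_within_open[where S="{0<..}"])
       (use greater in \<open>auto simp: flat_def\<close>)
qed

text \<open>An algebra of functions that contains the bumps around \<open>w0\<close>, multiplied by any power of
  \<open>|\<pi> w|\<close>, and all their directional derivatives. The powers are needed to test the weak gradient in the degenerate
  directions, where the coefficient \<open>|x|\<^sup>\<gamma>\<close> has to be divided out.\<close>
inductive tame :: "('e::euclidean_space \<Rightarrow> 'b::euclidean_space) \<Rightarrow> 'e \<Rightarrow> real \<Rightarrow> ('e \<Rightarrow> real) \<Rightarrow> bool"
  for \<pi> w0 r where
  const: "tame \<pi> w0 r (\<lambda>_. c)"
| linear: "tame \<pi> w0 r (\<lambda>w. w \<bullet> v)"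
| proj: "tame \<pi> w0 r (\<lambda>w. \<pi> w \<bullet> v)"
| bump: "tame \<pi> w0 r (\<lambda>w. norm (\<pi> w) powr s * flat P (r\<^sup>2 - (w - w0) \<bullet> (w - w0)))"
| add: "tame \<pi> w0 r f \<Longrightarrow> tame \<pi> w0 r g \<Longrightarrow> tame \<pi> w0 r (\<lambda>w. f w + g w)"
| mult: "tame \<pi> w0 r f \<Longrightarrow> tame \<pi> w0 r g \<Longrightarrow> tame \<pi> w0 r (\<lambda>w. f w * g w)"

text \<open>The power of \<open>|\<pi> w|\<close> is singular only where \<open>\<pi> w = 0\<close>, and there the bump vanishes in a whole
  neighbourhood because the ball of radius \<open>r\<close> avoids the kernel of \<open>\<pi>\<close>.\<close>
lemma has_derivative_bump:
  fixes \<pi> :: "'e::euclidean_space \<Rightarrow> 'b::euclidean_space"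
  assumes \<pi>: "bounded_linear \<pi>" and nz: "\<And>w. \<pi> w = 0 \<Longrightarrow> r\<^sup>2 < (w - w0) \<bullet> (w - w0)"
  shows "((\<lambda>w. norm (\<pi> w) powr s * flat P (r\<^sup>2 - (w - w0) \<bullet> (w - w0))) has_derivative
     (\<lambda>v. s * (\<pi> w \<bullet> \<pi> v) * (norm (\<pi> w) powr (s - 2) * flat P (r\<^sup>2 - (w - w0) \<bullet> (w - w0)))
        - 2 * ((w - w0) \<bullet> v) * (norm (\<pi> w) powr s *
             flat ([:0, 0, 1:] * (P - pderiv P)) (r\<^sup>2 - (w - w0) \<bullet> (w - w0))))) (at w)"
proof (cases "\<pi> w = 0")
  case True
  have "open {w. r\<^sup>2 < (w - w0) \<bullet> (w - w0)}"
    by (intro open_Collect_less continuous_intros)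
  then have "((\<lambda>w. norm (\<pi> w) powr s * flat P (r\<^sup>2 - (w - w0) \<bullet> (w - w0))) has_derivative (\<lambda>_. 0)) (at w)"
    by (rule has_derivative_transform_within_open[OF has_derivative_const])
       (use nz[OF True] in \<open>auto simp: flat_def\<close>)
  then show ?thesis using True nz[OF True] by (simp add: flat_def)
next
  case False
  have 1: "((\<lambda>w. flat P (r\<^sup>2 - (w - w0) \<bullet> (w - w0))) has_derivative
     (\<lambda>v. - 2 * ((w - w0) \<bullet> v) * flat ([:0, 0, 1:] * (P - pderiv P)) (r\<^sup>2 - (w - w0) \<bullet> (w - w0)))) (at w)"
    by (rule has_derivative_eq_rhs, rule DERIV_compose_FDERIV[OF DERIV_flat])
       (auto intro!: derivative_eq_intros simp: inner_commute algebra_simps)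
  have \<pi>': "(\<pi> has_derivative \<pi>) (at w)" using \<pi> by (rule bounded_linear_imp_has_derivative)
  have e: "norm z powr s = (z \<bullet> z) powr (s / 2)" for z :: 'b and s
    by (simp add: norm_eq_sqrt_inner powr_half_sqrt[symmetric] powr_powr)
  have "0 < \<pi> w \<bullet> \<pi> w" using False by simp
  then have "((\<lambda>w. (\<pi> w \<bullet> \<pi> w) powr (s / 2)) has_derivative
     (\<lambda>v. 2 * (\<pi> w \<bullet> \<pi> v) * (s / 2 * (\<pi> w \<bullet> \<pi> w) powr (s / 2 - 1)))) (at w)"
    by - (rule has_derivative_eq_rhs, rule DERIV_compose_FDERIV[where f="\<lambda>x. x powr (s / 2)"],
      rule has_real_derivative_powr, simp, auto intro!: derivative_eq_intros \<pi>' simp: inner_commute)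
  then have 2: "((\<lambda>w. norm (\<pi> w) powr s) has_derivative
     (\<lambda>v. s * (\<pi> w \<bullet> \<pi> v) * norm (\<pi> w) powr (s - 2))) (at w)"
    unfolding e by (simp add: diff_divide_distrib algebra_simps)
  show ?thesis
    by (rule has_derivative_eq_rhs, rule has_derivative_mult[OF 2 1]) (simp add: fun_eq_iff algebra_simps)
qed

lemma tame_derivative:
  fixes \<pi> :: "'e::euclidean_space \<Rightarrow> 'b::euclidean_space"
  assumes \<pi>: "bounded_linear \<pi>" and nz: "\<And>w. \<pi> w = 0 \<Longrightarrow> r\<^sup>2 < (w - w0) \<bullet> (w - w0)"
    and f: "tame \<pi> w0 r f"
  shows "\<exists>f'. (\<forall>w. (f has_derivative f' w) (at w)) \<and> (\<forall>v. tame \<pi> w0 r (\<lambda>w. f' w v))"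
  using f
proof induction
  case (const c)
  show ?case by (rule exI[of _ "\<lambda>_ _. 0"]) (auto intro: tame.const)
next
  case (linear v)
  show ?case
    by (rule exI[of _ "\<lambda>_ h. h \<bullet> v"]) (auto intro!: tame.const derivative_eq_intros)
next
  case (proj v)
  show ?case
    by (rule exI[of _ "\<lambda>_ h. \<pi> h \<bullet> v"])
       (auto intro!: tame.const derivative_eq_intros bounded_linear_imp_has_derivative[OF \<pi>])
next
  case (bump s P)
  have a: "tame \<pi> w0 r (\<lambda>w. s * (\<pi> w \<bullet> \<pi> v) * (norm (\<pi> w) powr (s - 2) * flat P (r\<^sup>2 - (w - w0) \<bullet> (w - w0)))
        + ((-2) * (w \<bullet> v) + 2 * (w0 \<bullet> v)) * (norm (\<pi> w) powr s *
             flat ([:0, 0, 1:] * (P - pderiv P)) (r\<^sup>2 - (w - w0) \<bullet> (w - w0))))" for v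
    by (intro tame.intros)
  show ?case
    apply (rule exI, rule conjI, rule allI, rule has_derivative_bump[OF \<pi> nz], assumption)
    using a by (simp add: algebra_simps)
next
  case (add f g)
  then obtain f' g' where "\<forall>w. (f has_derivative f' w) (at w)" "\<forall>v. tame \<pi> w0 r (\<lambda>w. f' w v)"
    "\<forall>w. (g has_derivative g' w) (at w)" "\<forall>v. tame \<pi> w0 r (\<lambda>w. g' w v)" by blast
  then show ?case
    by (intro exI[of _ "\<lambda>w v. f' w v + g' w v"]) (auto intro!: derivative_eq_intros tame.add)
next
  case (mult f g)
  then obtain f' g' where *: "\<forall>w. (f has_derivative f' w) (at w)" "\<forall>v. tame \<pi> w0 r (\<lambda>w. f' w v)"
    "\<forall>w. (g has_derivative g' w) (at w)" "\<forall>v. tame \<pi> w0 r (\<lambda>w. g' w v)" by blast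
  show ?case
    by (rule exI[of _ "\<lambda>w v. f w * g' w v + f' w v * g w"])
       (use * mult.hyps in \<open>auto intro!: has_derivative_mult tame.add tame.mult\<close>)
qed

text \<open>Closure under directional derivatives gives all orders by induction on the list of directions.\<close>
lemma tame_smooth:
  fixes \<pi> :: "'e::euclidean_space \<Rightarrow> 'b::euclidean_space"
  assumes \<pi>: "bounded_linear \<pi>" and nz: "\<And>w. \<pi> w = 0 \<Longrightarrow> r\<^sup>2 < (w - w0) \<bullet> (w - w0)"
    and f: "tame \<pi> w0 r f"
  shows "smooth f"
proof -
  have "tame \<pi> w0 r (foldr (\<lambda>v g x. frechet_derivative g (at x) v) vs f)" for vs
  proof (induction vs)
    case Nil
    then show ?case using f by simp
  next
    case (Cons v vs)
    obtain f' where f': "\<forall>w. (foldr (\<lambda>v g x. frechet_derivative g (at x) v) vs f has_derivative f' w) (at w)"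
      "\<forall>v. tame \<pi> w0 r (\<lambda>w. f' w v)"
      using tame_derivative[OF \<pi> nz Cons] by blast
    have "foldr (\<lambda>v g x. frechet_derivative g (at x) v) (v # vs) f = (\<lambda>w. f' w v)"
      using frechet_derivative_at[OF f'(1)[rule_format]] by (simp add: fun_eq_iff)
    then show ?case using f'(2) by simp
  qed
  then show ?thesis
    unfolding smooth_def differentiable_on_def
    using tame_derivative[OF \<pi> nz] by (meson differentiable_at_withinI differentiable_def)
qed

section \<open>Translation and mollification in \<open>L\<^sup>s\<close>\<close>
lemma lborel_distr_minus:
  fixes c :: "'a::euclidean_space"
  shows "distr lborel borel (\<lambda>x. x - c) = lborel" "distr lborel borel (\<lambda>x. c - x) = lborel"
proof -
  have "(+) (- c) = (\<lambda>x. x - c)" by auto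
  then show "distr lborel borel (\<lambda>x. x - c) = lborel" using lborel_distr_plus[of "- c"] by simp
  show "distr lborel borel (\<lambda>x. c - x) = lborel"
    using lborel_affine[of "-1" c] by (simp add: density_1)
qed

lemma
  fixes g :: "'a::euclidean_space \<Rightarrow> 'b::{banach, second_countable_topology}"
  assumes [measurable]: "g \<in> borel_measurable borel"
  shows integrable_lborel_translate: "integrable lborel (\<lambda>x. g (x - c)) \<longleftrightarrow> integrable lborel g"
    and integral_lborel_translate: "(LINT x|lborel. g (x - c)) = (LINT x|lborel. g x)"
    and integrable_lborel_reflect: "integrable lborel (\<lambda>x. g (c - x)) \<longleftrightarrow> integrable lborel g"
    and integral_lborel_reflect: "(LINT x|lborel. g (c - x)) = (LINT x|lborel. g x)"
  using integrable_distr_eq[of "\<lambda>x. x - c" lborel borel g] integral_distr[of "\<lambda>x. x - c" lborel borel g]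
    integrable_distr_eq[of "\<lambda>x. c - x" lborel borel g] integral_distr[of "\<lambda>x. c - x" lborel borel g]
  by (simp_all add: lborel_distr_minus)

lemma finite_measure_inner_compact:
  fixes A :: "'a::euclidean_space set"
  assumes A: "A \<in> sets lborel" "emeasure lborel A < \<infinity>" and e: "0 < (e::real)"
  obtains K where "compact K" "K \<subseteq> A" "measure lborel (A - K) < e"
proof -
  have fin: "emeasure lborel B < \<infinity>" if "B \<subseteq> A" for B
    using A emeasure_mono[OF that, of lborel] by (auto intro: order.strict_trans1)
  have "(\<lambda>n. measure lborel (A - cball 0 (real n))) \<longlonglongrightarrow> measure lborel (\<Inter>n. A - cball 0 (real n))"
  proof (rule Lim_measure_decseq)
    show "decseq (\<lambda>n. A - cball 0 (real n))" by (force simp: decseq_def)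
    show "range (\<lambda>n. A - cball 0 (real n)) \<subseteq> sets lborel" using A by auto
    show "emeasure lborel (A - cball 0 (real n)) \<noteq> \<infinity>" for n
      using fin[of "A - cball 0 (real n)"] by auto
  qed
  also have "(\<Inter>n. A - cball 0 (real n)) = {}"
    using real_arch_simple by auto
  finally have "\<forall>\<^sub>F n in sequentially. measure lborel (A - cball 0 (real n)) < e / 2"
    using e by (intro order_tendstoD(2)[of _ 0]) auto
  then obtain n where n: "measure lborel (A - cball 0 (real n)) < e / 2"
    by (auto simp: eventually_sequentially)
  let ?B = "A \<inter> cball 0 (real n)"
  have B: "?B \<in> sets lebesgue" using A by auto
  obtain T where T: "closed T" "T \<subseteq> ?B" "?B - T \<in> lmeasurable" "emeasure lebesgue (?B - T) < ennreal (e / 2)"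
    using sets_lebesgue_inner_closed[OF B, of "e / 2"] e by auto
  have "measure lborel (?B - T) < e / 2"
  proof -
    have b: "?B - T \<in> sets lborel" using A T by auto
    have "emeasure lborel (?B - T) < ennreal (e / 2)" using T(4) b by simp
    moreover have "emeasure lborel (?B - T) = ennreal (measure lborel (?B - T))"
      using fin[of "?B - T"] by (intro emeasure_eq_ennreal_measure) (auto simp: subset_eq)
    ultimately show ?thesis by (simp add: ennreal_less_iff)
  qed
  moreover have "measure lborel (A - T) \<le> measure lborel (A - cball 0 (real n)) + measure lborel (?B - T)"
  proof -
    have "A - T = (A - cball 0 (real n)) \<union> (?B - T)" using T by auto
    then show ?thesis
      using measure_Un_le[of "A - cball 0 (real n)" lborel "?B - T"] A T by auto
  qed
  ultimately have "measure lborel (A - T) < e" using n by simp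
  moreover have "compact T"
    using T bounded_subset[OF bounded_cball[of 0 "real n"], of T] by (auto simp: compact_eq_bounded_closed)
  ultimately show ?thesis using T that[of T] by auto
qed

text \<open>Squeeze \<open>A\<close> between a compact set and an open set of almost the same measure: a small translation keeps
  the compact set inside the open set, so \<open>A\<close> and its translate differ only within the two thin differences.\<close>
lemma translation_L1_indicator:
  fixes A :: "'a::euclidean_space set"
  assumes A: "A \<in> sets lborel" "emeasure lborel A < \<infinity>" and e: "0 < (e::real)"
  shows "\<exists>d>0. \<forall>h. norm h < d \<longrightarrow> (LINT w|lborel. \<bar>indicator A (w - h) - indicator A w :: real\<bar>) < e"
proof -
  have [measurable]: "A \<in> sets borel" using A by simp
  obtain K where K: "compact K" "K \<subseteq> A" "measure lborel (A - K) < e / 4"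
    using finite_measure_inner_compact[OF A, of "e / 4"] e by auto
  obtain U where U: "open U" "A \<subseteq> U" "emeasure lborel (U - A) < ennreal (e / 4)"
    using outer_regular_lborel[of A "e / 4"] A e by auto
  have [measurable]: "K \<in> sets borel" "U \<in> sets borel"
    using K U by (auto simp: borel_closed compact_imp_closed)
  have fU: "emeasure lborel (U - A) < \<infinity>" using U(3) by (rule order.strict_trans) simp
  have mU: "measure lborel (U - A) < e / 4"
    using U(3) fU e by (simp add: emeasure_eq_ennreal_measure ennreal_less_iff)
  have fK: "emeasure lborel (A - K) < \<infinity>"
    using A emeasure_mono[of "A - K" A lborel] by (auto intro: order.strict_trans1)
  obtain d where d: "d > 0" "(\<Union>x\<in>K. ball x d) \<subseteq> U"
    using compact_subset_open_imp_ball_epsilon_subset[OF K(1) U(1)] K U by blast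
  let ?P = "\<lambda>w. indicator (A - K) w + indicator (U - A) w :: real"
  have P: "integrable lborel ?P"
    using fU fK by (intro Bochner_Integration.integrable_add integrable_real_indicator) auto
  have iP: "(LINT w|lborel. ?P w) < e / 2"
    using fU fK K mU by (subst Bochner_Integration.integral_add) auto
  have "(LINT w|lborel. \<bar>indicator A (w - h) - indicator A w :: real\<bar>) < e" if h: "norm h < d" for h
  proof -
    have U1: "w \<in> U" if "w - h \<in> K" for w
    proof -
      have "w \<in> ball (w - h) d" using h by (simp add: dist_norm)
      then show ?thesis using d(2) that by blast
    qed
    have U2: "w - h \<in> U" if "w \<in> K" for w
    proof -
      have "w - h \<in> ball w d" using h by (simp add: dist_norm)
      then show ?thesis using d(2) that by blast
    qed
    have "\<bar>indicator A (w - h) - indicator A w :: real\<bar> \<le> ?P (w - h) + ?P w" for w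
      using U1[of w] U2[of w] K U by (auto simp: indicator_def)
    then have "(LINT w|lborel. \<bar>indicator A (w - h) - indicator A w :: real\<bar>) \<le> (LINT w|lborel. ?P (w - h) + ?P w)"
      using P integrable_lborel_translate[of ?P h]
      by (intro integral_mono'[OF Bochner_Integration.integrable_add[of _ "\<lambda>w. ?P (w - h)" ?P]]) auto
    also have "\<dots> = 2 * (LINT w|lborel. ?P w)"
      using P integrable_lborel_translate[of ?P h] integral_lborel_translate[of ?P h]
      by (subst Bochner_Integration.integral_add) auto
    finally show ?thesis using iP by simp
  qed
  then show ?thesis using d by auto
qed

lemma translation_L1:
  fixes g :: "'a::euclidean_space \<Rightarrow> 'b::{banach, second_countable_topology}"
  assumes "integrable lborel g"
  shows "\<forall>e>0. \<exists>d>0. \<forall>h. norm h < d \<longrightarrow> (LINT w|lborel. norm (g (w - h) - g w)) < e"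
  using assms
proof induction
  case (base A c)
  show ?case
  proof (intro allI impI)
    fix e :: real assume "e > 0"
    then have "e / (norm c + 1) > 0" by (simp add: add_nonneg_pos)
    from translation_L1_indicator[OF base this] obtain d where d: "d > 0"
      "\<And>h. norm h < d \<Longrightarrow> (LINT w|lborel. \<bar>indicator A (w - h) - indicator A w :: real\<bar>) < e / (norm c + 1)"
      by blast
    have "(LINT w|lborel. norm (indicator A (w - h) *\<^sub>R c - indicator A w *\<^sub>R c)) < e" if "norm h < d" for h
    proof -
      have "(LINT w|lborel. norm (indicator A (w - h) *\<^sub>R c - indicator A w *\<^sub>R c))
        = (LINT w|lborel. \<bar>indicator A (w - h) - indicator A w :: real\<bar>) * norm c"
        by (subst integral_mult_left_zero[symmetric]) (simp flip: scaleR_diff_left)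
      also have "\<dots> \<le> e / (norm c + 1) * norm c"
        using d(2)[OF that] by (intro mult_right_mono) auto
      also have "\<dots> = e * (norm c / (norm c + 1))" by simp
      also have "\<dots> < e * 1"
        using \<open>e > 0\<close> by (intro mult_strict_left_mono) (auto simp: add_nonneg_pos)
      also have "e * 1 = e" by simp
      finally show ?thesis .
    qed
    then show "\<exists>d>0. \<forall>h. norm h < d \<longrightarrow>
        (LINT w|lborel. norm (indicator A (w - h) *\<^sub>R c - indicator A w *\<^sub>R c)) < e"
      using d(1) by blast
  qed
next
  case (add f g)
  have [measurable]: "f \<in> borel_measurable borel" "g \<in> borel_measurable borel"
    using add.hyps by (auto dest: borel_measurable_integrable)
  show ?case
  proof (intro allI impI)
    fix e :: real assume "e > 0"
    then have "e / 2 > 0" by simp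
    from add.IH(1)[rule_format, OF this] add.IH(2)[rule_format, OF this]
    obtain d1 d2 where d: "d1 > 0" "d2 > 0"
      "\<And>h. norm h < d1 \<Longrightarrow> (LINT w|lborel. norm (f (w - h) - f w)) < e / 2"
      "\<And>h. norm h < d2 \<Longrightarrow> (LINT w|lborel. norm (g (w - h) - g w)) < e / 2"
      by blast
    have "(LINT w|lborel. norm (f (w - h) + g (w - h) - (f w + g w))) < e" if "norm h < min d1 d2" for h
    proof -
      have i: "integrable lborel (\<lambda>w. norm (f (w - h) - f w))" "integrable lborel (\<lambda>w. norm (g (w - h) - g w))"
        using add.hyps integrable_lborel_translate[of f h] integrable_lborel_translate[of g h] by auto
      have "(LINT w|lborel. norm (f (w - h) + g (w - h) - (f w + g w)))
         \<le> (LINT w|lborel. norm (f (w - h) - f w) + norm (g (w - h) - g w))"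
        using i by (intro integral_mono')
          (auto intro: norm_diff_triangle_ineq)
      also have "\<dots> = (LINT w|lborel. norm (f (w - h) - f w)) + (LINT w|lborel. norm (g (w - h) - g w))"
        using i by simp
      finally show ?thesis using d(3,4)[of h] that by simp
    qed
    then show "\<exists>d>0. \<forall>h. norm h < d \<longrightarrow>
        (LINT w|lborel. norm (f (w - h) + g (w - h) - (f w + g w))) < e"
      using d(1,2) by (intro exI[of _ "min d1 d2"]) auto
  qed
next
  case (lim f s)
  have [measurable]: "f \<in> borel_measurable borel" "s i \<in> borel_measurable borel" for i
    using lim.hyps by (auto dest: borel_measurable_integrable)
  have "(\<lambda>i. LINT w|lborel. norm (s i w - f w)) \<longlonglongrightarrow> (LINT w|lborel. norm (f w - f w))"
  proof (rule integral_dominated_convergence[where w="\<lambda>w. 3 * norm (f w)"])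
    show "AE x in lborel. (\<lambda>i. norm (s i x - f x)) \<longlonglongrightarrow> norm (f x - f x)"
      using lim.hyps(2) by (intro AE_I2 tendsto_intros) auto
    show "AE x in lborel. norm (norm (s i x - f x)) \<le> 3 * norm (f x)" for i
    proof (rule AE_I2)
      fix x :: 'a
      show "norm (norm (s i x - f x)) \<le> 3 * norm (f x)"
        using lim.hyps(3)[of x i] norm_triangle_ineq4[of "s i x" "f x"] by simp
    qed
  qed (use lim.hyps in auto)
  then have c: "(\<lambda>i. LINT w|lborel. norm (s i w - f w)) \<longlonglongrightarrow> 0" by simp
  show ?case
  proof (intro allI impI)
    fix e :: real assume "e > 0"
    then have "\<forall>\<^sub>F i in sequentially. (LINT w|lborel. norm (s i w - f w)) < e / 3"
      using c by (intro order_tendstoD(2)) auto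
    then obtain i where i: "(LINT w|lborel. norm (s i w - f w)) < e / 3"
      by (auto simp: eventually_sequentially)
    obtain d where d: "d > 0" "\<And>h. norm h < d \<Longrightarrow> (LINT w|lborel. norm (s i (w - h) - s i w)) < e / 3"
      using lim.IH[of i, rule_format, of "e / 3"] \<open>e > 0\<close> by auto
    have "(LINT w|lborel. norm (f (w - h) - f w)) < e" if "norm h < d" for h
    proof -
      let ?D = "\<lambda>w. norm (s i w - f w)"
      have D: "integrable lborel ?D" "integrable lborel (\<lambda>w. ?D (w - h))"
        "integrable lborel (\<lambda>w. norm (s i (w - h) - s i w))"
        using lim.hyps integrable_lborel_translate[of f h] integrable_lborel_translate[of "s i" h] by auto
      have "norm (f (w - h) - f w) \<le> ?D (w - h) + norm (s i (w - h) - s i w) + ?D w" for w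
      proof -
        have "f (w - h) - f w = (f (w - h) - s i (w - h)) + (s i (w - h) - s i w) + (s i w - f w)" by simp
        also have "norm \<dots> \<le> norm (f (w - h) - s i (w - h)) + norm (s i (w - h) - s i w) + norm (s i w - f w)"
          by (rule norm_triangle_le[OF add_right_mono[OF norm_triangle_ineq]])
        finally show ?thesis by (simp add: norm_minus_commute)
      qed
      then have "(LINT w|lborel. norm (f (w - h) - f w))
         \<le> (LINT w|lborel. ?D (w - h) + norm (s i (w - h) - s i w) + ?D w)"
        using D by (intro integral_mono' Bochner_Integration.integrable_add) auto
      also have "\<dots> = (LINT w|lborel. ?D w) + (LINT w|lborel. norm (s i (w - h) - s i w)) + (LINT w|lborel. ?D w)"
        using D integral_lborel_translate[of ?D h]
        by (simp add: Bochner_Integration.integral_add Bochner_Integration.integrable_add)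
      finally show ?thesis using d(2)[OF that] i by simp
    qed
    then show "\<exists>d>0. \<forall>h. norm h < d \<longrightarrow> (LINT w|lborel. norm (f (w - h) - f w)) < e"
      using d(1) by blast
  qed
qed

lemma powr_add3_le:
  fixes x y z s :: real
  assumes "0 \<le> x" "0 \<le> y" "0 \<le> z" "0 \<le> s"
  shows "(x + y + z) powr s \<le> 3 powr s * (x powr s + y powr s + z powr s)"
proof -
  have "(x + y + z) powr s \<le> (3 * max x (max y z)) powr s"
    using assms by (intro powr_mono2) auto
  also have "\<dots> = 3 powr s * max x (max y z) powr s" using assms by (simp add: powr_mult)
  also have "max x (max y z) powr s \<le> x powr s + y powr s + z powr s"
    by (auto simp: max_def)
  finally show ?thesis by (simp add: mult_left_mono)
qed

text \<open>Reduction to \<open>s = 1\<close>: the part of \<open>g\<close> above a high level is small in \<open>L\<^sup>s\<close>, and a difference of two values below the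
  level \<open>M/2\<close> has its power bounded by \<open>M\<^sup>s\<^sup>-\<^sup>1\<close> times the first power.\<close>
lemma translation_Ls:
  fixes g :: "'a::euclidean_space \<Rightarrow> 'b::{banach, second_countable_topology}"
  assumes g: "integrable lborel g" and gs: "integrable lborel (\<lambda>w. norm (g w) powr s)" and s: "1 \<le> s"
    and e: "e > 0"
  shows "\<exists>d>0. \<forall>h. norm h < d \<longrightarrow> (\<integral>\<^sup>+w. ennreal (norm (g (w - h) - g w) powr s) \<partial>lborel) < ennreal e"
proof -
  have [measurable]: "g \<in> borel_measurable borel" using g by (auto dest: borel_measurable_integrable)
  let ?g1 = "\<lambda>n w. if norm (g w) \<le> real n then g w else 0"
  let ?g2 = "\<lambda>n w. norm (g w - ?g1 n w) powr s"
  have g2i: "integrable lborel (?g2 n)" for n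
    by (rule Bochner_Integration.integrable_bound[OF gs]) (auto intro!: AE_I2)
  have "(\<lambda>n. LINT w|lborel. ?g2 n w) \<longlonglongrightarrow> (LINT w|(lborel::'a measure). 0)"
  proof (rule integral_dominated_convergence[where w="\<lambda>w. norm (g w) powr s"])
    show "AE x in lborel. (\<lambda>n. ?g2 n x) \<longlonglongrightarrow> 0"
    proof (rule AE_I2)
      fix x
      obtain N where N: "norm (g x) \<le> real N" using real_arch_simple by blast
      have "\<forall>\<^sub>F n in sequentially. 0 = ?g2 n x"
        using eventually_ge_at_top[of N] by eventually_elim (use N s in auto)
      then show "(\<lambda>n. ?g2 n x) \<longlonglongrightarrow> 0" by (rule Lim_transform_eventually[OF tendsto_const])
    qed
  qed (use gs in auto)
  then have "\<forall>\<^sub>F n in sequentially. (LINT w|lborel. ?g2 n w) < e / (4 * 3 powr s)"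
    using e by (intro order_tendstoD(2)[of _ 0]) auto
  then obtain n where n: "(LINT w|lborel. ?g2 n w) < e / (4 * 3 powr s)"
    by (auto simp: eventually_sequentially)
  \<comment> \<open>Two values below the level \<open>n\<close> differ by at most \<open>2 n\<close>; the summand \<open>1\<close> keeps \<open>M\<close> positive.\<close>
  define M where "M = 2 * (real n + 1)"
  have M: "M > 0" by (simp add: M_def)
  have g1i: "integrable lborel (?g1 n)"
    by (rule Bochner_Integration.integrable_bound[OF g]) auto
  have "e / (4 * 3 powr s * M powr (s - 1)) > 0" using e M by simp
  from translation_L1[OF g1i, rule_format, OF this] obtain d where d: "d > 0"
    "\<And>h. norm h < d \<Longrightarrow> (LINT w|lborel. norm (?g1 n (w - h) - ?g1 n w)) < e / (4 * 3 powr s * M powr (s - 1))"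
    by blast
  have "(\<integral>\<^sup>+w. ennreal (norm (g (w - h) - g w) powr s) \<partial>lborel) < ennreal e" if h: "norm h < d" for h
  proof -
    let ?D = "\<lambda>w. M powr (s - 1) * norm (?g1 n (w - h) - ?g1 n w)"
    let ?F = "\<lambda>w. 3 powr s * (?g2 n (w - h) + ?D w + ?g2 n w)"
    have Di: "integrable lborel ?D"
      using g1i integrable_lborel_translate[of "?g1 n" h] by auto
    have g2h: "integrable lborel (\<lambda>w. ?g2 n (w - h))"
      using g2i[of n] by (subst integrable_lborel_translate[of "?g2 n"]) auto
    have Fi: "integrable lborel ?F" using Di g2i[of n] g2h by auto
    have "norm (g (w - h) - g w) powr s \<le> ?F w" for w
    proof -
      let ?x = "norm (g (w - h) - ?g1 n (w - h))" and ?y = "norm (?g1 n (w - h) - ?g1 n w)" and ?z = "norm (g w - ?g1 n w)"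
      have tri: "norm (a - d) \<le> norm (a - b) + norm (b - c) + norm (d - c)" for a b c d :: 'b
      proof -
        have "a - d = (a - b) + (b - c) - (d - c)" by simp
        then show ?thesis
          using norm_triangle_ineq4[of "(a - b) + (b - c)" "d - c"] norm_triangle_ineq[of "a - b" "b - c"] by simp
      qed
      have "norm (g (w - h) - g w) \<le> ?x + ?y + ?z" by (rule tri)
      then have "norm (g (w - h) - g w) powr s \<le> (?x + ?y + ?z) powr s"
        using s by (intro powr_mono2) auto
      also have "\<dots> \<le> 3 powr s * (?x powr s + ?y powr s + ?z powr s)"
        using s by (intro powr_add3_le) auto
      also have "?y powr s \<le> ?D w"
      proof (cases "?y = 0")
        case False
        have "?y \<le> M" unfolding M_def
          by (rule order_trans[OF norm_triangle_ineq4]) auto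
        then have "?y powr (s - 1) \<le> M powr (s - 1)" using s by (intro powr_mono2) auto
        then have "?y powr (s - 1) * ?y \<le> ?D w" by (intro mult_right_mono) auto
        moreover have "?y powr s = ?y powr (s - 1) * ?y powr 1"
          by (subst powr_add[symmetric]) simp
        ultimately show ?thesis using False by simp
      qed (use s in simp)
      finally show ?thesis by (simp add: mult_left_mono)
    qed
    then have 1: "(\<integral>\<^sup>+w. ennreal (norm (g (w - h) - g w) powr s) \<partial>lborel) \<le> (\<integral>\<^sup>+w. ennreal (?F w) \<partial>lborel)"
      by (intro nn_integral_mono ennreal_leI) auto
    have 2: "(\<integral>\<^sup>+w. ennreal (?F w) \<partial>lborel) = ennreal (LINT w|lborel. ?F w)"
      by (rule nn_integral_eq_integral[OF Fi]) auto
    have "(LINT w|lborel. ?g2 n (w - h)) = (LINT w|lborel. ?g2 n w)"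
      by (rule integral_lborel_translate[of "?g2 n"]) auto
    then have "(LINT w|lborel. ?F w) = 3 powr s * ((LINT w|lborel. ?g2 n w) +
        M powr (s - 1) * (LINT w|lborel. norm (?g1 n (w - h) - ?g1 n w)) + (LINT w|lborel. ?g2 n w))"
      using g2h Di g2i[of n] by simp
    also have "\<dots> < 3 powr s * (e / (4 * 3 powr s) + M powr (s - 1) * (e / (4 * 3 powr s * M powr (s - 1))) + e / (4 * 3 powr s))"
      using n d(2)[OF h] M by (intro mult_strict_left_mono add_strict_mono) auto
    also have "\<dots> \<le> e" using e M by (simp add: field_simps)
    finally have "ennreal (LINT w|lborel. ?F w) < ennreal e" using e by (intro ennreal_lessI) auto
    then show ?thesis by (rule order.strict_trans1[OF 1[unfolded 2]])
  qed
  then show ?thesis using d(1) by blast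
qed

text \<open>The graph of \<open>t\<^sup>s\<close> lies above its tangent at \<open>a\<close>. This form of Young's inequality yields both Jensen's
  inequality for averages and Picone's inequality.\<close>
lemma powr_tangent_le:
  fixes a t s :: real
  assumes "0 \<le> a" "0 \<le> t" "1 \<le> s"
  shows "s * a powr (s - 1) * t \<le> (s - 1) * a powr s + t powr s"
proof (cases "s = 1")
  case True
  then show ?thesis using assms by (cases "a = 0"; cases "t = 0") auto
next
  case False
  then have s: "1 < s" using assms by simp
  have c: "1 / (s / (s - 1)) + 1 / s = 1" using s by (simp add: field_simps)
  have "a powr (s - 1) * t \<le> (a powr (s - 1)) powr (s / (s - 1)) / (s / (s - 1)) + t powr s / s"
    using s assms c by (intro Youngs_inequality) (auto simp: field_simps)
  then have "s * (a powr (s - 1) * t) \<le> s * (a powr s * (s - 1) / s + t powr s / s)"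
    using s by (intro mult_left_mono) (auto simp: powr_powr)
  also have "\<dots> = (s - 1) * a powr s + t powr s" using s by (simp add: distrib_left)
  finally show ?thesis by (simp add: mult.assoc)
qed

text \<open>Jensen's inequality: integrate the tangent inequality at the average. With the right-hand side in
  \<open>[0, \<infinity>]\<close> the inequality holds for every measurable \<open>X\<close>, since the integral of a non-integrable function
  is \<open>0\<close> by convention.\<close>
lemma norm_powr_average_le:
  fixes k :: "'a \<Rightarrow> real" and X :: "'a \<Rightarrow> 'b::{banach, second_countable_topology}"
  assumes k: "integrable M k" "\<And>h. 0 \<le> k h" "(LINT h|M. k h) = 1"
    and [measurable]: "X \<in> borel_measurable M" and s: "1 \<le> s"
  shows "ennreal (norm (LINT h|M. k h *\<^sub>R X h) powr s) \<le> (\<integral>\<^sup>+h. ennreal (k h * norm (X h) powr s) \<partial>M)"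
proof (cases "integrable M (\<lambda>h. k h *\<^sub>R X h) \<and> (\<integral>\<^sup>+h. ennreal (k h * norm (X h) powr s) \<partial>M) < \<infinity>")
  case False
  have "\<not> integrable M (\<lambda>h. k h *\<^sub>R X h) \<Longrightarrow> (LINT h|M. k h *\<^sub>R X h) = 0"
    by (rule not_integrable_integral_eq)
  moreover have "(\<integral>\<^sup>+h. ennreal (k h * norm (X h) powr s) \<partial>M) = top" if "integrable M (\<lambda>h. k h *\<^sub>R X h)"
    using False that by (metis infinity_ennreal_def less_top)
  ultimately show ?thesis using s by (cases "integrable M (\<lambda>h. k h *\<^sub>R X h)") auto
next
  case True
  have [measurable]: "k \<in> borel_measurable M" using k by auto
  have 1: "integrable M (\<lambda>h. k h * norm (X h))"
    using integrable_norm[OF conjunct1[OF True]] k(2) by simp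
  have 2: "integrable M (\<lambda>h. k h * norm (X h) powr s)"
    using True k(2) by (intro integrableI_nonneg) auto
  define a where "a = (LINT h|M. k h * norm (X h))"
  have a0: "0 \<le> a" unfolding a_def using k(2) by (intro Bochner_Integration.integral_nonneg) auto
  have le: "norm (LINT h|M. k h *\<^sub>R X h) \<le> a"
    unfolding a_def using integral_norm_bound[of M "\<lambda>h. k h *\<^sub>R X h"] k(2) by simp
  have "(LINT h|M. s * a powr (s - 1) * (k h * norm (X h))) \<le>
      (LINT h|M. (s - 1) * a powr s * k h + k h * norm (X h) powr s)"
  proof (rule integral_mono)
    fix h
    have "k h * (s * a powr (s - 1) * norm (X h)) \<le> k h * ((s - 1) * a powr s + norm (X h) powr s)"
      using powr_tangent_le[OF a0 norm_ge_zero s] k(2) by (intro mult_left_mono) auto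
    then show "s * a powr (s - 1) * (k h * norm (X h)) \<le> (s - 1) * a powr s * k h + k h * norm (X h) powr s"
      by (simp add: algebra_simps)
  qed (use 1 2 k in auto)
  also have "(LINT h|M. s * a powr (s - 1) * (k h * norm (X h))) = s * a powr (s - 1) * a"
    by (simp add: a_def)
  also have "\<dots> = s * a powr s"
    using a0 by (cases "a = 0") (auto simp: powr_diff)
  also have "(LINT h|M. (s - 1) * a powr s * k h + k h * norm (X h) powr s) =
      (s - 1) * a powr s + (LINT h|M. k h * norm (X h) powr s)"
    using 1 2 k by simp
  finally have "a powr s \<le> (LINT h|M. k h * norm (X h) powr s)" by (simp add: algebra_simps)
  moreover have "norm (LINT h|M. k h *\<^sub>R X h) powr s \<le> a powr s"
    using le s by (intro powr_mono2) auto
  ultimately have "norm (LINT h|M. k h *\<^sub>R X h) powr s \<le> (LINT h|M. k h * norm (X h) powr s)" by simp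
  then show ?thesis
    using k(2) by (subst nn_integral_eq_integral[OF 2]) (auto intro!: ennreal_leI)
qed

lemma continuous_vanishing_at_infinity:
  fixes f :: "'e::euclidean_space \<Rightarrow> 'b::euclidean_space"
  assumes c: "continuous_on UNIV f" and z: "\<And>w. norm w > r \<Longrightarrow> f w = 0"
  shows "integrable lborel f" and "\<exists>B\<ge>0. \<forall>w. norm (f w) \<le> B"
proof -
  have "integrable lborel (\<lambda>w. indicator (cball 0 r) w *\<^sub>R f w)"
    by (rule borel_integrable_compact) (auto intro: continuous_on_subset[OF c])
  also have "(\<lambda>w. indicator (cball 0 r) w *\<^sub>R f w) = f"
    using z by (force simp: indicator_def)
  finally show "integrable lborel f" .
  have "bounded (f ` cball 0 r)"
    by (intro compact_imp_bounded compact_continuous_image continuous_on_subset[OF c]) auto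
  then obtain B where B: "B > 0" "\<And>w. w \<in> cball 0 r \<Longrightarrow> norm (f w) \<le> B"
    by (auto simp: bounded_pos)
  have "norm (f w) \<le> B" for w using B z[of w] by (cases "norm w \<le> r") auto
  then show "\<exists>B\<ge>0. \<forall>w. norm (f w) \<le> B" using B(1) by (auto intro!: exI[of _ B])
qed

definition mollifier :: "real \<Rightarrow> 'e::euclidean_space \<Rightarrow> real" where
  "mollifier r w = flat 1 (r\<^sup>2 - w \<bullet> w) / (LINT y|lborel. flat 1 (r\<^sup>2 - (y :: 'e) \<bullet> y))"

text \<open>The Euclidean gradient of \<open>mollifier r\<close>.\<close>
definition mollifier_grad :: "real \<Rightarrow> 'e::euclidean_space \<Rightarrow> 'e" where
  "mollifier_grad r w =
     (- 2 * flat [:0, 0, 1:] (r\<^sup>2 - w \<bullet> w) / (LINT y|lborel. flat 1 (r\<^sup>2 - (y :: 'e) \<bullet> y))) *\<^sub>R w"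

lemma continuous_on_flat: "continuous_on S (flat P)"
  by (meson DERIV_flat DERIV_isCont continuous_at_imp_continuous_on)

lemma continuous_on_flat_ball:
  "continuous_on S (\<lambda>w::'e::euclidean_space. flat P (r\<^sup>2 - w \<bullet> w))"
  by (rule continuous_on_compose2[OF continuous_on_flat[of UNIV]]) (auto intro!: continuous_intros)

lemma flat_outside_ball:
  fixes w :: "'e::euclidean_space"
  assumes "r \<le> norm w" "0 \<le> r"
  shows "flat P (r\<^sup>2 - w \<bullet> w) = 0"
proof -
  have "r\<^sup>2 \<le> w \<bullet> w" using power_mono[OF assms, of 2] by (simp add: dot_square_norm)
  then show ?thesis by (simp add: flat_def)
qed

lemma mollifier_mass_pos:
  assumes r: "0 < r"
  shows "0 < (LINT y|lborel. flat 1 (r\<^sup>2 - (y :: 'e::euclidean_space) \<bullet> y))"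
proof -
  let ?f = "\<lambda>y::'e. flat 1 (r\<^sup>2 - y \<bullet> y)"
  have i: "integrable lborel ?f"
    by (rule continuous_vanishing_at_infinity(1)[where r=r])
       (use r in \<open>auto intro!: continuous_on_flat_ball flat_outside_ball\<close>)
  have nn: "0 \<le> ?f y" for y by (auto simp: flat_def)
  have "(LINT y|lborel. ?f y) \<noteq> 0"
  proof
    assume "(LINT y|lborel. ?f y) = 0"
    then have ae: "AE y in lborel. ?f y = 0"
      using integral_nonneg_eq_0_iff_AE[OF i] nn by auto
    have "AE y in lborel. y \<notin> ball (0::'e) r"
      using ae
    proof eventually_elim
      case (elim y)
      then have "r\<^sup>2 \<le> y \<bullet> y" by (auto simp: flat_def split: if_splits)
      then have "r \<le> norm y" using r by (simp add: dot_square_norm)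
      then show ?case by simp
    qed
    then have "ball (0::'e) r \<in> null_sets lborel"
      by (subst AE_iff_null_sets) auto
    then have "negligible (ball (0::'e) r)"
      by (simp add: negligible_iff_null_sets null_sets_completionI)
    then show False using open_not_negligible[of "ball (0::'e) r"] r by auto
  qed
  moreover have "0 \<le> (LINT y|lborel. ?f y)" using nn by (intro Bochner_Integration.integral_nonneg) auto
  ultimately show ?thesis by simp
qed

lemma
  fixes w :: "'e::euclidean_space"
  assumes r: "0 < r"
  shows mollifier_nonneg: "0 \<le> mollifier r w"
    and mollifier_outside: "r \<le> norm w \<Longrightarrow> mollifier r w = 0"
    and mollifier_grad_outside: "r \<le> norm w \<Longrightarrow> mollifier_grad r w = 0"
  using mollifier_mass_pos[OF r, where ?'e='e] r flat_outside_ball[of r w]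
  by (auto simp: mollifier_def mollifier_grad_def flat_def less_imp_le)

lemma continuous_on_mollifier: "continuous_on S (mollifier r :: 'e::euclidean_space \<Rightarrow> real)"
  and continuous_on_mollifier_grad: "continuous_on S (mollifier_grad r :: 'e::euclidean_space \<Rightarrow> 'e)"
  unfolding mollifier_def[abs_def] mollifier_grad_def[abs_def] divide_inverse
  by (intro continuous_intros continuous_on_flat_ball)+

lemma
  assumes r: "0 < r"
  shows integrable_mollifier: "integrable lborel (mollifier r :: 'e::euclidean_space \<Rightarrow> real)"
    and bounded_mollifier: "\<exists>B\<ge>0. \<forall>w::'e. norm (mollifier r w) \<le> B"
    and bounded_mollifier_grad: "\<exists>B\<ge>0. \<forall>w::'e. norm (mollifier_grad r w) \<le> B"
    and integral_mollifier: "(LINT w|lborel. mollifier r (w::'e)) = 1"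
proof -
  show "integrable lborel (mollifier r :: 'e \<Rightarrow> real)" "\<exists>B\<ge>0. \<forall>w::'e. norm (mollifier r w) \<le> B"
    by (rule continuous_vanishing_at_infinity[OF continuous_on_mollifier, of r];
        simp add: mollifier_outside[OF r])+
  show "\<exists>B\<ge>0. \<forall>w::'e. norm (mollifier_grad r w) \<le> B"
    by (rule continuous_vanishing_at_infinity(2)[OF continuous_on_mollifier_grad, of r])
       (simp add: mollifier_grad_outside[OF r])
  show "(LINT w|lborel. mollifier r (w::'e)) = 1"
    using mollifier_mass_pos[OF r, where ?'e='e] by (simp add: mollifier_def)
qed

lemma borel_measurable_mollifier [measurable]:
  "(mollifier r :: 'e::euclidean_space \<Rightarrow> real) \<in> borel_measurable borel"
  "(mollifier_grad r :: 'e::euclidean_space \<Rightarrow> 'e) \<in> borel_measurable borel"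
  by (intro borel_measurable_continuous_onI continuous_on_mollifier continuous_on_mollifier_grad)+

lemma has_derivative_mollifier:
  fixes w :: "'e::euclidean_space"
  shows "(mollifier r has_derivative (\<lambda>v. mollifier_grad r w \<bullet> v)) (at w)"
proof -
  have "((\<lambda>w. flat 1 (r\<^sup>2 - w \<bullet> w)) has_derivative
     (\<lambda>v. - 2 * (w \<bullet> v) * flat ([:0, 0, 1:] * (1 - pderiv 1)) (r\<^sup>2 - w \<bullet> w))) (at w)"
    by (rule has_derivative_eq_rhs, rule DERIV_compose_FDERIV[OF DERIV_flat])
       (auto intro!: derivative_eq_intros simp: inner_commute algebra_simps)
  from has_derivative_mult_right[OF this, of "1 / (LINT y|lborel. flat 1 (r\<^sup>2 - (y :: 'e) \<bullet> y))"]
  show ?thesis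
    unfolding mollifier_def[abs_def] mollifier_grad_def by (simp add: algebra_simps)
qed

lemma DERIV_along_line:
  assumes "(f has_derivative f') (at w)"
  shows "((\<lambda>t. f (w + t *\<^sub>R v)) has_real_derivative f' v) (at 0)"
proof -
  interpret f': bounded_linear f' using assms by (rule has_derivative_bounded_linear)
  have "((\<lambda>t. f (w + t *\<^sub>R v)) has_derivative (\<lambda>t. f' (t *\<^sub>R v))) (at 0)"
    by (rule has_derivative_compose[of "\<lambda>t. w + t *\<^sub>R v" "\<lambda>t. t *\<^sub>R v" 0 UNIV f f'])
       (use assms in \<open>auto intro!: derivative_eq_intros\<close>)
  then show ?thesis by (simp add: has_field_derivative_def f'.scaleR mult.commute[of _ "f' v"])
qed

definition conv :: "('e::euclidean_space \<Rightarrow> real) \<Rightarrow> ('e \<Rightarrow> 'b::euclidean_space) \<Rightarrow> 'e \<Rightarrow> 'b" where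
  "conv k f w = (LINT y|lborel. k (w - y) *\<^sub>R f y)"

lemma conv_commute:
  assumes [measurable]: "k \<in> borel_measurable borel" "f \<in> borel_measurable borel"
  shows "conv k f w = (LINT h|lborel. k h *\<^sub>R f (w - h))"
  using integral_lborel_reflect[of "\<lambda>h. k h *\<^sub>R f (w - h)" w] by (simp add: conv_def)

lemma borel_measurable_conv [measurable]:
  fixes f :: "'e::euclidean_space \<Rightarrow> 'b::euclidean_space"
  assumes [measurable]: "k \<in> borel_measurable borel" "f \<in> borel_measurable borel"
  shows "conv k f \<in> borel_measurable borel"
proof -
  have "(\<lambda>w. LINT y|lborel. k (w - y) *\<^sub>R f y) \<in> borel_measurable borel"
    by (rule sigma_finite_measure.borel_measurable_lebesgue_integral) (auto intro: sigma_finite_lborel)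
  then show ?thesis by (simp add: conv_def[abs_def])
qed

lemma integrable_bounded_kernel:
  fixes f :: "'e::euclidean_space \<Rightarrow> 'b::euclidean_space"
  assumes [measurable]: "k \<in> borel_measurable borel" and f: "integrable lborel f"
    and B: "\<And>w. norm (k w) \<le> B"
  shows "integrable lborel (\<lambda>y. k (w - y) *\<^sub>R f y)" and "norm (conv k f w) \<le> B * (LINT y|lborel. norm (f y))"
proof -
  have [measurable]: "f \<in> borel_measurable borel" using f by auto
  have b: "norm (k (w - y) *\<^sub>R f y) \<le> B * norm (f y)" for y
    using B[of "w - y"] by (simp add: mult_right_mono)
  show i: "integrable lborel (\<lambda>y. k (w - y) *\<^sub>R f y)"
  proof (rule Bochner_Integration.integrable_bound)
    show "integrable lborel (\<lambda>y. B * norm (f y))" using f by auto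
    show "AE y in lborel. norm (k (w - y) *\<^sub>R f y) \<le> norm (B * norm (f y))"
      by (intro AE_I2 order_trans[OF b]) simp
  qed measurable
  have "norm (conv k f w) \<le> (LINT y|lborel. norm (k (w - y) *\<^sub>R f y))"
    unfolding conv_def by (rule integral_norm_bound)
  also have "\<dots> \<le> (LINT y|lborel. B * norm (f y))"
    using f i by (intro integral_mono b integrable_norm) auto
  finally show "norm (conv k f w) \<le> B * (LINT y|lborel. norm (f y))" by simp
qed

text \<open>By Jensen and Tonelli the \<open>L\<^sup>s\<close> distance from \<open>g\<close> to its mollification is an average of the distances from
  \<open>g\<close> to its translates by vectors shorter than \<open>r\<close>.\<close>
lemma conv_mollifier_error_le:
  fixes g :: "'e::euclidean_space \<Rightarrow> 'b::euclidean_space"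
  assumes g: "integrable lborel g" and s: "1 \<le> s" and r: "0 < r"
    and c: "\<And>h. norm h < r \<Longrightarrow> (\<integral>\<^sup>+w. ennreal (norm (g (w - h) - g w) powr s) \<partial>lborel) \<le> c"
  shows "(\<integral>\<^sup>+w. ennreal (norm (conv (mollifier r) g w - g w) powr s) \<partial>lborel) \<le> c"
proof -
  let ?k = "mollifier r :: 'e \<Rightarrow> real"
  note k = integrable_mollifier[OF r, where ?'e='e] integral_mollifier[OF r, where ?'e='e]
  have k0: "0 \<le> ?k h" for h by (rule mollifier_nonneg[OF r])
  have [measurable]: "g \<in> borel_measurable borel" using g by auto
  have pw: "ennreal (norm (conv ?k g w - g w) powr s) \<le> (\<integral>\<^sup>+h. ennreal (?k h * norm (g (w - h) - g w) powr s) \<partial>lborel)" for w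
  proof -
    obtain B where B: "\<And>w::'e. norm (?k w) \<le> B" using bounded_mollifier[OF r] by blast
    have "integrable lborel (\<lambda>h. ?k h *\<^sub>R g (w - h))"
      using integrable_bounded_kernel(1)[of ?k g B w] g B
      by (subst integrable_lborel_reflect[of _ w, symmetric]) auto
    then have "conv ?k g w - g w = (LINT h|lborel. ?k h *\<^sub>R (g (w - h) - g w))"
      using k by (simp add: conv_commute scaleR_diff_right)
    then show ?thesis using norm_powr_average_le[OF k(1) k0 k(2) _ s, of "\<lambda>h. g (w - h) - g w"] by simp
  qed
  have "(\<integral>\<^sup>+w. ennreal (norm (conv ?k g w - g w) powr s) \<partial>lborel) \<le>
      (\<integral>\<^sup>+w. \<integral>\<^sup>+h. ennreal (?k h * norm (g (w - h) - g w) powr s) \<partial>lborel \<partial>lborel)"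
    by (intro nn_integral_mono pw)
  also have "\<dots> = (\<integral>\<^sup>+h. \<integral>\<^sup>+w. ennreal (?k h * norm (g (w - h) - g w) powr s) \<partial>lborel \<partial>lborel)"
    by (rule lborel_pair.Fubini') measurable
  also have "\<dots> = (\<integral>\<^sup>+h. ennreal (?k h) * (\<integral>\<^sup>+w. ennreal (norm (g (w - h) - g w) powr s) \<partial>lborel) \<partial>lborel)"
    using k0 by (simp add: ennreal_mult' nn_integral_cmult)
  also have "\<dots> \<le> (\<integral>\<^sup>+h. ennreal (?k h) * c \<partial>lborel)"
  proof (rule nn_integral_mono)
    fix h
    show "ennreal (?k h) * (\<integral>\<^sup>+w. ennreal (norm (g (w - h) - g w) powr s) \<partial>lborel) \<le> ennreal (?k h) * c"
      using c[of h] mollifier_outside[OF r, of h] by (cases "norm h < r") (auto intro: mult_left_mono)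
  qed
  also have "\<dots> = c"
    using nn_integral_eq_integral[OF k(1)] k0 k(2) by (simp add: nn_integral_multc)
  finally show ?thesis .
qed

lemma mollification_tendsto_Ls:
  fixes g :: "'e::euclidean_space \<Rightarrow> 'b::euclidean_space"
  assumes g: "integrable lborel g" and gs: "integrable lborel (\<lambda>w. norm (g w) powr s)" and s: "1 \<le> s"
    and r: "\<And>n. 0 < r n" "r \<longlonglongrightarrow> 0"
  shows "integrable lborel (\<lambda>w. norm (conv (mollifier (r n)) g w - g w) powr s)"
    and "(\<lambda>n. LINT w|lborel. norm (conv (mollifier (r n)) g w - g w) powr s) \<longlonglongrightarrow> 0"
proof -
  have [measurable]: "g \<in> borel_measurable borel" using g by auto
  have bound: "(\<integral>\<^sup>+w. ennreal (norm (g (w - h) - g w) powr s) \<partial>lborel)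
      \<le> ennreal (3 powr s * (2 * (LINT w|lborel. norm (g w) powr s)))" for h
  proof -
    have gh: "integrable lborel (\<lambda>w. norm (g (w - h)) powr s)"
      using gs by (subst integrable_lborel_translate[of "\<lambda>w. norm (g w) powr s"]) auto
    have "norm (g (w - h) - g w) powr s \<le> 3 powr s * (norm (g (w - h)) powr s + norm (g w) powr s)" for w
    proof -
      have "norm (g (w - h) - g w) powr s \<le> (norm (g (w - h)) + norm (g w) + 0) powr s"
        using s norm_triangle_ineq4[of "g (w - h)" "g w"] by (intro powr_mono2) auto
      also have "\<dots> \<le> 3 powr s * (norm (g (w - h)) powr s + norm (g w) powr s + 0 powr s)"
        using s by (intro powr_add3_le) auto
      finally show ?thesis using s by simp
    qed
    then have "(\<integral>\<^sup>+w. ennreal (norm (g (w - h) - g w) powr s) \<partial>lborel)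
      \<le> (\<integral>\<^sup>+w. ennreal (3 powr s * (norm (g (w - h)) powr s + norm (g w) powr s)) \<partial>lborel)"
      by (intro nn_integral_mono ennreal_leI)
    also have "\<dots> = ennreal (LINT w|lborel. 3 powr s * (norm (g (w - h)) powr s + norm (g w) powr s))"
      using gs gh by (intro nn_integral_eq_integral) auto
    also have "(LINT w|lborel. 3 powr s * (norm (g (w - h)) powr s + norm (g w) powr s)) =
       3 powr s * (2 * (LINT w|lborel. norm (g w) powr s))"
      using gs gh integral_lborel_translate[of "\<lambda>w. norm (g w) powr s" h] by simp
    finally show ?thesis .
  qed
  have fin: "integrable lborel (\<lambda>w. norm (conv (mollifier (r n)) g w - g w) powr s)" for n
    by (rule integrableI_nonneg)
       (use conv_mollifier_error_le[OF g s r(1)[of n] bound] in \<open>auto intro: order.strict_trans1\<close>)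
  then show "integrable lborel (\<lambda>w. norm (conv (mollifier (r n)) g w - g w) powr s)" .
  show "(\<lambda>n. LINT w|lborel. norm (conv (mollifier (r n)) g w - g w) powr s) \<longlonglongrightarrow> 0"
  proof (rule LIMSEQ_I)
    fix e :: real assume e: "0 < e"
    then obtain d where d: "d > 0" "\<And>h. norm h < d \<Longrightarrow>
        (\<integral>\<^sup>+w. ennreal (norm (g (w - h) - g w) powr s) \<partial>lborel) < ennreal (e / 2)"
      using translation_Ls[OF g gs s, of "e / 2"] by auto
    obtain N where N: "\<And>n. n \<ge> N \<Longrightarrow> r n < d"
      using order_tendstoD(2)[OF r(2) d(1)] by (auto simp: eventually_sequentially)
    have "norm ((LINT w|lborel. norm (conv (mollifier (r n)) g w - g w) powr s) - 0) < e" if "n \<ge> N" for n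
    proof -
      have "(\<integral>\<^sup>+w. ennreal (norm (conv (mollifier (r n)) g w - g w) powr s) \<partial>lborel) \<le> ennreal (e / 2)"
        by (rule conv_mollifier_error_le[OF g s r(1)]) (use N[OF that] d(2) in \<open>auto intro: less_imp_le\<close>)
      then have "(LINT w|lborel. norm (conv (mollifier (r n)) g w - g w) powr s) \<le> e / 2"
        using e by (subst (asm) nn_integral_eq_integral[OF fin]) auto
      moreover have "0 \<le> (LINT w|lborel. norm (conv (mollifier (r n)) g w - g w) powr s)"
        by (rule Bochner_Integration.integral_nonneg) simp
      ultimately show ?thesis using e by auto
    qed
    then show "\<exists>N. \<forall>n\<ge>N. norm ((LINT w|lborel. norm (conv (mollifier (r n)) g w - g w) powr s) - 0) < e" by blast
  qed
qed

text \<open>In the chain rule all derivatives are taken along lines, as real functions of the step, so that products and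
  compositions are handled by the one-dimensional calculus. The mean value theorem then supplies the dominating functions.\<close>
lemma directional_derivative_bound:
  fixes g :: "'e::real_normed_vector \<Rightarrow> real"
  assumes d: "\<And>w. ((\<lambda>t. g (w + t *\<^sub>R v)) has_real_derivative g' w) (at 0)" and B: "\<And>w. \<bar>g' w\<bar> \<le> B"
  shows "\<bar>g (w + h *\<^sub>R v) - g w\<bar> \<le> B * \<bar>h\<bar>"
proof -
  have "((\<lambda>t. g (w + t *\<^sub>R v)) has_real_derivative g' (w + t *\<^sub>R v)) (at t)" for t
  proof -
    have "((\<lambda>u. g (w + t *\<^sub>R v + u *\<^sub>R v)) has_real_derivative g' (w + t *\<^sub>R v)) (at 0)" by (rule d)
    then have "((\<lambda>u. g (w + (u + t) *\<^sub>R v)) has_real_derivative g' (w + t *\<^sub>R v)) (at 0)"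
      by (simp add: algebra_simps)
    then show ?thesis using DERIV_shift[of "\<lambda>t. g (w + t *\<^sub>R v)" "g' (w + t *\<^sub>R v)" 0 t] by simp
  qed
  then have "norm (g (w + h *\<^sub>R v) - g (w + 0 *\<^sub>R v)) \<le> B * norm (h - 0)"
    using B by (intro field_differentiable_bound[where S=UNIV and f="\<lambda>t. g (w + t *\<^sub>R v)"]) auto
  then show ?thesis by simp
qed

text \<open>A bound on the difference quotients for small steps is enough for dominated convergence.\<close>
lemma DERIV_under_integral:
  fixes g :: "real \<Rightarrow> 'a \<Rightarrow> real"
  assumes i: "\<And>h. integrable M (g h)" and d: "\<And>y. ((\<lambda>h. g h y) has_real_derivative g' y) (at 0)"
    and b: "\<And>h y. \<bar>h\<bar> \<le> 1 \<Longrightarrow> \<bar>g h y - g 0 y\<bar> \<le> \<bar>h\<bar> * B y" and B: "integrable M B"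
    and [measurable]: "g' \<in> borel_measurable M"
  shows "((\<lambda>h. LINT y|M. g h y) has_real_derivative (LINT y|M. g' y)) (at 0)"
  unfolding DERIV_def tendsto_at_iff_sequentially comp_def
proof (intro allI impI)
  fix X :: "nat \<Rightarrow> real" assume X: "\<forall>i. X i \<in> UNIV - {0}" "X \<longlonglongrightarrow> 0"
  have [measurable]: "g h \<in> borel_measurable M" for h using i by auto
  obtain N where N: "\<And>n. n \<ge> N \<Longrightarrow> \<bar>X n\<bar> < 1"
    using LIMSEQ_D[OF X(2), of 1] by auto
  have "(\<lambda>n. LINT y|M. (g (X (n + N)) y - g 0 y) / X (n + N)) \<longlonglongrightarrow> (LINT y|M. g' y)"
  proof (rule integral_dominated_convergence[OF _ _ B])
    show "AE y in M. (\<lambda>n. (g (X (n + N)) y - g 0 y) / X (n + N)) \<longlonglongrightarrow> g' y"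
    proof (rule AE_I2)
      fix y
      have "(\<lambda>n. (g (0 + X n) y - g 0 y) / X n) \<longlonglongrightarrow> g' y"
        using d[of y] X unfolding DERIV_def tendsto_at_iff_sequentially comp_def by blast
      then show "(\<lambda>n. (g (X (n + N)) y - g 0 y) / X (n + N)) \<longlonglongrightarrow> g' y"
        using LIMSEQ_ignore_initial_segment by force
    qed
    show "AE y in M. norm ((g (X (n + N)) y - g 0 y) / X (n + N)) \<le> B y" for n
    proof (rule AE_I2)
      fix y
      show "norm ((g (X (n + N)) y - g 0 y) / X (n + N)) \<le> B y"
        using b[of "X (n + N)" y] N[of "n + N"] X(1) by (simp add: divide_le_eq mult.commute)
    qed
  qed auto
  then have "(\<lambda>n. LINT y|M. (g (X n) y - g 0 y) / X n) \<longlonglongrightarrow> (LINT y|M. g' y)"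
    by (rule LIMSEQ_offset)
  then show "(\<lambda>n. ((LINT y|M. g (0 + X n) y) - (LINT y|M. g 0 y)) / X n) \<longlonglongrightarrow> (LINT y|M. g' y)"
    using i by simp
qed

lemma DERIV_conv:
  fixes f :: "'e::euclidean_space \<Rightarrow> real"
  assumes [measurable]: "k \<in> borel_measurable borel" "k' \<in> borel_measurable borel"
    and Bk: "\<And>w. \<bar>k w\<bar> \<le> Bk" and f: "integrable lborel f"
    and d: "\<And>w. ((\<lambda>t. k (w + t *\<^sub>R v)) has_real_derivative k' w) (at 0)" and B: "\<And>w. \<bar>k' w\<bar> \<le> B"
  shows "((\<lambda>t. conv k f (w + t *\<^sub>R v)) has_real_derivative conv k' f w) (at 0)"
  unfolding conv_def
proof (rule DERIV_under_integral)
  have [measurable]: "f \<in> borel_measurable borel" using f by auto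
  show "integrable lborel (\<lambda>y. k (w + h *\<^sub>R v - y) *\<^sub>R f y)" for h
    using integrable_bounded_kernel(1)[of k f Bk] f Bk by simp
  show "((\<lambda>t. k (w + t *\<^sub>R v - y) *\<^sub>R f y) has_real_derivative k' (w - y) *\<^sub>R f y) (at 0)" for y
    using DERIV_cmult_right[OF d[of "w - y"], of "f y"] by (simp add: algebra_simps)
  show "integrable lborel (\<lambda>y. B * \<bar>f y\<bar>)" using f by auto
  fix h y
  have e: "w + h *\<^sub>R v - y = w - y + h *\<^sub>R v" "w + 0 *\<^sub>R v - y = w - y" by auto
  have "\<bar>k (w - y + h *\<^sub>R v) - k (w - y)\<bar> * \<bar>f y\<bar> \<le> B * \<bar>h\<bar> * \<bar>f y\<bar>"
    using directional_derivative_bound[OF d B] by (intro mult_right_mono) auto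
  then show "\<bar>k (w + h *\<^sub>R v - y) *\<^sub>R f y - k (w + 0 *\<^sub>R v - y) *\<^sub>R f y\<bar> \<le> \<bar>h\<bar> * (B * \<bar>f y\<bar>)"
    unfolding e real_scaleR_def left_diff_distrib[symmetric] abs_mult by (simp add: mult_ac)
qed (use f in measurable)

text \<open>Integration by parts without boundary term: the integral of a translate does not depend on the
  translation, and its derivative may be taken under the integral sign.\<close>
lemma integral_directional_derivative_eq_0:
  fixes g :: "'e::euclidean_space \<Rightarrow> real"
  assumes i: "integrable lborel g" and [measurable]: "g' \<in> borel_measurable borel"
    and d: "\<And>w. ((\<lambda>t. g (w + t *\<^sub>R v)) has_real_derivative g' w) (at 0)" and B: "\<And>w. \<bar>g' w\<bar> \<le> B"
    and z: "\<And>w. norm w > r \<Longrightarrow> g w = 0"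
  shows "(LINT w|lborel. g' w) = 0"
proof -
  have [measurable]: "g \<in> borel_measurable borel" using i by auto
  have tr: "integrable lborel (\<lambda>w. g (w + h *\<^sub>R v))" "(LINT w|lborel. g (w + h *\<^sub>R v)) = (LINT w|lborel. g w)" for h
    using i integrable_lborel_translate[of g "- h *\<^sub>R v"] integral_lborel_translate[of g "- h *\<^sub>R v"] by auto
  have "((\<lambda>h. LINT w|lborel. g (w + h *\<^sub>R v)) has_real_derivative (LINT w|lborel. g' w)) (at 0)"
  proof (rule DERIV_under_integral[where B="\<lambda>w. B * indicator (cball 0 (r + norm v)) w"])
    show "integrable lborel (\<lambda>w::'e. B * indicator (cball 0 (r + norm v)) w)"
      using emeasure_bounded_finite[OF bounded_cball[of "0::'e" "r + norm v"]] by auto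
    show "\<bar>g (w + h *\<^sub>R v) - g (w + 0 *\<^sub>R v)\<bar> \<le> \<bar>h\<bar> * (B * indicator (cball 0 (r + norm v)) w)" if "\<bar>h\<bar> \<le> 1" for h w
    proof (cases "norm w \<le> r + norm v")
      case True
      then show ?thesis using directional_derivative_bound[OF d B, of w h] by (simp add: mult.commute)
    next
      case False
      have "norm w \<le> norm (w + h *\<^sub>R v) + norm (h *\<^sub>R v)" using norm_triangle_ineq4[of "w + h *\<^sub>R v" "h *\<^sub>R v"] by simp
      moreover have "norm (h *\<^sub>R v) \<le> norm v" using that by (simp add: mult_left_le_one_le)
      ultimately have "norm (w + h *\<^sub>R v) > r" using False by linarith
      moreover have "norm w > r" using False norm_ge_zero[of v] by linarith
      moreover have "0 \<le> B" using B[of w] by (meson abs_ge_zero order_trans)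
      ultimately show ?thesis using z by simp
    qed
  qed (use tr d in auto)
  then have "((\<lambda>h::real. LINT w|lborel. g w) has_real_derivative (LINT w|lborel. g' w)) (at 0)"
    by (simp add: tr(2))
  then show ?thesis using DERIV_unique DERIV_const by blast
qed

section \<open>The chain rule for weak solutions\<close>
lemma tendsto_integral_bounded_mult:
  fixes A :: "nat \<Rightarrow> 'a \<Rightarrow> real"
  assumes [measurable]: "\<And>n. A n \<in> borel_measurable M" "A' \<in> borel_measurable M"
    and K: "\<And>n w. \<bar>A n w\<bar> \<le> K" and A: "AE w in M. (\<lambda>n. A n w) \<longlonglongrightarrow> A' w"
    and X: "\<And>n. integrable M (X n)" "integrable M X'" "(\<lambda>n. LINT w|M. \<bar>X n w - X' w\<bar>) \<longlonglongrightarrow> 0"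
  shows "(\<lambda>n. LINT w|M. A n w * X n w) \<longlonglongrightarrow> (LINT w|M. A' w * X' w)"
proof -
  have [measurable]: "X n \<in> borel_measurable M" "X' \<in> borel_measurable M" for n using X by auto
  have i: "integrable M (\<lambda>w. A n w * Y w)" if "integrable M Y" for Y n
    by (rule Bochner_Integration.integrable_bound[OF integrable_mult_right[OF that, of K]])
       (use that K[of n] in \<open>auto simp: abs_mult intro!: AE_I2 mult_mono order_trans[OF K[of n] abs_ge_self]\<close>)
  have 1: "(\<lambda>n. LINT w|M. A n w * X' w) \<longlonglongrightarrow> (LINT w|M. A' w * X' w)"
  proof (rule integral_dominated_convergence[where w="\<lambda>w. K * \<bar>X' w\<bar>"])
    show "AE w in M. (\<lambda>n. A n w * X' w) \<longlonglongrightarrow> A' w * X' w"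
      using A by eventually_elim (intro tendsto_intros)
    show "AE w in M. norm (A n w * X' w) \<le> K * \<bar>X' w\<bar>" for n
      using K[of n] by (auto simp: abs_mult intro!: AE_I2 mult_right_mono)
  qed (use X(2) in auto)
  have 2: "(\<lambda>n. LINT w|M. A n w * (X n w - X' w)) \<longlonglongrightarrow> 0"
  proof (rule tendsto_rabs_zero_cancel, rule tendsto_sandwich[of "\<lambda>_. 0"])
    show "(\<lambda>n. K * (LINT w|M. \<bar>X n w - X' w\<bar>)) \<longlonglongrightarrow> 0"
      using tendsto_mult_right_zero[OF X(3)] by simp
    show "\<forall>\<^sub>F n in sequentially. \<bar>LINT w|M. A n w * (X n w - X' w)\<bar> \<le> K * (LINT w|M. \<bar>X n w - X' w\<bar>)"
    proof (intro always_eventually allI)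
      fix n
      have "\<bar>LINT w|M. A n w * (X n w - X' w)\<bar> \<le> (LINT w|M. \<bar>A n w * (X n w - X' w)\<bar>)"
        by (rule integral_abs_bound)
      also have "\<dots> \<le> (LINT w|M. K * \<bar>X n w - X' w\<bar>)"
      proof (rule integral_mono)
        show "integrable M (\<lambda>w. \<bar>A n w * (X n w - X' w)\<bar>)" using X i[of "\<lambda>w. X n w - X' w" n] by auto
        show "integrable M (\<lambda>w. K * \<bar>X n w - X' w\<bar>)" using X by auto
        show "\<bar>A n w * (X n w - X' w)\<bar> \<le> K * \<bar>X n w - X' w\<bar>" for w
          using K[of n w] by (simp add: abs_mult mult_right_mono)
      qed
      finally show "\<bar>LINT w|M. A n w * (X n w - X' w)\<bar> \<le> K * (LINT w|M. \<bar>X n w - X' w\<bar>)" by simp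
    qed
  qed auto
  have "(LINT w|M. A n w * X n w) = (LINT w|M. A n w * X' w) + (LINT w|M. A n w * (X n w - X' w))" for n
    using i[OF X(1), of n n] i[OF X(2), of n] by (simp add: right_diff_distrib)
  then show ?thesis using tendsto_add[OF 1 2] by simp
qed

lemma weighted_Young:
  fixes a b l s s' :: real
  assumes "0 \<le> a" "0 \<le> b" "0 < l" and s: "1 < s" "1 < s'" "1 / s + 1 / s' = 1"
  shows "a * b \<le> l powr s * a powr s + l powr (- s') * b powr s'"
proof -
  have "a * b = (l * a) * (b / l)" using assms by simp
  also have "\<dots> \<le> (l * a) powr s / s + (b / l) powr s' / s'"
    using assms by (intro Youngs_inequality) auto
  also have "\<dots> \<le> (l * a) powr s + (b / l) powr s'"
    using s by (intro add_mono) (auto simp: divide_le_eq mult_le_cancel_left1)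
  also have "\<dots> = l powr s * a powr s + l powr (- s') * b powr s'"
    using assms by (simp add: powr_mult powr_divide powr_minus_divide)
  finally show ?thesis .
qed

text \<open>In Young's inequality with a large weight on \<open>a\<close> the term with \<open>b\<close> is small
  uniformly in \<open>n\<close>, and for that fixed weight the term with \<open>a\<close> tends to \<open>0\<close>.\<close>
lemma tendsto_integral_mult_0:
  fixes a b :: "nat \<Rightarrow> 'a \<Rightarrow> real"
  assumes s: "1 < s" "1 < s'" "1 / s + 1 / s' = 1"
    and [measurable]: "\<And>n. a n \<in> borel_measurable M" "\<And>n. b n \<in> borel_measurable M"
    and nn: "\<And>n w. 0 \<le> a n w" "\<And>n w. 0 \<le> b n w"
    and a: "\<And>n. integrable M (\<lambda>w. a n w powr s)" "(\<lambda>n. LINT w|M. a n w powr s) \<longlonglongrightarrow> 0"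
    and b: "\<And>n. integrable M (\<lambda>w. b n w powr s')" "\<And>n. (LINT w|M. b n w powr s') \<le> C"
  shows "integrable M (\<lambda>w. a n w * b n w)" and "(\<lambda>n. LINT w|M. a n w * b n w) \<longlonglongrightarrow> 0"
proof -
  have Y: "a n w * b n w \<le> l powr s * a n w powr s + l powr (- s') * b n w powr s'" if "0 < l" for l n w
    using weighted_Young[OF nn that s] .
  show i: "integrable M (\<lambda>w. a n w * b n w)" for n
    by (rule Bochner_Integration.integrable_bound[of _ "\<lambda>w. 1 powr s * a n w powr s + 1 powr (- s') * b n w powr s'"])
       (use a b Y[of 1 n] nn in \<open>auto intro!: AE_I2\<close>)
  have "0 \<le> (LINT w|M. b 0 w powr s')" by (rule Bochner_Integration.integral_nonneg) simp
  then have C: "0 \<le> C" using b(2)[of 0] by linarith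
  show "(\<lambda>n. LINT w|M. a n w * b n w) \<longlonglongrightarrow> 0"
  proof (rule LIMSEQ_I)
    fix e :: real assume e: "0 < e"
    \<comment> \<open>The weight for which the second term of Young's inequality is below \<open>e / 2\<close>.\<close>
    define l where "l = (2 * (C + 1) / e) powr (1 / s')"
    have l: "0 < l" using C e by (simp add: l_def)
    have lC: "l powr (- s') * C < e / 2"
    proof -
      have "l powr (- s') = e / (2 * (C + 1))" using s C e by (simp add: l_def powr_powr powr_minus_divide)
      then have "l powr (- s') * (2 * (C + 1)) = e" using C by simp
      then have "2 * (l powr (- s') * C) + 2 * l powr (- s') = e" by (simp add: algebra_simps)
      moreover have "0 < l powr (- s')" using l by simp
      ultimately show ?thesis by linarith
    qed
    have "(\<lambda>n. l powr s * (LINT w|M. a n w powr s)) \<longlonglongrightarrow> 0"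
      using tendsto_mult_right_zero[OF a(2)] by simp
    then obtain N where N: "\<And>n. n \<ge> N \<Longrightarrow> l powr s * (LINT w|M. a n w powr s) < e / 2"
      using order_tendstoD(2)[of _ 0 sequentially "e / 2"] e by (auto simp: eventually_sequentially)
    have "norm ((LINT w|M. a n w * b n w) - 0) < e" if "n \<ge> N" for n
    proof -
      have "(LINT w|M. a n w * b n w) \<le> (LINT w|M. l powr s * a n w powr s + l powr (- s') * b n w powr s')"
        using i a b Y[OF l] by (intro integral_mono) auto
      also have "\<dots> = l powr s * (LINT w|M. a n w powr s) + l powr (- s') * (LINT w|M. b n w powr s')"
        using a b by simp
      also have "l powr (- s') * (LINT w|M. b n w powr s') \<le> l powr (- s') * C"
        by (intro mult_left_mono b) auto
      finally have "(LINT w|M. a n w * b n w) < e" using N[OF that] lC by linarith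
      moreover have "0 \<le> (LINT w|M. a n w * b n w)"
        using nn by (intro Bochner_Integration.integral_nonneg) auto
      ultimately show ?thesis by simp
    qed
    then show "\<exists>N. \<forall>n\<ge>N. norm ((LINT w|M. a n w * b n w) - 0) < e" by blast
  qed
qed

text \<open>The difference of the products is bilinear in the errors and the limits, and each of the three resulting terms has
  one factor that tends to \<open>0\<close>.\<close>
lemma tendsto_L1_inner:
  fixes X Y :: "nat \<Rightarrow> 'a \<Rightarrow> 'b::euclidean_space"
  assumes s: "1 < s" "1 < s'" "1 / s + 1 / s' = 1"
    and [measurable]: "\<And>n. X n \<in> borel_measurable M" "\<And>n. Y n \<in> borel_measurable M"
      "X' \<in> borel_measurable M" "Y' \<in> borel_measurable M"
    and X: "integrable M (\<lambda>w. norm (X' w) powr s)" "\<And>n. integrable M (\<lambda>w. norm (X n w - X' w) powr s)"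
      "(\<lambda>n. LINT w|M. norm (X n w - X' w) powr s) \<longlonglongrightarrow> 0"
    and Y: "integrable M (\<lambda>w. norm (Y' w) powr s')" "\<And>n. integrable M (\<lambda>w. norm (Y n w - Y' w) powr s')"
      "(\<lambda>n. LINT w|M. norm (Y n w - Y' w) powr s') \<longlonglongrightarrow> 0"
  shows "integrable M (\<lambda>w. X n w \<bullet> Y n w)" and "integrable M (\<lambda>w. X' w \<bullet> Y' w)"
    and "(\<lambda>n. LINT w|M. \<bar>X n w \<bullet> Y n w - X' w \<bullet> Y' w\<bar>) \<longlonglongrightarrow> 0"
proof -
  let ?dX = "\<lambda>n w. norm (X n w - X' w)" and ?dY = "\<lambda>n w. norm (Y n w - Y' w)"
  have s'': "1 / s' + 1 / s = 1" using s by simp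
  obtain C where C: "\<And>n. (LINT w|M. ?dY n w powr s') \<le> C"
    using convergent_imp_Bseq[OF convergentI[OF Y(3)]] unfolding Bseq_def by (auto dest: abs_le_D1)
  note 1 = tendsto_integral_mult_0[OF s, of ?dX M ?dY, OF _ _ norm_ge_zero norm_ge_zero X(2,3) Y(2) C, simplified]
  note 2 = tendsto_integral_mult_0[OF s, of ?dX M "\<lambda>_ w. norm (Y' w)", OF _ _ norm_ge_zero norm_ge_zero X(2,3) Y(1) order_refl, simplified]
  note 3 = tendsto_integral_mult_0[OF s(2,1) s'', of ?dY M "\<lambda>_ w. norm (X' w)", OF _ _ norm_ge_zero norm_ge_zero Y(2,3) X(1) order_refl, simplified]
  have E: "\<bar>X n w \<bullet> Y n w - X' w \<bullet> Y' w\<bar> \<le> ?dX n w * ?dY n w + ?dX n w * norm (Y' w) + ?dY n w * norm (X' w)" for n w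
  proof -
    have "X n w \<bullet> Y n w - X' w \<bullet> Y' w =
        (X n w - X' w) \<bullet> (Y n w - Y' w) + (X n w - X' w) \<bullet> Y' w + (Y n w - Y' w) \<bullet> X' w"
      by (simp add: inner_simps inner_commute)
    then show ?thesis
      using Cauchy_Schwarz_ineq2[of "X n w - X' w" "Y n w - Y' w"] Cauchy_Schwarz_ineq2[of "X n w - X' w" "Y' w"]
        Cauchy_Schwarz_ineq2[of "Y n w - Y' w" "X' w"] by linarith
  qed
  show i': "integrable M (\<lambda>w. X' w \<bullet> Y' w)"
  proof (rule Bochner_Integration.integrable_bound[of _ "\<lambda>w. norm (X' w) powr s + norm (Y' w) powr s'"])
    show "AE w in M. norm (X' w \<bullet> Y' w) \<le> norm (norm (X' w) powr s + norm (Y' w) powr s')"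
    proof (rule AE_I2)
      fix w
      show "norm (X' w \<bullet> Y' w) \<le> norm (norm (X' w) powr s + norm (Y' w) powr s')"
        using Cauchy_Schwarz_ineq2[of "X' w" "Y' w"] weighted_Young[of "norm (X' w)" "norm (Y' w)" 1, OF _ _ _ s] by simp
    qed
  qed (use X Y in auto)
  have iE: "integrable M (\<lambda>w. \<bar>X n w \<bullet> Y n w - X' w \<bullet> Y' w\<bar>)" for n
    by (rule Bochner_Integration.integrable_bound[of _ "\<lambda>w. ?dX n w * ?dY n w + ?dX n w * norm (Y' w) + ?dY n w * norm (X' w)"])
       (use 1(1) 2(1) 3(1) order_trans[OF E abs_ge_self] in \<open>auto intro!: AE_I2\<close>)
  have "integrable M (\<lambda>w. X n w \<bullet> Y n w - X' w \<bullet> Y' w)"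
    by (subst integrable_abs_iff[symmetric]) (use iE in auto)
  from Bochner_Integration.integrable_add[OF this i'] show "integrable M (\<lambda>w. X n w \<bullet> Y n w)" by simp
  show "(\<lambda>n. LINT w|M. \<bar>X n w \<bullet> Y n w - X' w \<bullet> Y' w\<bar>) \<longlonglongrightarrow> 0"
  proof (rule tendsto_sandwich[of "\<lambda>_. 0"])
    show "(\<lambda>n. (LINT w|M. ?dX n w * ?dY n w) + (LINT w|M. ?dX n w * norm (Y' w)) + (LINT w|M. ?dY n w * norm (X' w))) \<longlonglongrightarrow> 0"
      using tendsto_add[OF tendsto_add[OF 1(2) 2(2)] 3(2)] by simp
    show "\<forall>\<^sub>F n in sequentially. (LINT w|M. \<bar>X n w \<bullet> Y n w - X' w \<bullet> Y' w\<bar>) \<le>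
       (LINT w|M. ?dX n w * ?dY n w) + (LINT w|M. ?dX n w * norm (Y' w)) + (LINT w|M. ?dY n w * norm (X' w))"
    proof (intro always_eventually allI)
      fix n
      have "(LINT w|M. \<bar>X n w \<bullet> Y n w - X' w \<bullet> Y' w\<bar>) \<le>
         (LINT w|M. ?dX n w * ?dY n w + ?dX n w * norm (Y' w) + ?dY n w * norm (X' w))"
        using iE 1(1) 2(1) 3(1) by (intro integral_mono E) auto
      then show "(LINT w|M. \<bar>X n w \<bullet> Y n w - X' w \<bullet> Y' w\<bar>) \<le>
       (LINT w|M. ?dX n w * ?dY n w) + (LINT w|M. ?dX n w * norm (Y' w)) + (LINT w|M. ?dY n w * norm (X' w))"
        using 1(1) 2(1) 3(1) by simp
    qed
  qed (auto intro!: always_eventually Bochner_Integration.integral_nonneg)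
qed

lemma bounded_range_mult:
  fixes f g :: "'a \<Rightarrow> real"
  assumes "bounded (range f)" "bounded (range g)"
  shows "bounded (range (\<lambda>x. f x * g x))"
proof -
  obtain A B where "\<And>x. \<bar>f x\<bar> \<le> A" "\<And>x. \<bar>g x\<bar> \<le> B"
    using assms by (auto simp: bounded_iff)
  then have "\<bar>f x * g x\<bar> \<le> A * B" for x
    unfolding abs_mult by (intro mult_mono) (auto intro: order_trans[OF abs_ge_zero])
  then show ?thesis by (auto simp: bounded_iff)
qed

lemma bounded_range_inner:
  fixes f g :: "'a \<Rightarrow> 'b::real_inner"
  assumes "bounded (range f)" "bounded (range g)"
  shows "bounded (range (\<lambda>x. f x \<bullet> g x))"
proof -
  have "bounded (range (\<lambda>x. norm (f x) * norm (g x)))"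
    using assms by (intro bounded_range_mult) (auto simp: bounded_iff)
  then obtain B where "\<And>x. \<bar>norm (f x) * norm (g x)\<bar> \<le> B" by (auto simp: bounded_iff)
  then have "\<bar>f x \<bullet> g x\<bar> \<le> B" for x
    using Cauchy_Schwarz_ineq2[of "f x" "g x"] by (meson abs_le_D1 order_trans)
  then show ?thesis by (auto simp: bounded_iff)
qed

lemma integrable_bounded_support:
  fixes f :: "'e::euclidean_space \<Rightarrow> 'b::euclidean_space"
  assumes [measurable]: "f \<in> borel_measurable borel" and b: "bounded (range f)"
    and z: "\<And>w. norm w > \<rho> \<Longrightarrow> f w = 0"
  shows "integrable lborel f"
proof -
  obtain B where B: "\<And>w. norm (f w) \<le> B" using b by (auto simp: bounded_iff)
  show ?thesis
  proof (rule Bochner_Integration.integrable_bound)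
    show "integrable lborel (\<lambda>w::'e. B * indicator (cball 0 \<rho>) w)"
      using emeasure_bounded_finite[OF bounded_cball[of "0::'e" \<rho>]] by auto
    show "AE w in lborel. norm (f w) \<le> norm (B * indicator (cball 0 \<rho>) w)"
    proof (rule AE_I2)
      fix w
      show "norm (f w) \<le> norm (B * indicator (cball 0 \<rho>) w)"
        using B[of w] z[of w] by (cases "norm w \<le> \<rho>") auto
    qed
  qed measurable
qed

text \<open>The functions \<open>v\<close>, \<open>D\<close>, \<open>H\<close>, \<open>f\<close> on space-time stand for \<open>u - c\<close>, \<open>\<nabla>u\<close>, the flux
  and the source of \<open>\<partial>\<^sub>t u = div H + f\<close>; the hypotheses \<open>grad\<close> and \<open>eq\<close> say \<open>\<nabla>v = D\<close> and this
  equation after mollification, at the points where \<open>\<zeta> \<noteq> 0\<close>. As \<open>v\<close> takes values in \<open>[0, M]\<close>, so does its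
  mollification, hence the interval \<open>[c, c + M]\<close> in the hypotheses on \<open>F\<close>. The identity is the sum of the vanishing integrals of
  \<open>\<partial>\<^sub>t (Fh(c + v) \<zeta>)\<close> and \<open>- div (F(c + v) \<zeta> H)\<close>, in which the terms with \<open>div H\<close> cancel.\<close>
lemma mollified_chain_rule:
  fixes v f \<zeta> \<zeta>t :: "'a::euclidean_space \<times> real \<Rightarrow> real" and D H \<zeta>x :: "'a \<times> real \<Rightarrow> 'a"
    and F F' Fh :: "real \<Rightarrow> real" and r :: real
  defines "vr \<equiv> conv (mollifier r) v" and "Dr \<equiv> conv (mollifier r) D"
    and "Hr \<equiv> conv (mollifier r) H" and "fr \<equiv> conv (mollifier r) f"
  assumes r: "0 < r"
    and v: "integrable lborel v" "\<And>w. 0 \<le> v w" "\<And>w. v w \<le> M"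
    and D: "integrable lborel D" and H: "integrable lborel H" and f: "integrable lborel f"
    and [measurable]: "\<zeta> \<in> borel_measurable borel" "\<zeta>x \<in> borel_measurable borel" "\<zeta>t \<in> borel_measurable borel"
    and \<zeta>b: "bounded (range \<zeta>)" "bounded (range \<zeta>x)" "bounded (range \<zeta>t)"
    and \<zeta>0: "\<And>w. norm w > \<rho> \<Longrightarrow> \<zeta> w = 0" "\<And>w. norm w > \<rho> \<Longrightarrow> \<zeta>x w = 0" "\<And>w. norm w > \<rho> \<Longrightarrow> \<zeta>t w = 0"
    and dx: "\<And>w b. b \<in> Basis \<Longrightarrow> ((\<lambda>t. \<zeta> (w + t *\<^sub>R (b, 0))) has_real_derivative \<zeta>x w \<bullet> b) (at 0)"
    and dt: "\<And>w. ((\<lambda>t. \<zeta> (w + t *\<^sub>R (0, 1))) has_real_derivative \<zeta>t w) (at 0)"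
    and grad: "\<And>w b. \<zeta> w \<noteq> 0 \<Longrightarrow> b \<in> Basis \<Longrightarrow>
      conv (\<lambda>z. mollifier_grad r z \<bullet> (b, 0)) v w = Dr w \<bullet> b"
    and eq: "\<And>w. \<zeta> w \<noteq> 0 \<Longrightarrow> conv (\<lambda>z. mollifier_grad r z \<bullet> (0, 1)) v w =
      (LINT y|lborel. fst (mollifier_grad r (w - y)) \<bullet> H y) + fr w"
    and F: "\<And>x. c \<le> x \<Longrightarrow> x \<le> c + M \<Longrightarrow> (F has_real_derivative F' x) (at x)"
      "\<And>x. c \<le> x \<Longrightarrow> x \<le> c + M \<Longrightarrow> (Fh has_real_derivative F x) (at x)"
    and Fb: "\<And>x. c \<le> x \<Longrightarrow> x \<le> c + M \<Longrightarrow> \<bar>F x\<bar> \<le> C" "\<And>x. c \<le> x \<Longrightarrow> x \<le> c + M \<Longrightarrow> \<bar>F' x\<bar> \<le> C"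
      "\<And>x. c \<le> x \<Longrightarrow> x \<le> c + M \<Longrightarrow> \<bar>Fh x\<bar> \<le> C"
    and [measurable]: "F \<in> borel_measurable borel" "F' \<in> borel_measurable borel" "Fh \<in> borel_measurable borel"
  shows "0 \<le> vr w" and "vr w \<le> M"
    and "(LINT w|lborel. Fh (c + vr w) * \<zeta>t w) =
       (LINT w|lborel. F (c + vr w) * (\<zeta>x w \<bullet> Hr w)) + (LINT w|lborel. F' (c + vr w) * (\<zeta> w * (Hr w \<bullet> Dr w)))
       - (LINT w|lborel. F (c + vr w) * (\<zeta> w * fr w))"
proof -
  let ?k = "mollifier r :: 'a \<times> real \<Rightarrow> real"
  let ?kg = "\<lambda>e z. mollifier_grad r z \<bullet> (e :: 'a \<times> real)"
  have [measurable]: "v \<in> borel_measurable borel" "D \<in> borel_measurable borel"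
    "H \<in> borel_measurable borel" "f \<in> borel_measurable borel"
    using v D H f by auto
  have [measurable]: "vr \<in> borel_measurable borel" "Dr \<in> borel_measurable borel"
    "Hr \<in> borel_measurable borel" "fr \<in> borel_measurable borel"
    unfolding vr_def Dr_def Hr_def fr_def by measurable
  obtain Bk where Bk: "\<And>w. norm (?k w) \<le> Bk" using bounded_mollifier[OF r] by blast
  obtain Bg where Bg: "\<And>w::'a \<times> real. norm (mollifier_grad r w) \<le> Bg" using bounded_mollifier_grad[OF r] by blast
  have kgb: "norm (?kg e w) \<le> Bg * norm e" for e w
    using Cauchy_Schwarz_ineq2[of "mollifier_grad r w" e] mult_right_mono[OF Bg[of w], of "norm e"] by simp
  have conv_b: "bounded (range (conv ?k X))" if "integrable lborel X" for X :: "'a \<times> real \<Rightarrow> 'b::euclidean_space"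
    using integrable_bounded_kernel(2)[of ?k X Bk] that Bk by (auto simp: bounded_iff)
  have convg_b: "bounded (range (conv (?kg e) X))" if "integrable lborel X" for X :: "'a \<times> real \<Rightarrow> real" and e
    using integrable_bounded_kernel(2)[of "?kg e" X "Bg * norm e"] that kgb by (auto simp: bounded_iff)
  have k1: "integrable lborel (\<lambda>y. ?k (w - y))" "(LINT y|lborel. ?k (w - y)) = 1" for w
    using integrable_mollifier[OF r, where ?'e="'a \<times> real"] integral_mollifier[OF r, where ?'e="'a \<times> real"]
      integrable_lborel_reflect[of ?k w] integral_lborel_reflect[of ?k w] by auto
  have k0: "0 \<le> ?k z" for z by (rule mollifier_nonneg[OF r])
  show vr0: "0 \<le> vr w" for w
    unfolding vr_def conv_def using k0 v by (intro Bochner_Integration.integral_nonneg) auto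
  show vrM: "vr w \<le> M" for w
  proof -
    have "vr w \<le> (LINT y|lborel. ?k (w - y) * M)"
      unfolding vr_def conv_def real_scaleR_def
      using k0 v k1 integrable_bounded_kernel(1)[of ?k v Bk w] Bk by (intro integral_mono mult_left_mono) auto
    then show ?thesis using k1 by simp
  qed
  have vrc: "c \<le> c + vr w" "c + vr w \<le> c + M" for w using vr0 vrM by auto
  have FB: "bounded (range (\<lambda>w. F (c + vr w)))" "bounded (range (\<lambda>w. F' (c + vr w)))" "bounded (range (\<lambda>w. Fh (c + vr w)))"
    using Fb vrc by (auto simp: bounded_iff intro!: exI[of _ C])
  have Hb: "Hr w \<bullet> b = conv ?k (\<lambda>y. H y \<bullet> b) w" for w b
  proof -
    have "Hr w \<bullet> b = (LINT y|lborel. (?k (w - y) *\<^sub>R H y) \<bullet> b)"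
      unfolding Hr_def conv_def
      by (rule integral_inner_left[symmetric]) (use integrable_bounded_kernel(1)[of ?k H Bk w] H Bk in auto)
    then show ?thesis by (simp add: conv_def)
  qed
  have Hbi: "integrable lborel (\<lambda>y. H y \<bullet> b)" for b using H by auto
  have dconv: "((\<lambda>t. conv ?k X (w + t *\<^sub>R e)) has_real_derivative conv (?kg e) X w) (at 0)"
    if "integrable lborel X" for X :: "'a \<times> real \<Rightarrow> real" and w e
    using Bk kgb[of _ e] that DERIV_along_line[OF has_derivative_mollifier]
    by (intro DERIV_conv[of ?k "?kg e" Bk X e "Bg * norm e"]) simp_all
  define vt where "vt = conv (?kg (0, 1)) v"
  define vx where "vx b = conv (?kg (b, 0)) v" for b
  define hx where "hx b = conv (?kg (b, 0)) (\<lambda>y. H y \<bullet> b)" for b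
  have [measurable]: "vt \<in> borel_measurable borel" "vx b \<in> borel_measurable borel" "hx b \<in> borel_measurable borel" for b
    unfolding vt_def vx_def hx_def by measurable
  have bd: "bounded (range vt)" "bounded (range (vx b))" "bounded (range (hx b))" "bounded (range Hr)" "bounded (range Dr)"
    "bounded (range fr)" "bounded (range (\<lambda>w. Hr w \<bullet> b))" "bounded (range (\<lambda>w. \<zeta>x w \<bullet> b))"  for b
    unfolding vt_def vx_def hx_def Hr_def Dr_def fr_def
    by (intro conv_b convg_b v H D f Hbi bounded_range_inner \<zeta>b; simp)+
  have chain: "((\<lambda>t. \<Phi> (c + vr (w + t *\<^sub>R e))) has_real_derivative \<Phi>' * conv (?kg e) v w) (at 0)"
    if "(\<Phi> has_real_derivative \<Phi>') (at (c + vr w))" for \<Phi> \<Phi>' w e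
    using that dconv[OF v(1), of w e] unfolding vr_def
    by (intro DERIV_chain2[where f=\<Phi>]) (auto intro!: derivative_eq_intros)
  define Tt where "Tt w = F (c + vr w) * vt w * \<zeta> w + Fh (c + vr w) * \<zeta>t w" for w
  have Tt_b: "bounded (range Tt)"
    unfolding Tt_def by (intro bounded_plus_comp bounded_range_mult FB bd \<zeta>b)
  have [measurable]: "Tt \<in> borel_measurable borel" unfolding Tt_def[abs_def] by measurable
  have Tt: "integrable lborel Tt" "(LINT w|lborel. Tt w) = 0"
  proof -
    show "integrable lborel Tt"
      by (rule integrable_bounded_support[OF _ Tt_b, where \<rho>=\<rho>]) (auto simp: Tt_def \<zeta>0)
    have i: "integrable lborel (\<lambda>w. Fh (c + vr w) * \<zeta> w)"
      by (rule integrable_bounded_support[where \<rho>=\<rho>]) (auto simp: \<zeta>0 intro!: bounded_range_mult FB \<zeta>b)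
    obtain B where B: "\<And>w. \<bar>Tt w\<bar> \<le> B" using Tt_b by (auto simp: bounded_iff)
    have d: "((\<lambda>t. Fh (c + vr (w + t *\<^sub>R (0, 1))) * \<zeta> (w + t *\<^sub>R (0, 1))) has_real_derivative Tt w) (at 0)" for w
      using DERIV_mult[OF chain[OF F(2)[OF vrc], of w "(0, 1)"] dt[of w]]
      by (simp add: Tt_def vt_def algebra_simps flip: zero_prod_def)
    show "(LINT w|lborel. Tt w) = 0"
      by (rule integral_directional_derivative_eq_0[OF i _ d B, where r=\<rho>]) (auto simp: \<zeta>0)
  qed
  define Tx where "Tx b w = F' (c + vr w) * vx b w * (\<zeta> w * (Hr w \<bullet> b)) +
      F (c + vr w) * ((\<zeta>x w \<bullet> b) * (Hr w \<bullet> b) + \<zeta> w * hx b w)" for b w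
  have Tx_b: "bounded (range (Tx b))" for b
    unfolding Tx_def by (intro bounded_plus_comp bounded_range_mult FB bd \<zeta>b)
  have [measurable]: "Tx b \<in> borel_measurable borel" for b unfolding Tx_def[abs_def] by measurable
  have Tx: "integrable lborel (Tx b)" "(LINT w|lborel. Tx b w) = 0" if b: "b \<in> Basis" for b
  proof -
    show "integrable lborel (Tx b)"
      by (rule integrable_bounded_support[OF _ Tx_b, where \<rho>=\<rho>]) (auto simp: Tx_def \<zeta>0)
    have i: "integrable lborel (\<lambda>w. F (c + vr w) * (\<zeta> w * (Hr w \<bullet> b)))"
      by (rule integrable_bounded_support[where \<rho>=\<rho>]) (auto simp: \<zeta>0 intro!: bounded_range_mult FB \<zeta>b bd)
    obtain B where B: "\<And>w. \<bar>Tx b w\<bar> \<le> B" using Tx_b[of b] by (auto simp: bounded_iff)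
    have d: "((\<lambda>t. F (c + vr (w + t *\<^sub>R (b, 0))) * (\<zeta> (w + t *\<^sub>R (b, 0)) * (Hr (w + t *\<^sub>R (b, 0)) \<bullet> b))) has_real_derivative Tx b w) (at 0)" for w
      using DERIV_mult[OF chain[OF F(1)[OF vrc], of w "(b, 0)"] DERIV_mult[OF dx[OF b, of w] dconv[OF Hbi[of b], of w "(b, 0)"]]]
      by (simp add: Tx_def vx_def hx_def Hb algebra_simps flip: zero_prod_def)
    show "(LINT w|lborel. Tx b w) = 0"
      by (rule integral_directional_derivative_eq_0[OF i _ d B, where r=\<rho>]) (auto simp: \<zeta>0)
  qed
  have div: "(\<Sum>b\<in>Basis. hx b w) = (LINT y|lborel. fst (mollifier_grad r (w - y)) \<bullet> H y)" for w
  proof -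
    have "integrable lborel (\<lambda>y. ?kg (b, 0) (w - y) * (H y \<bullet> b))" for b
      by (rule integrable_bounded_kernel(1)[where k="?kg (b, 0)" and f="\<lambda>y. H y \<bullet> b" and w=w, unfolded real_scaleR_def, OF _ Hbi kgb])
         measurable
    then have "(\<Sum>b\<in>Basis. hx b w) = (LINT y|lborel. (\<Sum>b\<in>Basis. ?kg (b, 0) (w - y) * (H y \<bullet> b)))"
      unfolding hx_def conv_def real_scaleR_def
      by (intro Bochner_Integration.integral_sum[symmetric])
    also have "\<dots> = (LINT y|lborel. fst (mollifier_grad r (w - y)) \<bullet> H y)"
      by (intro Bochner_Integration.integral_cong refl) (simp add: inner_prod_def euclidean_inner[symmetric])
    finally show ?thesis .
  qed
  have pw: "Tt w - (\<Sum>b\<in>Basis. Tx b w) = Fh (c + vr w) * \<zeta>t w + F (c + vr w) * (\<zeta> w * fr w)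
      - F' (c + vr w) * (\<zeta> w * (Hr w \<bullet> Dr w)) - F (c + vr w) * (\<zeta>x w \<bullet> Hr w)" for w
  proof -
    have "(\<Sum>b\<in>Basis. Tx b w) = (\<Sum>b\<in>Basis. F' (c + vr w) * (\<zeta> w * (vx b w * (Hr w \<bullet> b)))) +
        F (c + vr w) * (\<zeta>x w \<bullet> Hr w) + F (c + vr w) * (\<zeta> w * (\<Sum>b\<in>Basis. hx b w))"
      unfolding Tx_def euclidean_inner[of "\<zeta>x w" "Hr w"] sum_distrib_left sum.distrib[symmetric]
      by (intro sum.cong refl) (simp add: algebra_simps)
    moreover have "(\<Sum>b\<in>Basis. F' (c + vr w) * (\<zeta> w * (vx b w * (Hr w \<bullet> b)))) = F' (c + vr w) * (\<zeta> w * (Hr w \<bullet> Dr w))"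
    proof -
      have "\<zeta> w * (vx b w * (Hr w \<bullet> b)) = \<zeta> w * ((Hr w \<bullet> b) * (Dr w \<bullet> b))" if "b \<in> Basis" for b
        using grad[of w b] that by (cases "\<zeta> w = 0") (auto simp: vx_def)
      then show ?thesis
        unfolding euclidean_inner[of "Hr w" "Dr w"] sum_distrib_left by (intro sum.cong refl) (simp only:)
    qed
    moreover have "\<zeta> w * vt w = \<zeta> w * (\<Sum>b\<in>Basis. hx b w) + \<zeta> w * fr w"
      using eq[of w] by (cases "\<zeta> w = 0") (auto simp: vt_def div algebra_simps)
    then have "F (c + vr w) * vt w * \<zeta> w = F (c + vr w) * (\<zeta> w * (\<Sum>b\<in>Basis. hx b w)) + F (c + vr w) * (\<zeta> w * fr w)"
      by (metis (no_types, lifting) mult.assoc mult.commute distrib_left)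
    ultimately show ?thesis unfolding Tt_def by simp
  qed
  have i: "integrable lborel (\<lambda>w. Fh (c + vr w) * \<zeta>t w)" "integrable lborel (\<lambda>w. F (c + vr w) * (\<zeta> w * fr w))"
    "integrable lborel (\<lambda>w. F' (c + vr w) * (\<zeta> w * (Hr w \<bullet> Dr w)))" "integrable lborel (\<lambda>w. F (c + vr w) * (\<zeta>x w \<bullet> Hr w))"
    by (rule integrable_bounded_support[where \<rho>=\<rho>]; auto simp: \<zeta>0 intro!: bounded_range_mult bounded_range_inner FB \<zeta>b bd)+
  have "0 = (LINT w|lborel. Tt w - (\<Sum>b\<in>Basis. Tx b w))"
    using Tt Tx by simp
  also have "\<dots> = (LINT w|lborel. Fh (c + vr w) * \<zeta>t w) + (LINT w|lborel. F (c + vr w) * (\<zeta> w * fr w))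
      - (LINT w|lborel. F' (c + vr w) * (\<zeta> w * (Hr w \<bullet> Dr w))) - (LINT w|lborel. F (c + vr w) * (\<zeta>x w \<bullet> Hr w))"
    unfolding pw using i by simp
  finally show "(LINT w|lborel. Fh (c + vr w) * \<zeta>t w) =
       (LINT w|lborel. F (c + vr w) * (\<zeta>x w \<bullet> Hr w)) + (LINT w|lborel. F' (c + vr w) * (\<zeta> w * (Hr w \<bullet> Dr w)))
       - (LINT w|lborel. F (c + vr w) * (\<zeta> w * fr w))" by simp
qed

lemma tendsto_L1_dominated_difference:
  fixes X :: "nat \<Rightarrow> 'a \<Rightarrow> real"
  assumes i: "\<And>n. integrable M (X n)" "integrable M X'" and e: "\<And>n. integrable M (e n)" "(\<lambda>n. LINT w|M. e n w) \<longlonglongrightarrow> 0"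
    and b: "\<And>n w. \<bar>X n w - X' w\<bar> \<le> B * e n w"
  shows "(\<lambda>n. LINT w|M. \<bar>X n w - X' w\<bar>) \<longlonglongrightarrow> 0"
proof (rule tendsto_sandwich[of "\<lambda>_. 0"])
  show "(\<lambda>n. B * (LINT w|M. e n w)) \<longlonglongrightarrow> 0" using tendsto_mult_right_zero[OF e(2)] by simp
  show "\<forall>\<^sub>F n in sequentially. (LINT w|M. \<bar>X n w - X' w\<bar>) \<le> B * (LINT w|M. e n w)"
  proof (intro always_eventually allI)
    fix n
    have "(LINT w|M. \<bar>X n w - X' w\<bar>) \<le> (LINT w|M. B * e n w)"
      using i e b by (intro integral_mono) auto
    then show "(LINT w|M. \<bar>X n w - X' w\<bar>) \<le> B * (LINT w|M. e n w)" by simp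
  qed
qed (auto intro!: always_eventually Bochner_Integration.integral_nonneg)

text \<open>Let the radius of mollification tend to \<open>0\<close>. Along a subsequence \<open>v\<close> converges almost everywhere, hence
  boundedly after composition with \<open>F\<close>, \<open>F'\<close>, \<open>Fh\<close>; the factors \<open>\<zeta>x \<bullet> H\<close>, \<open>\<zeta> f\<close> and, by
  the conjugate exponents, \<open>\<zeta> (H \<bullet> D)\<close> converge in \<open>L\<^sup>1\<close>.\<close>
lemma weak_chain_rule:
  fixes v f \<zeta> \<zeta>t :: "'a::euclidean_space \<times> real \<Rightarrow> real" and D H \<zeta>x :: "'a \<times> real \<Rightarrow> 'a"
    and F F' Fh :: "real \<Rightarrow> real"
  assumes r0: "0 < r0" and s: "1 < s" "1 < s'" "1 / s + 1 / s' = 1"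
    and v: "integrable lborel v" "\<And>w. 0 \<le> v w" "\<And>w. v w \<le> M"
    and D: "integrable lborel D" "integrable lborel (\<lambda>w. norm (D w) powr s)"
    and H: "integrable lborel H" "integrable lborel (\<lambda>w. norm (H w) powr s')"
    and f: "integrable lborel f"
    and \<zeta>m[measurable]: "\<zeta> \<in> borel_measurable borel" "\<zeta>x \<in> borel_measurable borel" "\<zeta>t \<in> borel_measurable borel"
    and \<zeta>b: "bounded (range \<zeta>)" "bounded (range \<zeta>x)" "bounded (range \<zeta>t)"
    and \<zeta>0: "\<And>w. norm w > \<rho> \<Longrightarrow> \<zeta> w = 0" "\<And>w. norm w > \<rho> \<Longrightarrow> \<zeta>x w = 0" "\<And>w. norm w > \<rho> \<Longrightarrow> \<zeta>t w = 0"
    and dx: "\<And>w b. b \<in> Basis \<Longrightarrow> ((\<lambda>t. \<zeta> (w + t *\<^sub>R (b, 0))) has_real_derivative \<zeta>x w \<bullet> b) (at 0)"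
    and dt: "\<And>w. ((\<lambda>t. \<zeta> (w + t *\<^sub>R (0, 1))) has_real_derivative \<zeta>t w) (at 0)"
    and grad: "\<And>r w b. 0 < r \<Longrightarrow> r < r0 \<Longrightarrow> \<zeta> w \<noteq> 0 \<Longrightarrow> b \<in> Basis \<Longrightarrow>
      conv (\<lambda>z. mollifier_grad r z \<bullet> (b, 0)) v w = conv (mollifier r) D w \<bullet> b"
    and eq: "\<And>r w. 0 < r \<Longrightarrow> r < r0 \<Longrightarrow> \<zeta> w \<noteq> 0 \<Longrightarrow> conv (\<lambda>z. mollifier_grad r z \<bullet> (0, 1)) v w =
      (LINT y|lborel. fst (mollifier_grad r (w - y)) \<bullet> H y) + conv (mollifier r) f w"
    and F: "\<And>x. c \<le> x \<Longrightarrow> x \<le> c + M \<Longrightarrow> (F has_real_derivative F' x) (at x)"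
      "\<And>x. c \<le> x \<Longrightarrow> x \<le> c + M \<Longrightarrow> (Fh has_real_derivative F x) (at x)"
    and F'c: "continuous_on {c..c + M} F'"
    and Fm[measurable]: "F \<in> borel_measurable borel" "F' \<in> borel_measurable borel" "Fh \<in> borel_measurable borel"
  shows "(LINT w|lborel. Fh (c + v w) * \<zeta>t w) =
       (LINT w|lborel. F (c + v w) * (\<zeta>x w \<bullet> H w)) + (LINT w|lborel. F' (c + v w) * (\<zeta> w * (H w \<bullet> D w)))
       - (LINT w|lborel. F (c + v w) * (\<zeta> w * f w))"
proof -
  have [measurable]: "v \<in> borel_measurable borel" "D \<in> borel_measurable borel"
    "H \<in> borel_measurable borel" "f \<in> borel_measurable borel"
    using v D H f by auto
  have Fc: "continuous_on {c..c + M} F" "continuous_on {c..c + M} Fh"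
    by (rule continuous_at_imp_continuous_on, rule ballI, rule DERIV_isCont, rule F; simp)+
  obtain C where C: "\<And>x. c \<le> x \<Longrightarrow> x \<le> c + M \<Longrightarrow> \<bar>F x\<bar> \<le> C" "\<And>x. c \<le> x \<Longrightarrow> x \<le> c + M \<Longrightarrow> \<bar>F' x\<bar> \<le> C"
      "\<And>x. c \<le> x \<Longrightarrow> x \<le> c + M \<Longrightarrow> \<bar>Fh x\<bar> \<le> C"
  proof -
    have "bounded (F ` {c..c+M} \<union> F' ` {c..c+M} \<union> Fh ` {c..c+M})"
      using Fc F'c by (auto intro!: compact_imp_bounded compact_continuous_image)
    then obtain C where "\<forall>y \<in> F ` {c..c+M} \<union> F' ` {c..c+M} \<union> Fh ` {c..c+M}. norm y \<le> C"
      unfolding bounded_iff by blast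
    then show ?thesis by (intro that[of C]) auto
  qed
  \<comment> \<open>The shift by \<open>2\<close> keeps every radius strictly below \<open>r0\<close>.\<close>
  define r where "r n = r0 / real (n + 2)" for n
  have r: "0 < r n" "r n < r0" for n
  proof -
    have "r0 / real (n + 2) < r0 / 1" using r0 by (intro divide_strict_left_mono) auto
    then show "0 < r n" "r n < r0" using r0 by (simp_all add: r_def)
  qed
  have "(\<lambda>n. r0 / real n) \<longlonglongrightarrow> 0" by (rule lim_const_over_n)
  from LIMSEQ_ignore_initial_segment[OF this, of 2] have rl: "r \<longlonglongrightarrow> 0" unfolding r_def .
  have Ls: "integrable lborel (\<lambda>w. norm (conv (mollifier (r n)) g w - g w))"
      "(\<lambda>n. LINT w|lborel. norm (conv (mollifier (r n)) g w - g w)) \<longlonglongrightarrow> 0"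
    if "integrable lborel g" "\<And>n. 0 < r n" "r \<longlonglongrightarrow> 0" for g :: "'a \<times> real \<Rightarrow> 'b::euclidean_space" and r n
    using mollification_tendsto_Ls[of g 1 r] that by auto
  have vint: "integrable lborel (\<lambda>w. conv (mollifier (r n)) v w - v w)" for n
    using Ls(1)[OF v(1) r(1) rl, of n] by (subst integrable_norm_iff[symmetric]) auto
  obtain \<sigma> where \<sigma>: "strict_mono (\<sigma> :: nat \<Rightarrow> nat)"
    "AE w in lborel. (\<lambda>n. conv (mollifier (r (\<sigma> n))) v w - v w) \<longlonglongrightarrow> 0"
    using tendsto_L1_AE_subseq[OF vint Ls(2)[OF v(1) r(1) rl]] by blast
  define R where "R n = r (\<sigma> n)" for n
  have R: "0 < R n" "R n < r0" for n using r by (auto simp: R_def)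
  have Rl: "R \<longlonglongrightarrow> 0" using LIMSEQ_subseq_LIMSEQ[OF rl \<sigma>(1)] by (simp add: R_def[abs_def] comp_def)
  define vn where "vn n = conv (mollifier (R n)) v" for n
  define Dn where "Dn n = conv (mollifier (R n)) D" for n
  define Hn where "Hn n = conv (mollifier (R n)) H" for n
  define fn where "fn n = conv (mollifier (R n)) f" for n
  have [measurable]: "vn n \<in> borel_measurable borel" "Dn n \<in> borel_measurable borel"
    "Hn n \<in> borel_measurable borel" "fn n \<in> borel_measurable borel" for n
    unfolding vn_def Dn_def Hn_def fn_def by measurable
  have vnl: "AE w in lborel. (\<lambda>n. vn n w) \<longlonglongrightarrow> v w"
    using \<sigma>(2) unfolding vn_def R_def by (simp add: LIM_zero_iff)
  have step: "0 \<le> vn n w" "vn n w \<le> M" "(LINT w|lborel. Fh (c + vn n w) * \<zeta>t w) =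
       (LINT w|lborel. F (c + vn n w) * (\<zeta>x w \<bullet> Hn n w)) + (LINT w|lborel. F' (c + vn n w) * (\<zeta> w * (Hn n w \<bullet> Dn n w)))
       - (LINT w|lborel. F (c + vn n w) * (\<zeta> w * fn n w))" for n w
    using mollified_chain_rule[OF R(1)[of n] v D(1) H(1) f \<zeta>m \<zeta>b \<zeta>0 dx dt grad[OF R[of n]] eq[OF R[of n]] F C Fm]
    unfolding vn_def Dn_def Hn_def fn_def by auto
  have A: "\<bar>\<Phi> (c + vn n w)\<bar> \<le> C" "AE w in lborel. (\<lambda>n. \<Phi> (c + vn n w)) \<longlonglongrightarrow> \<Phi> (c + v w)"
    if "continuous_on {c..c + M} \<Phi>" "\<And>x. c \<le> x \<Longrightarrow> x \<le> c + M \<Longrightarrow> \<bar>\<Phi> x\<bar> \<le> C" for \<Phi> n w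
  proof -
    show "\<bar>\<Phi> (c + vn n w)\<bar> \<le> C" using that(2) step(1,2)[of n w] by auto
    show "AE w in lborel. (\<lambda>n. \<Phi> (c + vn n w)) \<longlonglongrightarrow> \<Phi> (c + v w)"
      using vnl
    proof eventually_elim
      case (elim w)
      show ?case
        by (rule continuous_on_tendsto_compose[OF that(1)])
           (use elim v(2,3)[of w] step(1,2)[of _ w] in \<open>auto intro!: tendsto_intros always_eventually\<close>)
    qed
  qed
  obtain B where B: "\<And>w. \<bar>\<zeta> w\<bar> \<le> B" "\<And>w. norm (\<zeta>x w) \<le> B" "0 \<le> B"
  proof -
    obtain B1 B2 where "\<And>w. \<bar>\<zeta> w\<bar> \<le> B1" "\<And>w. norm (\<zeta>x w) \<le> B2"
      using \<zeta>b by (auto simp: bounded_iff)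
    then show ?thesis by (intro that[of "max 0 (max B1 B2)"]) (auto simp: le_max_iff_disj)
  qed
  have Hni: "integrable lborel (\<lambda>w. norm (Hn n w - H w))" for n using Ls(1)[OF H(1) R(1) Rl] by (simp add: Hn_def)
  have fni: "integrable lborel (\<lambda>w. norm (fn n w - f w))" for n using Ls(1)[OF f R(1) Rl] by (simp add: fn_def)
  have bm: "integrable lborel (\<lambda>w. g w *\<^sub>R X w)" if "integrable lborel X" "g \<in> borel_measurable borel" "\<And>w. \<bar>g w\<bar> \<le> B"
    for X :: "'a \<times> real \<Rightarrow> 'b::euclidean_space" and g
    by (rule Bochner_Integration.integrable_bound[OF integrable_scaleR_right[OF that(1), of B]])
       (use that B in \<open>auto intro!: AE_I2 mult_right_mono\<close>)
  have bi: "integrable lborel (\<lambda>w. \<zeta>x w \<bullet> X w)" if "integrable lborel X" for X :: "'a \<times> real \<Rightarrow> 'a"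
  proof (rule Bochner_Integration.integrable_bound[OF integrable_scaleR_right[OF that(1), of B]])
    show "AE w in lborel. norm (\<zeta>x w \<bullet> X w) \<le> norm (B *\<^sub>R X w)"
      using B Cauchy_Schwarz_ineq2 by (intro AE_I2) (auto intro!: order_trans[OF Cauchy_Schwarz_ineq2] mult_right_mono)
  qed (use that in auto)
  have Hi: "integrable lborel (Hn n)" for n
  proof -
    have "integrable lborel (\<lambda>w. Hn n w - H w)" using Hni[of n] by (subst integrable_norm_iff[symmetric]) auto
    from Bochner_Integration.integrable_add[OF this H(1)] show ?thesis by simp
  qed
  have fi: "integrable lborel (fn n)" for n
  proof -
    have "integrable lborel (\<lambda>w. fn n w - f w)" using fni[of n] by (subst integrable_norm_iff[symmetric]) auto
    from Bochner_Integration.integrable_add[OF this f] show ?thesis by simp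
  qed
  have ss: "1 \<le> s" "1 \<le> s'" "1 / s' + 1 / s = 1" using s by auto
  note HD = tendsto_L1_inner[OF s(2,1) ss(3), of Hn lborel Dn H D]
  have HD: "integrable lborel (\<lambda>w. Hn n w \<bullet> Dn n w)" "integrable lborel (\<lambda>w. H w \<bullet> D w)"
    "(\<lambda>n. LINT w|lborel. \<bar>Hn n w \<bullet> Dn n w - H w \<bullet> D w\<bar>) \<longlonglongrightarrow> 0" for n
    using HD H(2) D(2) mollification_tendsto_Ls[OF H ss(2) R(1) Rl] mollification_tendsto_Ls[OF D ss(1) R(1) Rl]
    unfolding Hn_def Dn_def by auto
  have HDi: "integrable lborel (\<lambda>w. \<bar>Hn n w \<bullet> Dn n w - H w \<bullet> D w\<bar>)" for n using HD(1,2) by auto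
  have T1: "(\<lambda>n. LINT w|lborel. Fh (c + vn n w) * \<zeta>t w) \<longlonglongrightarrow> (LINT w|lborel. Fh (c + v w) * \<zeta>t w)"
    by (rule tendsto_integral_bounded_mult[OF _ _ A[OF Fc(2) C(3)]])
       (auto intro!: integrable_bounded_support[OF _ \<zeta>b(3), where \<rho>=\<rho>] \<zeta>0)
  have T2: "(\<lambda>n. LINT w|lborel. F (c + vn n w) * (\<zeta>x w \<bullet> Hn n w)) \<longlonglongrightarrow> (LINT w|lborel. F (c + v w) * (\<zeta>x w \<bullet> H w))"
  proof (rule tendsto_integral_bounded_mult[OF _ _ A[OF Fc(1) C(1)]])
    show "(\<lambda>n. LINT w|lborel. \<bar>\<zeta>x w \<bullet> Hn n w - \<zeta>x w \<bullet> H w\<bar>) \<longlonglongrightarrow> 0"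
    proof (rule tendsto_L1_dominated_difference[where B=B])
      show "(\<lambda>n. LINT w|lborel. norm (Hn n w - H w)) \<longlonglongrightarrow> 0" using Ls(2)[OF H(1) R(1) Rl] by (simp add: Hn_def)
      show "\<bar>\<zeta>x w \<bullet> Hn n w - \<zeta>x w \<bullet> H w\<bar> \<le> B * norm (Hn n w - H w)" for n w
        using Cauchy_Schwarz_ineq2[of "\<zeta>x w" "Hn n w - H w"] mult_right_mono[OF B(2)[of w], of "norm (Hn n w - H w)"]
        by (simp add: inner_diff_right)
    qed (use bi Hi H Hni in auto)
  qed (use bi Hi H in auto)
  have T3: "(\<lambda>n. LINT w|lborel. F' (c + vn n w) * (\<zeta> w * (Hn n w \<bullet> Dn n w))) \<longlonglongrightarrow>
      (LINT w|lborel. F' (c + v w) * (\<zeta> w * (H w \<bullet> D w)))"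
  proof (rule tendsto_integral_bounded_mult[OF _ _ A[OF F'c C(2)]])
    show "(\<lambda>n. LINT w|lborel. \<bar>\<zeta> w * (Hn n w \<bullet> Dn n w) - \<zeta> w * (H w \<bullet> D w)\<bar>) \<longlonglongrightarrow> 0"
    proof (rule tendsto_L1_dominated_difference[where B=B, OF _ _ HDi HD(3)])
      show "\<bar>\<zeta> w * (Hn n w \<bullet> Dn n w) - \<zeta> w * (H w \<bullet> D w)\<bar> \<le> B * \<bar>Hn n w \<bullet> Dn n w - H w \<bullet> D w\<bar>" for n w
        using mult_right_mono[OF B(1)[of w], of "\<bar>Hn n w \<bullet> Dn n w - H w \<bullet> D w\<bar>"]
        by (simp add: abs_mult[symmetric] right_diff_distrib)
    qed (use bm[OF HD(1) _ B(1)] bm[OF HD(2) _ B(1)] in auto)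
  qed (use bm[OF HD(1) _ B(1)] bm[OF HD(2) _ B(1)] in auto)
  have T4: "(\<lambda>n. LINT w|lborel. F (c + vn n w) * (\<zeta> w * fn n w)) \<longlonglongrightarrow> (LINT w|lborel. F (c + v w) * (\<zeta> w * f w))"
  proof (rule tendsto_integral_bounded_mult[OF _ _ A[OF Fc(1) C(1)]])
    show "(\<lambda>n. LINT w|lborel. \<bar>\<zeta> w * fn n w - \<zeta> w * f w\<bar>) \<longlonglongrightarrow> 0"
    proof (rule tendsto_L1_dominated_difference[where B=B, OF _ _ fni])
      show "(\<lambda>n. LINT w|lborel. norm (fn n w - f w)) \<longlonglongrightarrow> 0" using Ls(2)[OF f R(1) Rl] by (simp add: fn_def)
      show "\<bar>\<zeta> w * fn n w - \<zeta> w * f w\<bar> \<le> B * norm (fn n w - f w)" for n w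
        using mult_right_mono[OF B(1)[of w], of "\<bar>fn n w - f w\<bar>"]
        by (simp add: abs_mult[symmetric] right_diff_distrib)
    qed (use bm[OF fi _ B(1)] bm[OF f _ B(1)] in auto)
  qed (use bm[OF fi _ B(1)] bm[OF f _ B(1)] in auto)
  have "(\<lambda>n. LINT w|lborel. Fh (c + vn n w) * \<zeta>t w) \<longlonglongrightarrow>
       (LINT w|lborel. F (c + v w) * (\<zeta>x w \<bullet> H w)) + (LINT w|lborel. F' (c + v w) * (\<zeta> w * (H w \<bullet> D w)))
       - (LINT w|lborel. F (c + v w) * (\<zeta> w * f w))"
    unfolding step(3) by (intro tendsto_diff tendsto_add T2 T3 T4)
  then show ?thesis using T1 LIMSEQ_unique by blast
qed

section \<open>The gauge, its gradient and its dilations\<close>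

text \<open>The degenerate matrix of the Grushin structure: it maps the Euclidean gradient at \<open>z\<close> to \<open>\<nabla>\<^sub>\<gamma>\<close>.\<close>
definition weighted :: "real \<Rightarrow> ('m::finite, 'k::finite) gpoint \<Rightarrow> ('m, 'k) gpoint \<Rightarrow> ('m, 'k) gpoint" where
  "weighted \<gamma> z v = (fst v, rpow (norm (fst z)) \<gamma> *\<^sub>R snd v)"

text \<open>The Euclidean gradient of the gauge where \<open>x \<noteq> 0\<close>.\<close>
definition rho_grad :: "real \<Rightarrow> ('m::finite, 'k::finite) gpoint \<Rightarrow> ('m, 'k) gpoint" where
  "rho_grad \<gamma> z = rho \<gamma> z powr (- 1 - 2 * \<gamma>) *\<^sub>R
     (norm (fst z) powr (2 * \<gamma>) *\<^sub>R fst z, (1 + \<gamma>) *\<^sub>R snd z)"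

lemma rho_nonneg: "0 \<le> rho \<gamma> z"
  by (simp add: rho_def)

lemma rho_powr:
  assumes "0 \<le> \<gamma>"
  shows "rho \<gamma> z powr (2 * (1 + \<gamma>)) = norm (fst z) powr (2 * (1 + \<gamma>)) + (1 + \<gamma>)\<^sup>2 * (norm (snd z))\<^sup>2"
  using assms by (simp add: rho_def powr_powr)

lemma continuous_on_rho:
  assumes "0 \<le> \<gamma>"
  shows "continuous_on S (rho \<gamma> :: ('m::finite, 'k::finite) gpoint \<Rightarrow> real)"
proof -
  have "continuous_on S (\<lambda>z::('m, 'k) gpoint. norm (fst z) powr (2 * (1 + \<gamma>)))"
    using assms by (intro continuous_on_powr' continuous_intros ballI conjI impI) auto
  then show ?thesis
    unfolding rho_def[abs_def] using assms
    by (intro continuous_on_powr' continuous_intros ballI conjI impI) (simp_all add: add_nonneg_nonneg)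
qed

lemma borel_measurable_rho [measurable]:
  "(rho \<gamma> :: ('m::finite, 'k::finite) gpoint \<Rightarrow> real) \<in> borel_measurable borel"
proof -
  have [measurable]: "(fst :: ('m, 'k) gpoint \<Rightarrow> _) \<in> borel_measurable borel" "(snd :: ('m, 'k) gpoint \<Rightarrow> _) \<in> borel_measurable borel"
    by (intro borel_measurable_continuous_onI continuous_intros)+
  show ?thesis unfolding rho_def[abs_def] by measurable
qed

lemma borel_measurable_rpow [measurable (raw)]:
  assumes "f \<in> borel_measurable M"
  shows "(\<lambda>x. rpow (f x) a) \<in> borel_measurable M"
  using assms by (cases "a = 0") (auto simp: rpow_def)

lemma norm_fst_le_rho:
  assumes "0 \<le> \<gamma>"
  shows "norm (fst z) \<le> rho \<gamma> z"
proof -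
  have "norm (fst z) powr (2 * (1 + \<gamma>)) \<le> rho \<gamma> z powr (2 * (1 + \<gamma>))"
    unfolding rho_powr[OF assms] by simp
  moreover have "0 < 2 * (1 + \<gamma>)" using assms by simp
  ultimately show ?thesis
    using powr_less_mono2[OF _ rho_nonneg, of "2 * (1 + \<gamma>)" \<gamma> z "norm (fst z)"] by (meson not_less)
qed

lemma norm_snd_le_rho:
  assumes "0 \<le> \<gamma>"
  shows "norm (snd z) \<le> rho \<gamma> z powr (1 + \<gamma>)"
proof -
  have "(norm (snd z))\<^sup>2 \<le> (1 + \<gamma>)\<^sup>2 * (norm (snd z))\<^sup>2"
    using assms mult_right_mono[OF one_le_power[of "1 + \<gamma>" 2], of "(norm (snd z))\<^sup>2"] by simp
  also have "\<dots> \<le> rho \<gamma> z powr (2 * (1 + \<gamma>))" unfolding rho_powr[OF assms] by simp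
  also have "\<dots> = (rho \<gamma> z powr (1 + \<gamma>))\<^sup>2"
    by (simp add: power2_eq_square powr_add[symmetric] algebra_simps)
  finally show ?thesis by (rule power2_le_imp_le) simp
qed

lemma norm_le_rho:
  assumes "0 \<le> \<gamma>" "rho \<gamma> z \<le> R"
  shows "norm z \<le> R + R powr (1 + \<gamma>)"
proof -
  have "norm (fst z) \<le> R" using norm_fst_le_rho[OF assms(1)] assms(2) by (rule order_trans)
  moreover have "rho \<gamma> z powr (1 + \<gamma>) \<le> R powr (1 + \<gamma>)" using assms rho_nonneg[of \<gamma> z] by (intro powr_mono2) auto
  ultimately show ?thesis
    using norm_snd_le_rho[OF assms(1), of z] sqrt_sum_squares_le_sum[of "norm (fst z)" "norm (snd z)"] by (simp add: norm_prod_def)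
qed

lemma norm_powr_double:
  fixes x :: "'a::real_inner"
  shows "norm x powr (2 * s) = (x \<bullet> x) powr s"
  by (simp add: norm_eq_sqrt_inner powr_half_sqrt[symmetric] powr_powr)

lemma has_derivative_rho:
  fixes z :: "('m::finite, 'k::finite) gpoint"
  assumes \<gamma>: "0 \<le> \<gamma>" and x: "fst z \<noteq> 0"
  shows "(rho \<gamma> has_derivative (\<lambda>v. rho_grad \<gamma> z \<bullet> v)) (at z)"
proof -
  define N where "N z = (fst z \<bullet> fst z) powr (1 + \<gamma>) + (1 + \<gamma>)\<^sup>2 * (snd z \<bullet> snd z)" for z :: "('m, 'k) gpoint"
  have rho: "rho \<gamma> w = N w powr (1 / (2 * (1 + \<gamma>)))" for w :: "('m, 'k) gpoint"
    unfolding rho_def N_def norm_powr_double power2_norm_eq_inner ..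
  have pos: "0 < fst z \<bullet> fst z" using x by simp
  then have N: "0 < N z" unfolding N_def by (intro add_pos_nonneg) auto
  have d1: "((\<lambda>z. (fst z \<bullet> fst z) powr (1 + \<gamma>)) has_derivative
     (\<lambda>v. 2 * (fst z \<bullet> fst v) * ((1 + \<gamma>) * (fst z \<bullet> fst z) powr \<gamma>))) (at z)"
    by (rule has_derivative_eq_rhs, rule DERIV_compose_FDERIV[where f="\<lambda>x. x powr (1 + \<gamma>)"])
       (use pos in \<open>auto intro!: derivative_eq_intros simp: inner_commute\<close>)
  have d2: "(N has_derivative (\<lambda>v. 2 * (fst z \<bullet> fst v) * ((1 + \<gamma>) * (fst z \<bullet> fst z) powr \<gamma>)
       + (1 + \<gamma>)\<^sup>2 * (2 * (snd z \<bullet> snd v)))) (at z)"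
    unfolding N_def[abs_def]
    by (rule has_derivative_eq_rhs, rule has_derivative_add[OF d1])
       (auto intro!: derivative_eq_intros simp: inner_commute)
  have "((\<lambda>z. N z powr (1 / (2 * (1 + \<gamma>)))) has_derivative
     (\<lambda>v. (2 * (fst z \<bullet> fst v) * ((1 + \<gamma>) * (fst z \<bullet> fst z) powr \<gamma>) + (1 + \<gamma>)\<^sup>2 * (2 * (snd z \<bullet> snd v))) *
        (1 / (2 * (1 + \<gamma>)) * N z powr (1 / (2 * (1 + \<gamma>)) - 1)))) (at z)"
    by (rule DERIV_compose_FDERIV[OF has_real_derivative_powr[OF N] d2])
  moreover have "(\<lambda>z. N z powr (1 / (2 * (1 + \<gamma>)))) = rho \<gamma>" using rho by auto
  moreover have "(2 * (fst z \<bullet> fst v) * ((1 + \<gamma>) * (fst z \<bullet> fst z) powr \<gamma>) + (1 + \<gamma>)\<^sup>2 * (2 * (snd z \<bullet> snd v))) *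
        (1 / (2 * (1 + \<gamma>)) * N z powr (1 / (2 * (1 + \<gamma>)) - 1)) = rho_grad \<gamma> z \<bullet> v" for v
  proof -
    have "1 / (2 * (1 + \<gamma>)) - 1 = 1 / (2 * (1 + \<gamma>)) * (- 1 - 2 * \<gamma>)" using \<gamma> by (simp add: field_simps)
    then have e1: "N z powr (1 / (2 * (1 + \<gamma>)) - 1) = rho \<gamma> z powr (- 1 - 2 * \<gamma>)"
      unfolding rho powr_powr by simp
    have e2: "(fst z \<bullet> fst z) powr \<gamma> = norm (fst z) powr (2 * \<gamma>)"
      by (rule norm_powr_double[symmetric])
    have "(2 * a * ((1 + \<gamma>) * b) + (1 + \<gamma>)\<^sup>2 * (2 * d)) * (1 / (2 * (1 + \<gamma>)) * n) = n * (b * a + (1 + \<gamma>) * d)" for a b d n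
      using \<gamma> by (simp add: field_simps power2_eq_square)
    from this[of "fst z \<bullet> fst v" "(fst z \<bullet> fst z) powr \<gamma>" "snd z \<bullet> snd v" "N z powr (1 / (2 * (1 + \<gamma>)) - 1)"]
    show ?thesis unfolding e1 e2 by (simp add: rho_grad_def inner_prod_def distrib_left mult.assoc)
  qed
  ultimately show ?thesis by simp
qed

text \<open>This is the identity \<open>|\<nabla>\<^sub>\<gamma> \<rho>| = (|x| / \<rho>)\<^sup>\<gamma>\<close>, which makes the potential equal to
  \<open>|\<nabla>\<^sub>\<gamma> \<rho>|\<^sup>p / (R - \<rho>)\<^sup>p\<close> and reduces the choice of test functions to one variable.\<close>
lemma norm_weighted_rho_grad:
  assumes \<gamma>: "0 \<le> \<gamma>" and x: "fst z \<noteq> 0"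
  shows "norm (weighted \<gamma> z (rho_grad \<gamma> z)) = norm (fst z) powr \<gamma> * rho \<gamma> z powr (- \<gamma>)"
proof -
  let ?x = "norm (fst z)" and ?y = "norm (snd z)" and ?r = "rho \<gamma> z"
  have xp: "0 < ?x" using x by simp
  then have rp: "0 < ?r" using norm_fst_le_rho[OF \<gamma>, of z] by linarith
  have w: "weighted \<gamma> z (rho_grad \<gamma> z) =
      ((?r powr (- 1 - 2 * \<gamma>) * ?x powr (2 * \<gamma>)) *\<^sub>R fst z, (?x powr \<gamma> * (?r powr (- 1 - 2 * \<gamma>) * (1 + \<gamma>))) *\<^sub>R snd z)"
    using xp by (simp add: weighted_def rho_grad_def rpow_def)
  have "(norm (weighted \<gamma> z (rho_grad \<gamma> z)))\<^sup>2 = (?r powr (- 1 - 2 * \<gamma>))\<^sup>2 *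
     ((?x powr (2 * \<gamma>))\<^sup>2 * ?x\<^sup>2 + (?x powr \<gamma>)\<^sup>2 * ((1 + \<gamma>)\<^sup>2 * ?y\<^sup>2))"
    unfolding w norm_Pair norm_scaleR by (simp add: power_mult_distrib distrib_left mult_ac)
  also have "(?x powr (2 * \<gamma>))\<^sup>2 * ?x\<^sup>2 = (?x powr \<gamma>)\<^sup>2 * ?x powr (2 * (1 + \<gamma>))"
    using xp by (simp add: powr_numeral[symmetric] powr_powr powr_add[symmetric] algebra_simps del: powr_numeral)
  also have "(?r powr (- 1 - 2 * \<gamma>))\<^sup>2 * ((?x powr \<gamma>)\<^sup>2 * ?x powr (2 * (1 + \<gamma>)) + (?x powr \<gamma>)\<^sup>2 * ((1 + \<gamma>)\<^sup>2 * ?y\<^sup>2))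
     = (?r powr (- 1 - 2 * \<gamma>))\<^sup>2 * (?x powr \<gamma>)\<^sup>2 * ?r powr (2 * (1 + \<gamma>))"
    unfolding rho_powr[OF \<gamma>] by (simp add: algebra_simps)
  also have "?r powr (2 * (1 + \<gamma>)) = (?r powr (1 + \<gamma>))\<^sup>2"
    by (simp add: power2_eq_square powr_add[symmetric] algebra_simps)
  also have "(?r powr (- 1 - 2 * \<gamma>))\<^sup>2 * (?x powr \<gamma>)\<^sup>2 * (?r powr (1 + \<gamma>))\<^sup>2 =
      (?x powr \<gamma> * (?r powr (- 1 - 2 * \<gamma>) * ?r powr (1 + \<gamma>)))\<^sup>2"
    by (simp add: power_mult_distrib)
  also have "?r powr (- 1 - 2 * \<gamma>) * ?r powr (1 + \<gamma>) = ?r powr (- \<gamma>)"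
    by (simp add: powr_add[symmetric])
  finally show ?thesis by (simp add: power2_eq_iff_nonneg)
qed

definition dilation :: "real \<Rightarrow> real \<Rightarrow> ('m::finite, 'k::finite) gpoint \<Rightarrow> ('m, 'k) gpoint" where
  "dilation \<gamma> l z = (l *\<^sub>R fst z, l powr (1 + \<gamma>) *\<^sub>R snd z)"

lemma rho_dilation:
  assumes "0 \<le> \<gamma>" "0 < l"
  shows "rho \<gamma> (dilation \<gamma> l z) = l * rho \<gamma> z"
proof -
  have l2: "(l powr (1 + \<gamma>))\<^sup>2 = l powr (2 * (1 + \<gamma>))"
    by (simp add: power2_eq_square powr_add[symmetric] algebra_simps)
  have "rho \<gamma> (dilation \<gamma> l z) powr (2 * (1 + \<gamma>)) =
      (l * norm (fst z)) powr (2 * (1 + \<gamma>)) + (1 + \<gamma>)\<^sup>2 * (l powr (1 + \<gamma>) * norm (snd z))\<^sup>2"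
    unfolding rho_powr[OF assms(1)] using assms(2) by (simp add: dilation_def)
  also have "\<dots> = l powr (2 * (1 + \<gamma>)) * rho \<gamma> z powr (2 * (1 + \<gamma>))"
    unfolding rho_powr[OF assms(1)] power_mult_distrib l2 using assms(2) by (simp add: powr_mult distrib_left)
  also have "\<dots> = (l * rho \<gamma> z) powr (2 * (1 + \<gamma>))"
    using assms(2) rho_nonneg[of \<gamma> z] by (simp add: powr_mult)
  finally have "rho \<gamma> (dilation \<gamma> l z) powr (2 * (1 + \<gamma>)) = (l * rho \<gamma> z) powr (2 * (1 + \<gamma>))" .
  then have "(rho \<gamma> (dilation \<gamma> l z) powr (2 * (1 + \<gamma>))) powr (1 / (2 * (1 + \<gamma>)))
     = ((l * rho \<gamma> z) powr (2 * (1 + \<gamma>))) powr (1 / (2 * (1 + \<gamma>)))" by simp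
  then show ?thesis using assms rho_nonneg[of \<gamma> z] rho_nonneg[of \<gamma> "dilation \<gamma> l z"] by (simp add: powr_powr)
qed

text \<open>The exponent by which Lebesgue measure scales under dilations; this is the homogeneous dimension,
  written as a sum over the standard basis.\<close>
definition dilation_dim :: "('m::finite, 'k::finite) gpoint itself \<Rightarrow> real \<Rightarrow> real" where
  "dilation_dim _ \<gamma> = (\<Sum>j\<in>(Basis :: ('m, 'k) gpoint set). if snd j = 0 then 1 else 1 + \<gamma>)"

lemma dilation_dim_ge_1:
  assumes "0 \<le> \<gamma>"
  shows "1 \<le> dilation_dim TYPE(('m::finite, 'k::finite) gpoint) \<gamma>"
proof -
  have "1 \<le> real (card (Basis :: ('m, 'k) gpoint set))"
    using DIM_positive[where 'a="('m, 'k) gpoint"] by linarith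
  also have "\<dots> = (\<Sum>j\<in>(Basis :: ('m, 'k) gpoint set). 1)" by simp
  also have "\<dots> \<le> dilation_dim TYPE(('m, 'k) gpoint) \<gamma>"
    unfolding dilation_dim_def using assms by (intro sum_mono) auto
  finally show ?thesis .
qed

lemma emeasure_dilation:
  fixes A :: "('m::finite, 'k::finite) gpoint set"
  assumes A: "A \<in> sets borel" and l: "0 < l"
  shows "emeasure lborel A = ennreal (l powr dilation_dim TYPE(('m, 'k) gpoint) \<gamma>) * emeasure lborel (dilation \<gamma> l -` A)"
proof -
  let ?c = "\<lambda>j::('m, 'k) gpoint. l powr (if snd j = 0 then 1 else 1 + \<gamma>)"
  have T: "(\<lambda>x. 0 + (\<Sum>j\<in>Basis. (?c j * (x \<bullet> j)) *\<^sub>R j)) = (dilation \<gamma> l :: ('m, 'k) gpoint \<Rightarrow> _)"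
  proof
    fix x :: "('m, 'k) gpoint"
    show "0 + (\<Sum>j\<in>Basis. (?c j * (x \<bullet> j)) *\<^sub>R j) = dilation \<gamma> l x"
    proof (rule euclidean_eqI)
      fix b :: "('m, 'k) gpoint" assume b: "b \<in> Basis"
      have "(0 + (\<Sum>j\<in>Basis. (?c j * (x \<bullet> j)) *\<^sub>R j)) \<bullet> b = ?c b * (x \<bullet> b)"
        using b by (simp add: inner_sum_left inner_Basis if_distrib[of "\<lambda>y. _ * y"] sum.delta cong: if_cong)
      also have "\<dots> = dilation \<gamma> l x \<bullet> b"
        using b l by (auto simp: Basis_prod_def dilation_def inner_prod_def)
      finally show "(0 + (\<Sum>j\<in>Basis. (?c j * (x \<bullet> j)) *\<^sub>R j)) \<bullet> b = dilation \<gamma> l x \<bullet> b" .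
    qed
  qed
  have prod: "(\<Prod>j\<in>(Basis :: ('m, 'k) gpoint set). \<bar>?c j\<bar>) = l powr dilation_dim TYPE(('m, 'k) gpoint) \<gamma>"
    using l by (simp add: dilation_dim_def powr_sum)
  have [measurable]: "(dilation \<gamma> l :: ('m, 'k) gpoint \<Rightarrow> _) \<in> borel_measurable borel"
    unfolding dilation_def[abs_def] by (intro borel_measurable_continuous_onI continuous_intros)
  have "(lborel :: ('m, 'k) gpoint measure) = density (distr lborel borel (dilation \<gamma> l)) (\<lambda>_. l powr dilation_dim TYPE(('m, 'k) gpoint) \<gamma>)"
    using lborel_affine_euclidean[of ?c 0] l unfolding T prod by simp
  then have "emeasure lborel A = emeasure (density (distr lborel borel (dilation \<gamma> l)) (\<lambda>_. l powr dilation_dim TYPE(('m, 'k) gpoint) \<gamma>)) A"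
    by simp
  also have "\<dots> = ennreal (l powr dilation_dim TYPE(('m, 'k) gpoint) \<gamma>) * emeasure lborel (dilation \<gamma> l -` A)"
    using A by (simp add: emeasure_density nn_integral_cmult_indicator emeasure_distr)
  finally show ?thesis .
qed

lemma powr_diff_bounds:
  fixes a b d :: real
  assumes "0 < a" "a \<le> b" "1 \<le> d"
  shows "d * a powr (d - 1) * (b - a) \<le> b powr d - a powr d" "b powr d - a powr d \<le> d * b powr (d - 1) * (b - a)"
proof -
  have "\<exists>x. a \<le> x \<and> x \<le> b \<and> b powr d - a powr d = (b - a) * (d * x powr (d - 1))"
  proof (cases "a = b")
    case False
    then have "a < b" using assms by simp
    then obtain x where "a < x" "x < b" "b powr d - a powr d = (b - a) * (d * x powr (d - 1))"
      using MVT2[of a b "\<lambda>x. x powr d" "\<lambda>x. d * x powr (d - 1)"] assms has_real_derivative_powr by fastforce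
    then show ?thesis by (intro exI[of _ x]) auto
  qed auto
  then obtain x where x: "a \<le> x" "x \<le> b" "b powr d - a powr d = (b - a) * (d * x powr (d - 1))" by blast
  have "a powr (d - 1) \<le> x powr (d - 1)" "x powr (d - 1) \<le> b powr (d - 1)"
    using x assms by (auto intro!: powr_mono2)
  then show "d * a powr (d - 1) * (b - a) \<le> b powr d - a powr d" "b powr d - a powr d \<le> d * b powr (d - 1) * (b - a)"
    using x assms by (auto simp: mult_ac intro!: mult_left_mono)
qed

text \<open>In a dilation invariant cone the volume below level \<open>r\<close> is \<open>r\<^sup>d\<close> times the volume below level \<open>1\<close>. This estimates
  integrals of functions of the gauge.\<close>
lemma measure_rho_shell:
  fixes S :: "('m::finite, 'k::finite) gpoint set"
  assumes \<gamma>: "0 \<le> \<gamma>" and S [measurable]: "S \<in> sets borel"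
    and inv: "\<And>l z. 0 < l \<Longrightarrow> dilation \<gamma> l z \<in> S \<longleftrightarrow> z \<in> S"
    and ab: "0 < a" "a \<le> b"
  defines "d \<equiv> dilation_dim TYPE(('m, 'k) gpoint) \<gamma>"
  shows "measure lborel {z\<in>S. a \<le> rho \<gamma> z \<and> rho \<gamma> z < b} =
      (b powr d - a powr d) * measure lborel {z\<in>S. rho \<gamma> z < 1}"
proof -
  have fin: "emeasure lborel {z\<in>S. rho \<gamma> z < r} < \<infinity>" for r
  proof (rule emeasure_bounded_finite, rule bounded_subset[OF bounded_cball[of 0 "r + r powr (1 + \<gamma>)"]], rule subsetI)
    fix z assume "z \<in> {z\<in>S. rho \<gamma> z < r}"
    then show "z \<in> cball 0 (r + r powr (1 + \<gamma>))" using norm_le_rho[OF \<gamma>, of z r] by (simp add: dist_norm)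
  qed
  have m: "measure lborel {z\<in>S. rho \<gamma> z < r} = r powr d * measure lborel {z\<in>S. rho \<gamma> z < 1}" if "0 < r" for r
  proof -
    have "dilation \<gamma> r -` {z\<in>S. rho \<gamma> z < r} = {z\<in>S. rho \<gamma> z < 1}"
      using that inv by (auto simp: rho_dilation[OF \<gamma>])
    then have "emeasure lborel {z\<in>S. rho \<gamma> z < r} = ennreal (r powr d) * emeasure lborel {z\<in>S. rho \<gamma> z < 1}"
      unfolding d_def by (subst emeasure_dilation[OF _ that, where \<gamma>=\<gamma>]) auto
    then show ?thesis by (simp add: measure_def enn2real_mult)
  qed
  have sub: "{z\<in>S. rho \<gamma> z < a} \<subseteq> {z\<in>S. rho \<gamma> z < b}" using ab(2) by (blast intro: order.strict_trans2)
  have M: "{z\<in>S. rho \<gamma> z < r} \<in> sets lborel" for r by measurable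
  have "{z\<in>S. a \<le> rho \<gamma> z \<and> rho \<gamma> z < b} = {z\<in>S. rho \<gamma> z < b} - {z\<in>S. rho \<gamma> z < a}" using ab by auto
  moreover have finb: "emeasure lborel {z\<in>S. rho \<gamma> z < b} \<noteq> \<infinity>" using fin[of b] by (rule less_imp_neq)
  ultimately have "measure lborel {z\<in>S. a \<le> rho \<gamma> z \<and> rho \<gamma> z < b} =
     measure lborel {z\<in>S. rho \<gamma> z < b} - measure lborel {z\<in>S. rho \<gamma> z < a}"
    using measure_Diff[OF finb M M sub] by (simp only:)
  then show ?thesis using ab unfolding m[OF ab(1)] m[OF order.strict_trans2[OF ab]] by (simp only: left_diff_distrib)
qed

section \<open>Test functions that violate Hardy's inequality\<close>

text \<open>For \<open>p > 1\<close> the \<open>p\<close>-th power smooths the kink of the positive part. This is why only the power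
  \<open>\<phi>\<^sup>p\<close> of the test function, and not \<open>\<phi>\<close>, has to be differentiable.\<close>
lemma DERIV_max_powr:
  fixes p :: real
  assumes p: "1 < p"
  shows "((\<lambda>t. max 0 t powr p) has_real_derivative p * max 0 t powr (p - 1)) (at t)"
proof (cases t "0 :: real" rule: linorder_cases)
  case less
  have "((\<lambda>_. 0) has_real_derivative 0) (at t)" by simp
  then have "((\<lambda>t. max 0 t powr p) has_real_derivative 0) (at t)"
    by (rule has_field_derivative_transform_within_open[where S="{..<0}"])
       (use less in \<open>auto simp: max_def\<close>)
  then show ?thesis using less by (simp add: max_def)
next
  case equal
  have "((\<lambda>h. (max 0 (0 + h) powr p - max 0 0 powr p) / h) \<longlongrightarrow> 0) (at 0)"
  proof (rule Lim_null_comparison)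
    have "((\<lambda>h. \<bar>h\<bar> powr (p - 1)) \<longlongrightarrow> \<bar>0\<bar> powr (p - 1)) (at 0)"
      using p by (intro tendsto_powr' tendsto_intros) auto
    then show "((\<lambda>h. \<bar>h\<bar> powr (p - 1)) \<longlongrightarrow> 0) (at 0)" by simp
    show "\<forall>\<^sub>F h in at 0. norm ((max 0 (0 + h) powr p - max 0 0 powr p) / h) \<le> \<bar>h\<bar> powr (p - 1)"
      unfolding eventually_at_filter
      by (rule always_eventually) (auto simp: max_def powr_diff divide_le_0_iff)
  qed
  then show ?thesis using equal by (simp add: DERIV_def)
next
  case greater
  have "((\<lambda>t. t powr p) has_real_derivative p * t powr (p - 1)) (at t)"
    using greater by (rule has_real_derivative_powr)
  then have "((\<lambda>t. max 0 t powr p) has_real_derivative p * t powr (p - 1)) (at t)"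
    by (rule has_field_derivative_transform_within_open[where S="{0<..}"])
       (use greater in \<open>auto simp: max_def\<close>)
  then show ?thesis using greater by (simp add: max_def)
qed

definition axis_cutoff :: "real \<Rightarrow> ('m::finite, 'k::finite) gpoint \<Rightarrow> real" where
  "axis_cutoff \<kappa> z = max 0 ((norm (fst z))\<^sup>2 - \<kappa>\<^sup>2)"

text \<open>The function \<open>(s\<^sup>a - \<epsilon>\<^sup>a)\<^sub>+\<close> of the distance \<open>s = R - \<rho>\<close>, with the critical exponent
  \<open>a = (p - 1) / p\<close> for which \<open>s\<^sup>a\<close> barely fails to have finite energy.\<close>
definition hardy_profile :: "real \<Rightarrow> real \<Rightarrow> real \<Rightarrow> real \<Rightarrow> ('m::finite, 'k::finite) gpoint \<Rightarrow> real" where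
  "hardy_profile \<gamma> p R \<epsilon> z =
     (if rho \<gamma> z < R - \<epsilon> then (R - rho \<gamma> z) powr ((p - 1) / p) - \<epsilon> powr ((p - 1) / p) else 0)"

definition hardy_test :: "real \<Rightarrow> real \<Rightarrow> real \<Rightarrow> real \<Rightarrow> real \<Rightarrow> ('m::finite, 'k::finite) gpoint \<Rightarrow> real" where
  "hardy_test \<gamma> p R \<kappa> \<epsilon> z = axis_cutoff \<kappa> z * hardy_profile \<gamma> p R \<epsilon> z"

text \<open>The Euclidean gradient of \<open>hardy_test\<close> where that function is positive.\<close>
definition hardy_test_grad ::
  "real \<Rightarrow> real \<Rightarrow> real \<Rightarrow> real \<Rightarrow> real \<Rightarrow> ('m::finite, 'k::finite) gpoint \<Rightarrow> ('m, 'k) gpoint" where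
  "hardy_test_grad \<gamma> p R \<kappa> \<epsilon> z = (2 * hardy_profile \<gamma> p R \<epsilon> z) *\<^sub>R (fst z, 0)
     - (axis_cutoff \<kappa> z * ((p - 1) / p * (R - rho \<gamma> z) powr (- 1 / p))) *\<^sub>R rho_grad \<gamma> z"

lemma axis_cutoff_nonneg: "0 \<le> axis_cutoff \<kappa> z"
  by (simp add: axis_cutoff_def)

lemma hardy_profile_nonneg:
  assumes "1 < p" "0 < \<epsilon>"
  shows "0 \<le> hardy_profile \<gamma> p R \<epsilon> z"
  using assms by (auto simp: hardy_profile_def intro!: powr_mono2)

lemma hardy_test_pos_iff:
  assumes "1 < p" "0 < \<epsilon>" "0 < \<kappa>"
  shows "0 < hardy_test \<gamma> p R \<kappa> \<epsilon> z \<longleftrightarrow> \<kappa> < norm (fst z) \<and> rho \<gamma> z < R - \<epsilon>"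
    and "hardy_test \<gamma> p R \<kappa> \<epsilon> z = 0 \<longleftrightarrow> norm (fst z) \<le> \<kappa> \<or> R - \<epsilon> \<le> rho \<gamma> z"
proof -
  have 1: "0 < axis_cutoff \<kappa> z \<longleftrightarrow> \<kappa> < norm (fst z)"
    using assms by (auto simp: axis_cutoff_def max_def intro: power_strict_mono dest: power_less_imp_less_base)
  have 2: "0 < hardy_profile \<gamma> p R \<epsilon> z \<longleftrightarrow> rho \<gamma> z < R - \<epsilon>"
    using assms by (auto simp: hardy_profile_def intro!: powr_less_mono2)
  show "0 < hardy_test \<gamma> p R \<kappa> \<epsilon> z \<longleftrightarrow> \<kappa> < norm (fst z) \<and> rho \<gamma> z < R - \<epsilon>"
    using 1 2 axis_cutoff_nonneg[of \<kappa> z] hardy_profile_nonneg[OF assms(1,2), of \<gamma> R z]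
    by (auto simp: hardy_test_def zero_less_mult_iff)
  then show "hardy_test \<gamma> p R \<kappa> \<epsilon> z = 0 \<longleftrightarrow> norm (fst z) \<le> \<kappa> \<or> R - \<epsilon> \<le> rho \<gamma> z"
    using axis_cutoff_nonneg[of \<kappa> z] hardy_profile_nonneg[OF assms(1,2), of \<gamma> R z]
    by (metis hardy_test_def less_eq_real_def linorder_not_less mult_nonneg_nonneg)
qed

lemma hardy_test_nonneg:
  assumes "1 < p" "0 < \<epsilon>"
  shows "0 \<le> hardy_test \<gamma> p R \<kappa> \<epsilon> z"
  unfolding hardy_test_def by (intro mult_nonneg_nonneg axis_cutoff_nonneg hardy_profile_nonneg assms)

text \<open>Near the set \<open>x = 0\<close>, where the gauge is not differentiable, and near the boundary of the ball the function
  is locally zero; on the remaining set both positive parts are composed with smooth functions.\<close>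
lemma has_derivative_hardy_test_powr:
  fixes z :: "('m::finite, 'k::finite) gpoint"
  assumes \<gamma>: "0 \<le> \<gamma>" and p: "1 < p" and \<epsilon>: "0 < \<epsilon>" and \<kappa>: "0 < \<kappa>"
  shows "((\<lambda>z. hardy_test \<gamma> p R \<kappa> \<epsilon> z powr p) has_derivative
     (\<lambda>v. ((p * hardy_test \<gamma> p R \<kappa> \<epsilon> z powr (p - 1)) *\<^sub>R hardy_test_grad \<gamma> p R \<kappa> \<epsilon> z) \<bullet> v)) (at z)"
proof -
  have 0: "hardy_test \<gamma> p R \<kappa> \<epsilon> w = 0" if "norm (fst w) < \<kappa> \<or> R - \<epsilon> < rho \<gamma> w" for w :: "('m, 'k) gpoint"
    using hardy_test_pos_iff(2)[OF p \<epsilon> \<kappa>, of \<gamma> R w] that by linarith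
  consider "norm (fst z) < \<kappa>" | "R - \<epsilon> < rho \<gamma> z" | "\<kappa> \<le> norm (fst z)" "rho \<gamma> z \<le> R - \<epsilon>" by linarith
  then show ?thesis
  proof cases
    case 1
    have "open {z::('m, 'k) gpoint. norm (fst z) < \<kappa>}" by (intro open_Collect_less continuous_intros)
    then have "((\<lambda>z. hardy_test \<gamma> p R \<kappa> \<epsilon> z powr p) has_derivative (\<lambda>_. 0)) (at z)"
      by (rule has_derivative_transform_within_open[OF has_derivative_const])
         (simp_all add: 1 0)
    moreover have "hardy_test \<gamma> p R \<kappa> \<epsilon> z = 0" using 1 by (intro 0) simp
    ultimately show ?thesis by simp
  next
    case 2
    have "open {z::('m, 'k) gpoint. R - \<epsilon> < rho \<gamma> z}" by (intro open_Collect_less continuous_intros continuous_on_rho \<gamma>)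
    then have "((\<lambda>z. hardy_test \<gamma> p R \<kappa> \<epsilon> z powr p) has_derivative (\<lambda>_. 0)) (at z)"
      by (rule has_derivative_transform_within_open[OF has_derivative_const])
         (simp_all add: 2 0)
    moreover have "hardy_test \<gamma> p R \<kappa> \<epsilon> z = 0" using 2 by (intro 0) simp
    ultimately show ?thesis by simp
  next
    case 3
    then have x: "fst z \<noteq> 0" and s: "0 < R - rho \<gamma> z" using \<kappa> \<epsilon> by auto
    let ?a = "(p - 1) / p"
    define U where "U z = (norm (fst z))\<^sup>2 - \<kappa>\<^sup>2" for z :: "('m, 'k) gpoint"
    define S where "S z = (R - rho \<gamma> z) powr ?a - \<epsilon> powr ?a" for z :: "('m, 'k) gpoint"
    have a: "0 < ?a" "?a - 1 = - 1 / p" using p by (auto simp: field_simps)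
    have prof: "hardy_profile \<gamma> p R \<epsilon> w = max 0 (S w)" if "rho \<gamma> w < R" for w
      using that \<epsilon> a(1) by (auto simp: hardy_profile_def S_def max_def intro!: powr_less_mono2 powr_mono2)
        (smt (verit) powr_less_mono2 powr_mono2)+
    have dU: "(U has_derivative (\<lambda>v. 2 * (fst z \<bullet> fst v))) (at z)"
      unfolding U_def[abs_def] power2_norm_eq_inner
      by (auto intro!: derivative_eq_intros simp: inner_commute)
    have d0: "((\<lambda>z. R - rho \<gamma> z) has_derivative (\<lambda>v. - (rho_grad \<gamma> z \<bullet> v))) (at z)"
      by (rule has_derivative_eq_rhs, rule has_derivative_diff[OF has_derivative_const has_derivative_rho[OF \<gamma> x]]) simp
    have d1: "((\<lambda>z. (R - rho \<gamma> z) powr ?a) has_derivative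
        (\<lambda>v. - (rho_grad \<gamma> z \<bullet> v) * (?a * (R - rho \<gamma> z) powr (?a - 1)))) (at z)"
      by (rule DERIV_compose_FDERIV[where f="\<lambda>x. x powr ?a" and g="\<lambda>z. R - rho \<gamma> z",
            OF has_real_derivative_powr[OF s] d0])
    have dS: "(S has_derivative (\<lambda>v. - (rho_grad \<gamma> z \<bullet> v) * (?a * (R - rho \<gamma> z) powr (?a - 1)))) (at z)"
      unfolding S_def[abs_def]
      by (rule has_derivative_eq_rhs, rule has_derivative_diff[OF d1 has_derivative_const]) simp
    have "((\<lambda>z. max 0 (U z) powr p * max 0 (S z) powr p) has_derivative
      (\<lambda>v. ((p * hardy_test \<gamma> p R \<kappa> \<epsilon> z powr (p - 1)) *\<^sub>R hardy_test_grad \<gamma> p R \<kappa> \<epsilon> z) \<bullet> v)) (at z)"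
    proof (rule has_derivative_eq_rhs, rule has_derivative_mult[OF
          DERIV_compose_FDERIV[where f="\<lambda>t. max 0 t powr p", OF DERIV_max_powr[OF p] dU]
          DERIV_compose_FDERIV[where f="\<lambda>t. max 0 t powr p", OF DERIV_max_powr[OF p] dS]], rule ext)
      fix v
      have e: "m powr p = m powr (p - 1) * m" if "0 \<le> m" for m :: real
        using that p by (cases "m = 0") (auto simp: powr_diff)
      have g: "hardy_test_grad \<gamma> p R \<kappa> \<epsilon> z \<bullet> v = 2 * max 0 (S z) * (fst z \<bullet> fst v)
          - max 0 (U z) * (?a * (R - rho \<gamma> z) powr (?a - 1)) * (rho_grad \<gamma> z \<bullet> v)"
      proof -
        have "(fst z, 0) \<bullet> v = fst z \<bullet> fst v" by (simp add: inner_prod_def)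
        moreover have "hardy_profile \<gamma> p R \<epsilon> z = max 0 (S z)" using s by (intro prof) simp
        ultimately show ?thesis
          unfolding hardy_test_grad_def a(2) inner_diff_left inner_scaleR_left axis_cutoff_def U_def by (simp only:)
      qed
      have t: "hardy_test \<gamma> p R \<kappa> \<epsilon> z powr (p - 1) = max 0 (U z) powr (p - 1) * max 0 (S z) powr (p - 1)"
        using s by (simp add: hardy_test_def prof axis_cutoff_def U_def powr_mult)
      have alg: "(m1 * u) * (- w * A * (p * m2)) + 2 * x * (p * m1) * (m2 * s') = p * (m1 * m2) * (2 * s' * x - u * A * w)"
        for m1 m2 u s' A w x :: real by (simp add: algebra_simps)
      show "max 0 (U z) powr p * (- (rho_grad \<gamma> z \<bullet> v) * (?a * (R - rho \<gamma> z) powr (?a - 1)) * (p * max 0 (S z) powr (p - 1))) +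
        2 * (fst z \<bullet> fst v) * (p * max 0 (U z) powr (p - 1)) * max 0 (S z) powr p =
        (p * hardy_test \<gamma> p R \<kappa> \<epsilon> z powr (p - 1)) *\<^sub>R hardy_test_grad \<gamma> p R \<kappa> \<epsilon> z \<bullet> v"
        unfolding inner_scaleR_left g t e[of "max 0 (U z)", simplified] e[of "max 0 (S z)", simplified] by (rule alg)
    qed
    moreover have "open {z::('m, 'k) gpoint. rho \<gamma> z < R}" by (intro open_Collect_less continuous_intros continuous_on_rho \<gamma>)
    ultimately show ?thesis
      by (rule has_derivative_transform_within_open)
         (use s in \<open>auto simp: hardy_test_def prof axis_cutoff_def U_def powr_mult\<close>)
  qed
qed

lemma compact_hardy_support:
  fixes \<gamma> :: real
  assumes \<gamma>: "0 \<le> \<gamma>"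
  shows "compact {z::('m::finite, 'k::finite) gpoint. \<kappa> \<le> norm (fst z) \<and> rho \<gamma> z \<le> R}"
proof -
  have "closed {z::('m, 'k) gpoint. \<kappa> \<le> norm (fst z) \<and> rho \<gamma> z \<le> R}"
    by (intro closed_Collect_conj closed_Collect_le continuous_intros continuous_on_rho \<gamma>)
  moreover have "{z::('m, 'k) gpoint. \<kappa> \<le> norm (fst z) \<and> rho \<gamma> z \<le> R} \<subseteq> cball 0 (R + R powr (1 + \<gamma>))"
  proof (rule subsetI)
    fix z :: "('m, 'k) gpoint" assume "z \<in> {z. \<kappa> \<le> norm (fst z) \<and> rho \<gamma> z \<le> R}"
    then show "z \<in> cball 0 (R + R powr (1 + \<gamma>))" using norm_le_rho[OF \<gamma>, of z R] by (simp add: dist_norm)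
  qed
  ultimately show ?thesis by (meson bounded_cball bounded_subset compact_eq_bounded_closed)
qed

lemma borel_measurable_hardy [measurable]:
  "(axis_cutoff \<kappa> :: ('m::finite, 'k::finite) gpoint \<Rightarrow> real) \<in> borel_measurable borel"
  "(hardy_profile \<gamma> p R \<epsilon> :: ('m, 'k) gpoint \<Rightarrow> real) \<in> borel_measurable borel"
  "(hardy_test \<gamma> p R \<kappa> \<epsilon> :: ('m, 'k) gpoint \<Rightarrow> real) \<in> borel_measurable borel"
  "(hardy_test_grad \<gamma> p R \<kappa> \<epsilon> :: ('m, 'k) gpoint \<Rightarrow> _) \<in> borel_measurable borel"
proof -
  have [measurable]: "(fst :: ('m, 'k) gpoint \<Rightarrow> _) \<in> borel_measurable borel" "(snd :: ('m, 'k) gpoint \<Rightarrow> _) \<in> borel_measurable borel"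
    by (intro borel_measurable_continuous_onI continuous_intros)+
  show [measurable]: "(axis_cutoff \<kappa> :: ('m::finite, 'k::finite) gpoint \<Rightarrow> real) \<in> borel_measurable borel"
    unfolding axis_cutoff_def[abs_def] by measurable
  show [measurable]: "(hardy_profile \<gamma> p R \<epsilon> :: ('m, 'k) gpoint \<Rightarrow> real) \<in> borel_measurable borel"
    unfolding hardy_profile_def[abs_def] by measurable
  show "(hardy_test \<gamma> p R \<kappa> \<epsilon> :: ('m, 'k) gpoint \<Rightarrow> real) \<in> borel_measurable borel"
    unfolding hardy_test_def[abs_def] by measurable
  have [measurable]: "(rho_grad \<gamma> :: ('m, 'k) gpoint \<Rightarrow> _) \<in> borel_measurable borel"
    unfolding rho_grad_def[abs_def] by (intro borel_measurable_scaleR borel_measurable_Pair) measurable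
  show "(hardy_test_grad \<gamma> p R \<kappa> \<epsilon> :: ('m, 'k) gpoint \<Rightarrow> _) \<in> borel_measurable borel"
    unfolding hardy_test_grad_def[abs_def]
    by (intro borel_measurable_diff borel_measurable_scaleR borel_measurable_Pair) measurable
qed

text \<open>On the compact set \<open>|x| \<ge> \<kappa>\<close>, \<open>\<rho> \<le> R - \<epsilon>\<close> all factors are continuous, and off that set
  the function vanishes.\<close>
lemma bounded_hardy_test_grad:
  fixes \<gamma> :: real
  assumes \<gamma>: "0 \<le> \<gamma>" and p: "1 < p" and \<epsilon>: "0 < \<epsilon>" and \<kappa>: "0 < \<kappa>"
  shows "bounded (range (\<lambda>z::('m::finite, 'k::finite) gpoint. (p * hardy_test \<gamma> p R \<kappa> \<epsilon> z powr (p - 1)) *\<^sub>R hardy_test_grad \<gamma> p R \<kappa> \<epsilon> z))"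
proof -
  let ?K = "{z::('m, 'k) gpoint. \<kappa> \<le> norm (fst z) \<and> rho \<gamma> z \<le> R - \<epsilon>}"
  have K: "compact ?K" by (rule compact_hardy_support[OF \<gamma>])
  let ?a = "(p - 1) / p"
  have prof: "hardy_profile \<gamma> p R \<epsilon> z = (R - rho \<gamma> z) powr ?a - \<epsilon> powr ?a" if "z \<in> ?K" for z
    using that by (auto simp: hardy_profile_def)
  have r: "continuous_on ?K (rho \<gamma>)" by (rule continuous_on_rho[OF \<gamma>])
  have s0: "R - rho \<gamma> z \<noteq> 0" if "z \<in> ?K" for z using that \<epsilon> by auto
  have "rho \<gamma> z \<noteq> 0" if "z \<in> ?K" for z using that \<kappa> norm_fst_le_rho[OF \<gamma>, of z] by auto
  moreover have "norm (fst z) \<noteq> 0" if "z \<in> ?K" for z using that \<kappa> by auto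
  ultimately have rg: "continuous_on ?K (rho_grad \<gamma>)"
    unfolding rho_grad_def[abs_def]
    by (intro continuous_on_scaleR continuous_on_Pair continuous_on_powr continuous_intros r ballI) auto
  have pr: "continuous_on ?K (hardy_profile \<gamma> p R \<epsilon>)"
    by (subst continuous_on_cong[OF refl prof]) (use s0 in \<open>auto intro!: continuous_on_powr continuous_intros r\<close>)
  have ca: "continuous_on ?K (axis_cutoff \<kappa>)"
    unfolding axis_cutoff_def[abs_def] by (intro continuous_intros continuous_on_max)
  have ct: "continuous_on ?K (hardy_test \<gamma> p R \<kappa> \<epsilon>)"
    unfolding hardy_test_def[abs_def] by (intro continuous_intros ca pr)
  have cg: "continuous_on ?K (hardy_test_grad \<gamma> p R \<kappa> \<epsilon>)"
    unfolding hardy_test_grad_def[abs_def]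
    by (intro continuous_on_diff continuous_on_scaleR continuous_on_mult continuous_on_powr continuous_on_Pair continuous_intros ca pr rg r ballI)
       (use s0 in auto)
  have nn: "0 \<le> hardy_test \<gamma> p R \<kappa> \<epsilon> z" for z :: "('m, 'k) gpoint" by (rule hardy_test_nonneg[OF p \<epsilon>])
  have c2: "continuous_on ?K (\<lambda>z. (p * hardy_test \<gamma> p R \<kappa> \<epsilon> z powr (p - 1)) *\<^sub>R hardy_test_grad \<gamma> p R \<kappa> \<epsilon> z)"
    using p nn by (intro continuous_on_scaleR continuous_on_mult continuous_on_powr' ct cg continuous_intros ballI conjI impI) auto
  have out: "hardy_test \<gamma> p R \<kappa> \<epsilon> z = 0" if "z \<notin> ?K" for z
    using that hardy_test_pos_iff(2)[OF p \<epsilon> \<kappa>, of \<gamma> R z] by auto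
  have ext: "bounded (range f)" if "continuous_on ?K f" "\<And>z. z \<notin> ?K \<Longrightarrow> f z = 0" for f :: "('m, 'k) gpoint \<Rightarrow> 'b::real_normed_vector"
  proof -
    have "bounded (f ` ?K \<union> {0})"
      using compact_imp_bounded[OF compact_continuous_image[OF that(1) K]] by simp
    moreover have "range f \<subseteq> f ` ?K \<union> {0}" using that(2) by blast
    ultimately show ?thesis by (rule bounded_subset)
  qed
  show "bounded (range (\<lambda>z::('m::finite, 'k::finite) gpoint. (p * hardy_test \<gamma> p R \<kappa> \<epsilon> z powr (p - 1)) *\<^sub>R hardy_test_grad \<gamma> p R \<kappa> \<epsilon> z))"
    by (rule ext[OF c2], subst out) auto
qed

text \<open>Convexity with weights \<open>1 - \<theta>\<close> and \<open>\<theta>\<close>. As \<open>\<theta>\<close> tends to \<open>1\<close> the constant in front of \<open>B\<^sup>p\<close> tends to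
  \<open>1\<close>, so when \<open>A\<close> stems from the gradient of a cutoff it costs arbitrarily little of the sharp constant.\<close>
lemma powr_add_weighted_le:
  fixes A B p \<theta> :: real
  assumes "1 \<le> p" "0 \<le> A" "0 \<le> B" "0 < \<theta>" "\<theta> < 1"
  shows "(A + B) powr p \<le> (1 - \<theta>) powr (1 - p) * A powr p + \<theta> powr (1 - p) * B powr p"
proof -
  have one: "1 \<le> u powr (1 - p)" if "0 < u" "u < 1" for u :: real
    using that powr_le1[of "p - 1" u] assms(1) by (simp add: powr_diff field_simps)
  have e: "u * (X / u) powr p = u powr (1 - p) * X powr p" if "0 < u" "0 \<le> X" for u X :: real
    using that by (simp add: powr_divide powr_diff)
  show ?thesis
  proof (cases "A = 0 \<or> B = 0")
    case True
    then show ?thesis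
      using one[OF assms(4,5)] one[of "1 - \<theta>"] assms by (auto simp: mult_le_cancel_right1)
  next
    case False
    have "((1 - \<theta>) *\<^sub>R (A / (1 - \<theta>)) + \<theta> *\<^sub>R (B / \<theta>)) powr p
        \<le> (1 - \<theta>) * (A / (1 - \<theta>)) powr p + \<theta> * (B / \<theta>) powr p"
      using assms False by (intro convex_onD[OF powr_convex]) auto
    then show ?thesis using assms by (simp add: e)
  qed
qed

lemma norm_weighted_hardy_test_grad_le:
  fixes z :: "('m::finite, 'k::finite) gpoint"
  assumes \<gamma>: "0 \<le> \<gamma>" and p: "1 < p" and \<epsilon>: "0 < \<epsilon>" and x: "fst z \<noteq> 0"
  shows "norm (weighted \<gamma> z (hardy_test_grad \<gamma> p R \<kappa> \<epsilon> z)) \<le> 2 * norm (fst z) * hardy_profile \<gamma> p R \<epsilon> z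
     + axis_cutoff \<kappa> z * ((p - 1) / p) * (R - rho \<gamma> z) powr (- 1 / p) * (norm (fst z) powr \<gamma> * rho \<gamma> z powr (- \<gamma>))"
proof -
  let ?A = "2 * hardy_profile \<gamma> p R \<epsilon> z" and ?B = "axis_cutoff \<kappa> z * ((p - 1) / p * (R - rho \<gamma> z) powr (- 1 / p))"
  have "weighted \<gamma> z (hardy_test_grad \<gamma> p R \<kappa> \<epsilon> z) = ?A *\<^sub>R (fst z, 0) - ?B *\<^sub>R weighted \<gamma> z (rho_grad \<gamma> z)"
    by (simp add: weighted_def hardy_test_grad_def prod_eq_iff)
  also have "norm \<dots> \<le> norm (?A *\<^sub>R (fst z, 0 :: real ^ 'k)) + norm (?B *\<^sub>R weighted \<gamma> z (rho_grad \<gamma> z))"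
    by (rule norm_triangle_ineq4)
  also have "norm (?A *\<^sub>R (fst z, 0 :: real ^ 'k)) = ?A * norm (fst z)"
    using hardy_profile_nonneg[OF p \<epsilon>, of \<gamma> R z] by (simp add: norm_Pair)
  also have "norm (?B *\<^sub>R weighted \<gamma> z (rho_grad \<gamma> z)) = ?B * (norm (fst z) powr \<gamma> * rho \<gamma> z powr (- \<gamma>))"
    using axis_cutoff_nonneg[of \<kappa> z] p by (simp add: norm_weighted_rho_grad[OF \<gamma> x] abs_mult)
  finally show ?thesis by (simp add: mult_ac)
qed

text \<open>Both the potential term and the main part of the energy carry the factor \<open>\<chi>\<^sup>p W / s\<close>, because
  \<open>s\<^sup>a\<^sup>p / s\<^sup>p = s\<^sup>(\<^sup>a\<^sup>-\<^sup>1\<^sup>)\<^sup>p = 1 / s\<close>. The gradient of the axis cutoff contributes the constant.\<close>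
lemma hardy_integrand_lower_bound:
  fixes z :: "('m::finite, 'k::finite) gpoint"
  assumes \<gamma>: "0 \<le> \<gamma>" and p: "1 < p" and \<epsilon>: "0 < \<epsilon>" and \<theta>: "0 < \<theta>" "\<theta> < 1" and R: "0 < R"
    and x: "fst z \<noteq> 0" and r: "rho \<gamma> z < R - \<epsilon>"
  defines "a \<equiv> (p - 1) / p" and "s \<equiv> R - rho \<gamma> z"
    and "W \<equiv> (norm (fst z) powr \<gamma> * rho \<gamma> z powr (- \<gamma>)) powr p"
  shows "axis_cutoff \<kappa> z powr p * W / s * (c * (1 - (\<epsilon> / s) powr a) powr p - \<theta> powr (1 - p) * a powr p)
       - (1 - \<theta>) powr (1 - p) * (2 * R * R powr a) powr p
     \<le> c * potential \<gamma> p R z * hardy_test \<gamma> p R \<kappa> \<epsilon> z powr p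
       - norm (weighted \<gamma> z (hardy_test_grad \<gamma> p R \<kappa> \<epsilon> z)) powr p"
proof -
  let ?x = "norm (fst z)" and ?r = "rho \<gamma> z" and ?\<chi> = "axis_cutoff \<kappa> z" and ?g = "hardy_profile \<gamma> p R \<epsilon> z"
  let ?w = "?x powr \<gamma> * ?r powr (- \<gamma>)"
  have xp: "0 < ?x" and xr: "?x \<le> ?r" using x norm_fst_le_rho[OF \<gamma>, of z] by auto
  then have rp: "0 < ?r" by linarith
  have s: "\<epsilon> < s" "0 < s" "s \<le> R" using r \<epsilon> rp by (auto simp: s_def)
  have a: "0 < a" "a * p = p - 1" using p by (auto simp: a_def)
  have \<chi>: "0 \<le> ?\<chi>" by (rule axis_cutoff_nonneg)
  have g: "?g = s powr a - \<epsilon> powr a" "0 \<le> ?g"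
    using r hardy_profile_nonneg[OF p \<epsilon>, of \<gamma> R z] by (auto simp: hardy_profile_def s_def a_def)
  have es: "(\<epsilon> / s) powr a \<le> 1" using s \<epsilon> a by (intro powr_le1) auto
  have g2: "?g = s powr a * (1 - (\<epsilon> / s) powr a)" using s \<epsilon> by (simp add: g(1) powr_divide right_diff_distrib)
  have gp: "?g powr p = s powr (p - 1) * (1 - (\<epsilon> / s) powr a) powr p"
    unfolding g2 using es s by (simp add: powr_mult powr_powr a(2))
  have V: "potential \<gamma> p R z = W * s powr (- p)"
  proof (cases "\<gamma> = 0")
    case True
    then show ?thesis using xp rp by (simp add: potential_def rpow_def W_def s_def powr_minus_divide)
  next
    case False
    then show ?thesis using xp rp p
      by (simp add: potential_def rpow_def W_def s_def powr_minus_divide powr_mult powr_powr powr_divide)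
  qed
  have "c * potential \<gamma> p R z * hardy_test \<gamma> p R \<kappa> \<epsilon> z powr p =
      ?\<chi> powr p * W * c * (1 - (\<epsilon> / s) powr a) powr p * (s powr (- p) * s powr (p - 1))"
    unfolding hardy_test_def using \<chi> g(2) by (simp add: powr_mult V gp mult_ac)
  also have "s powr (- p) * s powr (p - 1) = 1 / s"
    using s by (simp add: powr_diff powr_minus_divide)
  finally have 1: "c * potential \<gamma> p R z * hardy_test \<gamma> p R \<kappa> \<epsilon> z powr p =
      ?\<chi> powr p * W / s * (c * (1 - (\<epsilon> / s) powr a) powr p)" by simp
  let ?A = "2 * ?x * ?g" and ?B = "?\<chi> * a * s powr (- 1 / p) * ?w"
  have "norm (weighted \<gamma> z (hardy_test_grad \<gamma> p R \<kappa> \<epsilon> z)) powr p \<le> (?A + ?B) powr p"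
    using norm_weighted_hardy_test_grad_le[OF \<gamma> p \<epsilon> x, of R \<kappa>] p by (intro powr_mono2) (auto simp: a_def s_def)
  also have "\<dots> \<le> (1 - \<theta>) powr (1 - p) * ?A powr p + \<theta> powr (1 - p) * ?B powr p"
    using p \<theta> \<chi> g(2) a by (intro powr_add_weighted_le) auto
  also have "?B powr p = ?\<chi> powr p * W / s * a powr p"
  proof -
    have m: "(X * Y * t * w) powr p = X powr p * w powr p * t powr p * Y powr p"
      if "0 \<le> X" "0 \<le> Y" "0 \<le> t" "0 \<le> w" for X Y t w :: real
      using that by (simp add: powr_mult)
    have "- 1 / p * p = - 1" using p by simp
    then have "(s powr (- 1 / p)) powr p = 1 / s" unfolding powr_powr using s by (simp add: powr_minus_divide)
    then show ?thesis using \<chi> a by (subst m) (auto simp: W_def)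
  qed
  finally have 3: "norm (weighted \<gamma> z (hardy_test_grad \<gamma> p R \<kappa> \<epsilon> z)) powr p \<le>
     (1 - \<theta>) powr (1 - p) * ?A powr p + \<theta> powr (1 - p) * (?\<chi> powr p * W / s * a powr p)" .
  have 4: "?A powr p \<le> (2 * R * R powr a) powr p"
  proof (rule powr_mono2)
    have "?g \<le> s powr a" by (simp add: g(1))
    also have "\<dots> \<le> R powr a" using s a by (intro powr_mono2) auto
    finally show "?A \<le> 2 * R * R powr a" using xr r \<epsilon> g(2) R by (intro mult_mono) auto
  qed (use p g(2) in auto)
  have 5: "(1 - \<theta>) powr (1 - p) * ?A powr p \<le> (1 - \<theta>) powr (1 - p) * (2 * R * R powr a) powr p"
    by (rule mult_left_mono[OF 4]) simp
  have "\<theta> powr (1 - p) * (?\<chi> powr p * W / s * a powr p) = ?\<chi> powr p * W / s * (\<theta> powr (1 - p) * a powr p)" by simp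
  then show ?thesis using 1 3 5 unfolding right_diff_distrib by linarith
qed

text \<open>Each dyadic shell \<open>R/2\<^sup>n\<^sup>+\<^sup>2 < R - \<rho> \<le> R/2\<^sup>n\<^sup>+\<^sup>1\<close> of the cone has volume comparable to its width, so it contributes
  at least a fixed amount \<open>b\<close>. The cone \<open>|x| > \<rho>/2\<close> keeps away from the degenerate set.\<close>
lemma integral_inverse_distance_cone_unbounded:
  fixes \<gamma> R :: real
  assumes \<gamma>: "0 \<le> \<gamma>" and R: "0 < R"
  defines "J \<equiv> \<lambda>n (z::('m::finite, 'k::finite) gpoint).
     if rho \<gamma> z / 2 < norm (fst z) \<and> R / 2 \<le> rho \<gamma> z \<and> rho \<gamma> z < R - R / 2 ^ Suc n then 1 / (R - rho \<gamma> z) else 0"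
  shows "integrable lborel (J n)" and "\<exists>b>0. \<forall>n. real n * b \<le> (LINT z|lborel. J n z)"
proof -
  let ?S = "{z::('m, 'k) gpoint. rho \<gamma> z / 2 < norm (fst z)}"
  have op: "open ?S" by (intro open_Collect_less continuous_intros continuous_on_rho \<gamma>) simp
  have [measurable]: "(fst :: ('m, 'k) gpoint \<Rightarrow> _) \<in> borel_measurable borel"
    by (intro borel_measurable_continuous_onI continuous_intros)
  have Jm [measurable]: "J n \<in> borel_measurable borel" for n unfolding J_def by measurable
  have Jb: "norm (J n z) \<le> 2 ^ Suc n / R" for n z
  proof (cases "J n z = 0")
    case False
    then have J: "R / 2 ^ Suc n < R - rho \<gamma> z" "J n z = 1 / (R - rho \<gamma> z)" by (auto simp: J_def split: if_splits)
    have "0 < R / 2 ^ Suc n" using R by simp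
    then have "0 < R - rho \<gamma> z" using J(1) by linarith
    then show ?thesis using J R frac_le[of 1 1 "R / 2 ^ Suc n" "R - rho \<gamma> z"] by simp
  qed (use R in simp)
  show Ji: "integrable lborel (J n)" for n
  proof (rule integrable_bounded_support[where \<rho>="R + R powr (1 + \<gamma>)"])
    show "bounded (range (J n))" using Jb[of n] unfolding bounded_iff by blast
    show "J n z = 0" if "R + R powr (1 + \<gamma>) < norm z" for z
    proof -
      have "R < rho \<gamma> z" using norm_le_rho[OF \<gamma>, of z R] that by linarith
      moreover have "0 < R / 2 ^ Suc n" using R by simp
      ultimately have "\<not> rho \<gamma> z < R - R / 2 ^ Suc n" by linarith
      then show ?thesis unfolding J_def by simp
    qed
  qed simp
  define d where "d = dilation_dim TYPE(('m, 'k) gpoint) \<gamma>"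
  define \<mu> where "\<mu> = measure lborel {z\<in>?S. rho \<gamma> z < 1}"
  have d1: "1 \<le> d" unfolding d_def by (rule dilation_dim_ge_1[OF \<gamma>])
  have inv: "dilation \<gamma> l z \<in> ?S \<longleftrightarrow> z \<in> ?S" if "0 < l" for l and z :: "('m, 'k) gpoint"
  proof -
    have "norm (fst (dilation \<gamma> l z)) = l * norm (fst z)" using that by (simp add: dilation_def)
    then have "dilation \<gamma> l z \<in> ?S \<longleftrightarrow> l * (rho \<gamma> z / 2) < l * norm (fst z)" by (simp add: rho_dilation[OF \<gamma> that])
    then show ?thesis using that by simp
  qed
  have shell: "measure lborel {z\<in>?S. a \<le> rho \<gamma> z \<and> rho \<gamma> z < b} = (b powr d - a powr d) * \<mu>" if "0 < a" "a \<le> b" for a b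
    unfolding d_def \<mu>_def by (rule measure_rho_shell[OF \<gamma> _ inv that]) (use op in auto)
  have \<mu>: "0 < \<mu>"
  proof -
    let ?O = "{z\<in>?S. rho \<gamma> z < 1}"
    have o: "open ?O"
      unfolding mem_Collect_eq by (intro open_Collect_conj open_Collect_less continuous_intros continuous_on_rho \<gamma>) simp
    obtain v :: "real ^ 'm" where v: "norm v = 1 / 2" using vector_choose_size[of "1 / 2"] by auto
    have "rho \<gamma> (v, 0 :: real ^ 'k) = 1 / 2"
      using \<gamma> by (simp add: rho_def powr_powr v)
    then have "(v, 0) \<in> ?O" by (simp add: v)
    then have "\<not> negligible ?O" using open_not_negligible[OF o] by blast
    then have "?O \<notin> null_sets lborel"
      unfolding negligible_iff_null_sets by (blast intro: null_sets_completionI)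
    moreover have "?O \<in> sets lborel" using borel_open[OF o] by (simp only: sets_lborel)
    ultimately have "emeasure lborel ?O \<noteq> 0" by (blast intro: null_setsI)
    moreover have "emeasure lborel ?O < \<infinity>"
    proof (rule emeasure_bounded_finite, rule bounded_subset[OF bounded_cball[of 0 "1 + 1 powr (1 + \<gamma>)"]], rule subsetI)
      fix z assume "z \<in> ?O"
      then show "z \<in> cball 0 (1 + 1 powr (1 + \<gamma>))" using norm_le_rho[OF \<gamma>, of z 1] by (simp add: dist_norm)
    qed
    ultimately show ?thesis unfolding \<mu>_def measure_def by (simp add: enn2real_positive_iff zero_less_iff_neq_zero)
  qed
  define b where "b = d * (R / 2) powr (d - 1) * \<mu> / 2"
  have b: "0 < b" using d1 \<mu> R by (simp add: b_def)
  have "real n * b \<le> (LINT z|lborel. J n z)" for n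
  proof (induction n)
    case 0
    have "J 0 = (\<lambda>_. 0)" by (auto simp: J_def)
    then show ?case by simp
  next
    case (Suc n)
    let ?a = "R - R / 2 ^ Suc n" and ?b = "R - R / 2 ^ Suc (Suc n)"
    let ?T = "{z\<in>?S. ?a \<le> rho \<gamma> z \<and> rho \<gamma> z < ?b}"
    have pw: "(2::real) \<le> 2 ^ Suc n" by simp
    have a2: "R / 2 \<le> ?a"
      using divide_left_mono[OF pw, of R] R by simp
    have ab: "?b - ?a = R / 2 ^ Suc (Suc n)" "?a \<le> ?b" using R by (auto simp: field_simps)
    have T: "?T \<in> sets lborel" using op by measurable
    have Tfin: "emeasure lborel ?T < \<infinity>"
    proof (rule emeasure_bounded_finite, rule bounded_subset[OF bounded_cball[of 0 "R + R powr (1 + \<gamma>)"]], rule subsetI)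
      fix z assume "z \<in> ?T"
      moreover have "?b \<le> R" using R by simp
      ultimately have "rho \<gamma> z \<le> R" by simp
      then show "z \<in> cball 0 (R + R powr (1 + \<gamma>))" using norm_le_rho[OF \<gamma>, of z R] by (simp add: dist_norm)
    qed
    have Ti: "integrable lborel (\<lambda>z. 2 ^ Suc n / R * indicator ?T z)"
      using T Tfin by (intro integrable_mult_right integrable_real_indicator)
    have "J n z + 2 ^ Suc n / R * indicator ?T z \<le> J (Suc n) z" for z
    proof (cases "z \<in> ?T")
      case True
      then have z: "rho \<gamma> z / 2 < norm (fst z)" "?a \<le> rho \<gamma> z" "rho \<gamma> z < ?b" by auto
      have "J n z = 0" using z by (simp add: J_def)
      moreover have "J (Suc n) z = 1 / (R - rho \<gamma> z)" using z a2 by (simp add: J_def)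
      moreover have "1 / (R / 2 ^ Suc n) \<le> 1 / (R - rho \<gamma> z)"
      proof (rule divide_left_mono)
        have "0 < R / 2 ^ Suc (Suc n)" using R by simp
        then have "0 < R - rho \<gamma> z" using z(3) by linarith
        then show "0 < R / 2 ^ Suc n * (R - rho \<gamma> z)" using R by simp
        show "R - rho \<gamma> z \<le> R / 2 ^ Suc n" using z(2) by linarith
      qed simp
      ultimately show ?thesis using True by simp
    next
      case False
      have "J n z \<le> J (Suc n) z"
      proof (cases "J n z = 0")
        case True
        have "0 < R / 2 ^ Suc (Suc n)" using R by simp
        then show ?thesis using True by (auto simp: J_def)
      next
        case False
        then have "rho \<gamma> z < ?a" by (simp add: J_def split: if_splits)
        then have "rho \<gamma> z < ?b" using ab(2) by linarith
        then show ?thesis using False by (simp add: J_def split: if_splits)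
      qed
      then show ?thesis using False by simp
    qed
    then have "(LINT z|lborel. J n z + 2 ^ Suc n / R * indicator ?T z) \<le> (LINT z|lborel. J (Suc n) z)"
      by (intro integral_mono Bochner_Integration.integrable_add Ji Ti)
    also have "(LINT z|lborel. J n z + 2 ^ Suc n / R * indicator ?T z) = (LINT z|lborel. J n z) + 2 ^ Suc n / R * measure lborel ?T"
      using Ji[of n] Ti T Tfin by (subst Bochner_Integration.integral_add) auto
    finally have 1: "(LINT z|lborel. J n z) + 2 ^ Suc n / R * measure lborel ?T \<le> (LINT z|lborel. J (Suc n) z)" .
    have mT: "measure lborel ?T = (?b powr d - ?a powr d) * \<mu>" using a2 R ab by (intro shell) auto
    have dT: "d * (R / 2) powr (d - 1) * (?b - ?a) \<le> ?b powr d - ?a powr d"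
    proof -
      have "d * (R / 2) powr (d - 1) * (?b - ?a) \<le> d * ?a powr (d - 1) * (?b - ?a)"
        using d1 R a2 ab by (intro mult_right_mono mult_left_mono powr_mono2) auto
      also have "\<dots> \<le> ?b powr d - ?a powr d" using a2 R ab d1 by (intro powr_diff_bounds) auto
      finally show ?thesis .
    qed
    have "(d * (R / 2) powr (d - 1) * (?b - ?a)) * \<mu> \<le> measure lborel ?T"
      unfolding mT using \<mu> by (intro mult_right_mono[OF dT]) simp
    then have "2 ^ Suc n / R * (d * (R / 2) powr (d - 1) * (R / 2 ^ Suc (Suc n)) * \<mu>) \<le> 2 ^ Suc n / R * measure lborel ?T"
      using R unfolding ab(1) by (intro mult_left_mono) auto
    moreover have "2 ^ Suc n / R * (d * (R / 2) powr (d - 1) * (R / 2 ^ Suc (Suc n)) * \<mu>) = b"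
      using R by (simp add: b_def)
    ultimately show ?case using 1 Suc by (simp add: algebra_simps)
  qed
  then show "\<exists>b>0. \<forall>n. real n * b \<le> (LINT z|lborel. J n z)" using b by blast
qed

text \<open>Let \<open>c' < c\<close> be the constant that the weighted convexity inequality puts in front of the energy. For
  \<open>s \<ge> K \<epsilon>\<close> the integrand is, up to a bounded term, at least \<open>(c - c') / 2\<close> times the weight over \<open>s\<close>, and on the strip
  \<open>\<epsilon> < s < K \<epsilon>\<close>, of volume \<open>O(\<epsilon>)\<close>, it is at least \<open>- O(1/\<epsilon>)\<close>. The function \<open>g\<close> is the explicit integrable minorant made of these bounds.\<close>
lemma hardy_energy_unbounded:
  fixes \<gamma> p R c L :: real
  assumes \<gamma>: "0 \<le> \<gamma>" and p: "1 < p" and R: "0 < R" and c: "((p - 1) / p) powr p < c"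
  obtains \<epsilon> and g :: "('m::finite, 'k::finite) gpoint \<Rightarrow> real"
  where "0 < \<epsilon>" "\<epsilon> < R" "integrable lborel g" "L \<le> (LINT z|lborel. g z)"
    "\<And>z. 0 < hardy_test \<gamma> p R (R / 8) \<epsilon> z \<Longrightarrow>
       g z \<le> c * potential \<gamma> p R z * hardy_test \<gamma> p R (R / 8) \<epsilon> z powr p
         - norm (weighted \<gamma> z (hardy_test_grad \<gamma> p R (R / 8) \<epsilon> z)) powr p"
    "\<And>z. hardy_test \<gamma> p R (R / 8) \<epsilon> z = 0 \<Longrightarrow> g z \<le> 0"
proof -
  define a where "a = (p - 1) / p"
  have a: "0 < a" using p by (simp add: a_def)
  define q where "q = (1 + c / a powr p) / 2"
  have q: "1 < q" "q * a powr p < c"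
    using a c by (simp_all add: q_def a_def[symmetric] field_simps)
  \<comment> \<open>Solves \<open>\<theta>\<^sup>1\<^sup>-\<^sup>p = q\<close>, where \<open>q a\<^sup>p\<close> is the midpoint of \<open>a\<^sup>p\<close> and \<open>c\<close>.\<close>
  define \<theta> where "\<theta> = q powr (- 1 / (p - 1))"
  have \<theta>: "0 < \<theta>" "\<theta> < 1" "\<theta> powr (1 - p) = q"
  proof -
    show "0 < \<theta>" using q by (simp add: \<theta>_def)
    have "q powr (- 1 / (p - 1)) < q powr 0" using q p by (intro powr_less_mono) (auto simp: divide_less_0_iff)
    then show "\<theta> < 1" using q by (simp add: \<theta>_def)
    have "- 1 / (p - 1) * (1 - p) = 1" using p by (simp add: field_simps)
    then show "\<theta> powr (1 - p) = q" using q by (simp add: \<theta>_def powr_powr)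
  qed
  define c' where "c' = q * a powr p"
  have c': "0 < c'" "c' < c" using q a by (auto simp: c'_def)
  define y where "y = ((c + c') / (2 * c)) powr (1 / p)"
  have yq: "0 < (c + c') / (2 * c)" "(c + c') / (2 * c) < 1" using c' by (auto simp: field_simps)
  have y: "0 < y" "y < 1" "y powr p = (c + c') / (2 * c)"
  proof -
    show "0 < y" using yq c' by (simp add: y_def)
    have "((c + c') / (2 * c)) powr (1 / p) < 1 powr (1 / p)" using yq p by (intro powr_less_mono2) auto
    then show "y < 1" by (simp add: y_def)
    show "y powr p = (c + c') / (2 * c)" using yq p c' by (simp add: y_def powr_powr)
  qed
  \<comment> \<open>Chosen so that \<open>s \<ge> K \<epsilon>\<close> implies \<open>c (1 - (\<epsilon> / s)\<^sup>a)\<^sup>p \<ge> c y\<^sup>p = (c + c') / 2\<close>.\<close>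
  define K where "K = (1 - y) powr (- 1 / a)"
  have K: "1 < K" "K powr (- a) = 1 - y"
  proof -
    have "1 powr (- 1 / a) < (1 - y) powr (- 1 / a)" using y a by (intro powr_less_mono2_neg) auto
    then show "1 < K" by (simp add: K_def)
    show "K powr (- a) = 1 - y" using y a by (simp add: K_def powr_powr)
  qed
  define C1 where "C1 = (1 - \<theta>) powr (1 - p) * (2 * R * R powr a) powr p"
  have C1: "0 \<le> C1" by (simp add: C1_def)
  define d where "d = (c - c') / 2"
  have d: "0 < d" using c' by (simp add: d_def)
  define w0 where "w0 = (3 * R\<^sup>2 / 64) powr p * ((R / 8) powr \<gamma> * R powr (- \<gamma>)) powr p"
  have w0: "0 < w0" using R by (simp add: w0_def)
  define J where "J n z = (if rho \<gamma> z / 2 < norm (fst z) \<and> R / 2 \<le> rho \<gamma> z \<and> rho \<gamma> z < R - R / 2 ^ Suc n then 1 / (R - rho \<gamma> z) else 0)"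
    for n and z :: "('m, 'k) gpoint"
  note Ji = integral_inverse_distance_cone_unbounded(1)[OF \<gamma> R, where ?'m='m and ?'k='k, folded J_def]
  obtain b where b: "0 < b" "\<And>n. real n * b \<le> (LINT z|lborel. J n z)"
    using integral_inverse_distance_cone_unbounded(2)[OF \<gamma> R, where ?'m='m and ?'k='k, folded J_def] by blast
  define Q where "Q = dilation_dim TYPE(('m, 'k) gpoint) \<gamma>"
  have Q: "1 \<le> Q" unfolding Q_def by (rule dilation_dim_ge_1[OF \<gamma>])
  define B where "B = {z::('m, 'k) gpoint. rho \<gamma> z < R}"
  define \<mu> where "\<mu> = measure lborel {z::('m, 'k) gpoint. z \<in> UNIV \<and> rho \<gamma> z < 1}"
  have \<mu>: "0 \<le> \<mu>" by (simp add: \<mu>_def)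
  have fin: "emeasure lborel A < \<infinity>" if "A \<subseteq> B" for A
  proof (rule emeasure_bounded_finite, rule bounded_subset[OF bounded_cball[of 0 "R + R powr (1 + \<gamma>)"]], rule subsetI)
    fix z assume "z \<in> A"
    then have "rho \<gamma> z \<le> R" using that by (auto simp: B_def)
    then show "z \<in> cball 0 (R + R powr (1 + \<gamma>))" using norm_le_rho[OF \<gamma>, of z R] by (simp add: dist_norm)
  qed
  define C2 where "C2 = c' * (R\<^sup>2) powr p * (Q * R powr (Q - 1) * K * \<mu>)"
  obtain n where n: "(L + C2 + C1 * measure lborel B) / (d * w0 * b) < real n"
    using reals_Archimedean2 by blast
  \<comment> \<open>The strip \<open>\<epsilon> < s < K \<epsilon>\<close> ends exactly where the dyadic shells of \<open>J n\<close> begin.\<close>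
  define \<epsilon> where "\<epsilon> = R / 2 ^ Suc n / K"
  have K\<epsilon>: "K * \<epsilon> = R / 2 ^ Suc n" using K by (simp add: \<epsilon>_def)
  have \<epsilon>: "0 < \<epsilon>" "\<epsilon> < K * \<epsilon>" "K * \<epsilon> \<le> R / 2"
  proof -
    show "0 < \<epsilon>" using R K by (simp add: \<epsilon>_def)
    then show "\<epsilon> < K * \<epsilon>" using K by simp
    have "(2::real) \<le> 2 ^ Suc n" by simp
    then show "K * \<epsilon> \<le> R / 2" unfolding K\<epsilon> using R divide_left_mono[of 2 "2 ^ Suc n" R] by simp
  qed
  have \<epsilon>R: "\<epsilon> < R" using \<epsilon> R by linarith
  define S where "S = {z::('m, 'k) gpoint. z \<in> UNIV \<and> R - K * \<epsilon> \<le> rho \<gamma> z \<and> rho \<gamma> z < R - \<epsilon>}"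
  have [measurable]: "B \<in> sets borel" "S \<in> sets borel" unfolding B_def S_def by measurable
  have SB: "S \<subseteq> B" using \<epsilon> by (auto simp: S_def B_def)
  define g where "g z = d * w0 * J n z - c' * (R\<^sup>2) powr p / \<epsilon> * indicator S z - C1 * indicator B z" for z
  have Si: "integrable lborel (\<lambda>z. c' * (R\<^sup>2) powr p / \<epsilon> * indicator S z)"
    by (intro integrable_mult_right integrable_real_indicator fin SB) simp
  have Bi: "integrable lborel (\<lambda>z. C1 * indicator B z)"
    by (intro integrable_mult_right integrable_real_indicator fin) auto
  have gi: "integrable lborel g"
    unfolding g_def by (intro Bochner_Integration.integrable_diff integrable_mult_right Ji Si Bi)
  have "(LINT z|lborel. g z) = d * w0 * (LINT z|lborel. J n z) - c' * (R\<^sup>2) powr p / \<epsilon> * measure lborel S - C1 * measure lborel B"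
    unfolding g_def using Ji[of n] Si Bi
    by (simp add: Bochner_Integration.integral_diff Bochner_Integration.integrable_diff fin[OF SB] fin[of B])
  moreover have "c' * (R\<^sup>2) powr p / \<epsilon> * measure lborel S \<le> C2"
  proof -
    have "measure lborel S = ((R - \<epsilon>) powr Q - (R - K * \<epsilon>) powr Q) * \<mu>"
      unfolding S_def Q_def \<mu>_def using \<epsilon> R by (intro measure_rho_shell[OF \<gamma>]) auto
    also have "\<dots> \<le> (Q * (R - \<epsilon>) powr (Q - 1) * ((R - \<epsilon>) - (R - K * \<epsilon>))) * \<mu>"
      using \<epsilon> R Q \<mu> by (intro mult_right_mono powr_diff_bounds) auto
    also have "\<dots> \<le> (Q * R powr (Q - 1) * (K * \<epsilon>)) * \<mu>"
      using \<epsilon> \<epsilon>R R Q \<mu> by (intro mult_right_mono mult_mono powr_mono2) auto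
    finally have "c' * (R\<^sup>2) powr p / \<epsilon> * measure lborel S \<le> c' * (R\<^sup>2) powr p / \<epsilon> * ((Q * R powr (Q - 1) * (K * \<epsilon>)) * \<mu>)"
      using c' \<epsilon> by (intro mult_left_mono) auto
    also have "\<dots> = C2" using \<epsilon> by (simp add: C2_def)
    finally show ?thesis .
  qed
  moreover have "L + C2 + C1 * measure lborel B \<le> d * w0 * (LINT z|lborel. J n z)"
  proof -
    have "L + C2 + C1 * measure lborel B \<le> real n * (d * w0 * b)"
      using n d w0 b(1) by (simp add: divide_less_eq)
    also have "\<dots> = d * w0 * (real n * b)" by simp
    also have "\<dots> \<le> d * w0 * (LINT z|lborel. J n z)" using d w0 by (intro mult_left_mono b) auto
    finally show ?thesis .
  qed
  ultimately have Lg: "L \<le> (LINT z|lborel. g z)" by linarith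
  have \<kappa>: "0 < R / 8" using R by simp
  note iff = hardy_test_pos_iff[OF p \<epsilon>(1) \<kappa>, of \<gamma> R]
  have Jpos: "0 < hardy_test \<gamma> p R (R / 8) \<epsilon> z" if "J n z \<noteq> 0" for z
    using that \<epsilon> R K\<epsilon> unfolding iff(1)[of z] by (auto simp: J_def split: if_splits)
  have zero: "g z \<le> 0" if "hardy_test \<gamma> p R (R / 8) \<epsilon> z = 0" for z
  proof -
    have "J n z = 0" using Jpos[of z] that by force
    moreover have "0 \<le> c' * (R\<^sup>2) powr p / \<epsilon> * indicator S z" using c' \<epsilon> by simp
    moreover have "0 \<le> C1 * indicator B z" using C1 by simp
    ultimately show ?thesis unfolding g_def by simp
  qed
  have main: "g z \<le> c * potential \<gamma> p R z * hardy_test \<gamma> p R (R / 8) \<epsilon> z powr p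
         - norm (weighted \<gamma> z (hardy_test_grad \<gamma> p R (R / 8) \<epsilon> z)) powr p"
    if pos: "0 < hardy_test \<gamma> p R (R / 8) \<epsilon> z" for z
  proof -
    define s where "s = R - rho \<gamma> z"
    define W where "W = (norm (fst z) powr \<gamma> * rho \<gamma> z powr (- \<gamma>)) powr p"
    let ?\<chi> = "axis_cutoff (R / 8) z"
    have z: "R / 8 < norm (fst z)" "rho \<gamma> z < R - \<epsilon>" using pos iff(1)[of z] by auto
    have x: "fst z \<noteq> 0" using z R by auto
    have xr: "norm (fst z) \<le> rho \<gamma> z" by (rule norm_fst_le_rho[OF \<gamma>])
    have rp: "0 < rho \<gamma> z" using xr z R by linarith
    have s: "\<epsilon> < s" "0 < s" using z \<epsilon> by (auto simp: s_def)
    have zB: "z \<in> B" using z \<epsilon> by (auto simp: B_def)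
    let ?M = "?\<chi> powr p * W / s"
    let ?E = "c * (1 - (\<epsilon> / s) powr a) powr p - c'"
    have low: "?M * ?E - C1 \<le> c * potential \<gamma> p R z * hardy_test \<gamma> p R (R / 8) \<epsilon> z powr p
         - norm (weighted \<gamma> z (hardy_test_grad \<gamma> p R (R / 8) \<epsilon> z)) powr p"
      using hardy_integrand_lower_bound[OF \<gamma> p \<epsilon>(1) \<theta>(1,2) R x z(2), where \<kappa>="R / 8" and c=c]
      unfolding \<theta>(3) s_def W_def C1_def c'_def a_def .
    have M0: "0 \<le> ?M" using s by (simp add: W_def)
    have far: "d \<le> ?E" if "K * \<epsilon> \<le> s"
    proof -
      have "\<epsilon> / s \<le> 1 / K" "0 \<le> \<epsilon> / s"
        using that s(2) \<epsilon>(1) K(1) by (simp_all add: divide_simps mult.commute)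
      then have "(\<epsilon> / s) powr a \<le> (1 / K) powr a"
        using a by (intro powr_mono2) auto
      also have "\<dots> = 1 - y" using K by (simp add: powr_divide powr_minus_divide)
      finally have "y powr p \<le> (1 - (\<epsilon> / s) powr a) powr p" using y p by (intro powr_mono2) auto
      then have "c * y powr p \<le> c * (1 - (\<epsilon> / s) powr a) powr p" using c' by (intro mult_left_mono) auto
      moreover have "c * y powr p = (c + c') / 2" using y c' by simp
      ultimately show ?thesis by (simp add: d_def field_simps)
    qed
    show ?thesis
    proof (cases "J n z = 0")
      case False
      then have zJ: "rho \<gamma> z / 2 < norm (fst z)" "R / 2 \<le> rho \<gamma> z" "rho \<gamma> z < R - K * \<epsilon>" "J n z = 1 / s"
        unfolding K\<epsilon> s_def by (auto simp: J_def split: if_splits)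
      then have zS: "z \<notin> S" by (simp add: S_def)
      have "(R / 4)\<^sup>2 \<le> (norm (fst z))\<^sup>2" using zJ R by (intro power_mono) auto
      then have "3 * R\<^sup>2 / 64 \<le> (norm (fst z))\<^sup>2 - (R / 8)\<^sup>2" by (simp add: power_divide)
      then have \<chi>R: "3 * R\<^sup>2 / 64 \<le> ?\<chi>" unfolding axis_cutoff_def by (rule max.coboundedI2)
      have "(R / 8) powr \<gamma> \<le> norm (fst z) powr \<gamma>" using z(1) R \<gamma> by (intro powr_mono2) auto
      moreover have "R powr - \<gamma> \<le> rho \<gamma> z powr - \<gamma>" using \<gamma> rp z \<epsilon> by (intro powr_mono2') auto
      ultimately have "(R / 8) powr \<gamma> * R powr - \<gamma> \<le> norm (fst z) powr \<gamma> * rho \<gamma> z powr - \<gamma>"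
        by (intro mult_mono) auto
      then have "((R / 8) powr \<gamma> * R powr (- \<gamma>)) powr p \<le> W" unfolding W_def using p by (intro powr_mono2) auto
      moreover have "(3 * R\<^sup>2 / 64) powr p \<le> ?\<chi> powr p" using p by (intro powr_mono2 \<chi>R) auto
      ultimately have "w0 \<le> ?\<chi> powr p * W" unfolding w0_def by (intro mult_mono) auto
      then have "d * w0 * (1 / s) \<le> ?M * ?E"
      proof -
        assume "w0 \<le> ?\<chi> powr p * W"
        then have "w0 / s * d \<le> ?M * ?E"
          using s d M0 far zJ(3) w0 by (intro mult_mono divide_right_mono) (auto simp: s_def)
        then show ?thesis by (simp add: mult.commute)
      qed
      then show ?thesis using low zJ(4) zS zB by (simp add: g_def)
    next
      case J0: True
      show ?thesis
      proof (cases "K * \<epsilon> \<le> s")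
        case True
        have "0 \<le> ?M * ?E" using M0 far[OF True] d by (intro mult_nonneg_nonneg) auto
        moreover have "0 \<le> c' * (R\<^sup>2) powr p / \<epsilon> * indicator S z" using c' \<epsilon> by simp
        ultimately show ?thesis using low J0 zB unfolding g_def by simp
      next
        case False
        then have zS: "z \<in> S" using z by (auto simp: S_def s_def)
        have "?\<chi> powr p * W \<le> (R\<^sup>2) powr p * 1"
        proof (rule mult_mono)
          have "(norm (fst z))\<^sup>2 \<le> R\<^sup>2" using xr z \<epsilon> by (intro power_mono) auto
          then have "(norm (fst z))\<^sup>2 - (R / 8)\<^sup>2 \<le> R\<^sup>2" using zero_le_power2[of "R / 8"] by linarith
          then have "?\<chi> \<le> R\<^sup>2" by (simp add: axis_cutoff_def)
          then show "?\<chi> powr p \<le> (R\<^sup>2) powr p" using p by (intro powr_mono2 axis_cutoff_nonneg) auto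
          have "norm (fst z) powr \<gamma> * rho \<gamma> z powr (- \<gamma>) \<le> rho \<gamma> z powr \<gamma> * rho \<gamma> z powr (- \<gamma>)"
            using \<gamma> xr by (intro mult_right_mono powr_mono2) auto
          also have "\<dots> = 1" using rp by (simp add: powr_add[symmetric])
          finally show "W \<le> 1" unfolding W_def using p by (intro powr_le1) auto
        qed (auto simp: W_def)
        then have "?M \<le> (R\<^sup>2) powr p / \<epsilon>" using s \<epsilon> by (intro frac_le) (auto simp: W_def)
        then have "c' * ?M \<le> c' * ((R\<^sup>2) powr p / \<epsilon>)" using c' by (intro mult_left_mono) auto
        moreover have "?M * (- c') \<le> ?M * ?E" using M0 c' by (intro mult_left_mono) auto
        moreover have "?M * (- c') = - (c' * ?M)" "c' * ((R\<^sup>2) powr p / \<epsilon>) = c' * (R\<^sup>2) powr p / \<epsilon>" by simp_all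
        ultimately have "- (c' * (R\<^sup>2) powr p / \<epsilon>) \<le> ?M * ?E" by linarith
        then show ?thesis using low J0 zS zB unfolding g_def by simp
      qed
    qed
  qed
  show ?thesis by (rule that[OF \<epsilon>(1) \<epsilon>R gi Lg main zero])
qed

section \<open>Borel representatives\<close>
lemma borel_measurable_lebesgue_AE_cong:
  fixes f g :: "'a::euclidean_space \<Rightarrow> 'b::topological_space"
  assumes f: "f \<in> borel_measurable lebesgue" and ae: "AE x in lebesgue. f x = g x"
  shows "g \<in> borel_measurable lebesgue"
proof (rule measurableI)
  obtain N where N: "N \<in> null_sets lebesgue" "{x. f x \<noteq> g x} \<subseteq> N"
    using ae unfolding eventually_ae_filter by auto
  fix A :: "'b set" assume A: "A \<in> sets borel"
  have fA: "f -` A \<in> sets lebesgue" using measurable_sets[OF f A] by simp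
  have fg: "f x = g x" if "x \<notin> N" for x using N(2) that by blast
  have eq: "g -` A = (f -` A - N) \<union> (g -` A \<inter> N)" by (auto simp: fg)
  have gN: "g -` A \<inter> N \<in> sets lebesgue"
    by (rule null_setsD2[OF completion.complete2[OF _ N(1)]]) simp
  have "g -` A \<in> sets lebesgue"
    by (subst eq) (intro sets.Un sets.Diff fA gN null_setsD2[OF N(1)])
  then show "g -` A \<inter> space lebesgue \<in> sets lebesgue" by simp
qed auto

lemma integral_lebesgue_eq_lborel:
  fixes X Y :: "'a::euclidean_space \<Rightarrow> 'b::euclidean_space"
  assumes Y: "Y \<in> borel_measurable borel" and ae: "AE w in lebesgue. X w = Y w"
  shows "integral\<^sup>L lebesgue X = integral\<^sup>L lborel Y"
proof -
  have Y': "Y \<in> borel_measurable lebesgue" using Y by (intro measurable_completion) simp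
  have "X \<in> borel_measurable lebesgue"
    by (rule borel_measurable_lebesgue_AE_cong[OF Y']) (use ae in auto)
  then have "integral\<^sup>L lebesgue X = integral\<^sup>L lebesgue Y"
    using Y' ae by (intro integral_cong_AE)
  also have "\<dots> = integral\<^sup>L lborel Y" using Y by (intro integral_completion) simp
  finally show ?thesis .
qed

lemma ex_borel_version:
  fixes X :: "'a::euclidean_space \<Rightarrow> 'b::euclidean_space"
  assumes X: "X \<in> borel_measurable lebesgue"
  obtains Y where "Y \<in> borel_measurable borel" "AE w in lebesgue. X w = Y w"
proof -
  have "\<exists>Y\<in>borel_measurable lborel. AE w in lborel. X w \<bullet> b = Y w" for b
    by (rule completion_ex_borel_measurable_real) (use X in auto)
  then obtain Y where Y: "\<And>b. Y b \<in> borel_measurable lborel" "\<And>b. AE w in lborel. X w \<bullet> b = Y b w" by metis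
  have "AE w in lborel. \<forall>b\<in>Basis. X w \<bullet> b = Y b w" using Y(2) by (intro AE_finite_allI) auto
  then have "AE w in lborel. X w = (\<Sum>b\<in>Basis. Y b w *\<^sub>R b)"
  proof eventually_elim
    case (elim w)
    have "(\<Sum>b\<in>Basis. Y b w *\<^sub>R b) = (\<Sum>b\<in>Basis. (X w \<bullet> b) *\<^sub>R b)" using elim by (intro sum.cong) auto
    then show ?case by (simp add: euclidean_representation)
  qed
  moreover have "(\<lambda>w. \<Sum>b\<in>Basis. Y b w *\<^sub>R b) \<in> borel_measurable borel" using Y(1) by (intro borel_measurable_sum borel_measurable_scaleR) auto
  ultimately show ?thesis using that AE_completion by blast
qed

section \<open>Mollifiers as test functions\<close>

text \<open>For \<open>s = 0\<close> this is the mollifier around \<open>w0\<close> where \<open>x \<noteq> 0\<close>. The choice \<open>s = - \<gamma>\<close> turns the distributional derivative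
  \<open>|x|\<^sup>\<gamma> \<partial>\<^sub>y\<close> into \<open>\<partial>\<^sub>y\<close>; it is a smooth test function as long as its support avoids \<open>x = 0\<close>.\<close>
definition kernel_test ::
  "real \<Rightarrow> real \<Rightarrow> ('m::finite, 'k::finite) gpoint \<times> real \<Rightarrow> ('m, 'k) gpoint \<times> real \<Rightarrow> real" where
  "kernel_test s r w0 w = norm (fst (fst w)) powr s * mollifier r (w0 - w)"

lemma norm_inner_self: "(w0 - w) \<bullet> (w0 - w) = (w - w0) \<bullet> (w - w0)" for w w0 :: "'a::real_inner"
  by (simp add: inner_simps inner_commute)

lemma kernel_test_mem:
  fixes w0 :: "('m::finite, 'k::finite) gpoint \<times> real"
  assumes r: "0 < r" and sub: "cball w0 r \<subseteq> W" and x: "\<And>w. w \<in> cball w0 r \<Longrightarrow> fst (fst w) \<noteq> 0"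
  shows "kernel_test s r w0 \<in> test_functions W"
proof -
  let ?\<pi> = "\<lambda>w :: ('m, 'k) gpoint \<times> real. fst (fst w)"
  have \<pi>: "bounded_linear ?\<pi>"
    by (rule bounded_linear_compose[OF bounded_linear_fst bounded_linear_fst])
  have nz: "r\<^sup>2 < (w - w0) \<bullet> (w - w0)" if "?\<pi> w = 0" for w
  proof -
    have "w \<notin> cball w0 r" using x that by blast
    then have "r < norm (w - w0)" by (simp add: dist_norm norm_minus_commute)
    then have "r\<^sup>2 < (norm (w - w0))\<^sup>2" using r by (intro power_strict_mono) auto
    then show ?thesis by (simp add: dot_square_norm)
  qed
  have "tame ?\<pi> w0 r (\<lambda>w. (norm (?\<pi> w) powr s * flat 1 (r\<^sup>2 - (w - w0) \<bullet> (w - w0)))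
     * (1 / (LINT y|lborel. flat 1 (r\<^sup>2 - (y :: ('m, 'k) gpoint \<times> real) \<bullet> y))))"
    by (intro tame.mult tame.bump tame.const)
  then have "tame ?\<pi> w0 r (kernel_test s r w0)"
    unfolding kernel_test_def[abs_def] mollifier_def norm_inner_self by simp
  then have sm: "smooth (kernel_test s r w0)" using tame_smooth[OF \<pi> nz] by blast
  have supp: "{w. kernel_test s r w0 w \<noteq> 0} \<subseteq> cball w0 r"
    using mollifier_outside[OF r] by (force simp: kernel_test_def dist_norm)
  then have cl: "closure {w. kernel_test s r w0 w \<noteq> 0} \<subseteq> cball w0 r" by (simp add: closure_minimal)
  then have "compact (closure {w. kernel_test s r w0 w \<noteq> 0})"
    by (metis bounded_cball bounded_subset closed_closure compact_eq_bounded_closed)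
  then show ?thesis using sm cl sub unfolding test_functions_def by blast
qed

text \<open>The Euclidean gradient of \<open>kernel_test\<close> in space-time.\<close>
definition kernel_test_grad ::
  "real \<Rightarrow> real \<Rightarrow> ('m::finite, 'k::finite) gpoint \<times> real \<Rightarrow> ('m, 'k) gpoint \<times> real \<Rightarrow> ('m, 'k) gpoint \<times> real" where
  "kernel_test_grad s r w0 w = (s * norm (fst (fst w)) powr (s - 2) * mollifier r (w0 - w)) *\<^sub>R ((fst (fst w), 0), 0)
     - norm (fst (fst w)) powr s *\<^sub>R mollifier_grad r (w0 - w)"

lemma has_derivative_kernel_test:
  fixes w :: "('m::finite, 'k::finite) gpoint \<times> real"
  assumes x: "fst (fst w) \<noteq> 0 \<or> w \<notin> cball w0 r" and r: "0 < r"
  shows "(kernel_test s r w0 has_derivative (\<lambda>v. kernel_test_grad s r w0 w \<bullet> v)) (at w)"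
proof (cases "w \<in> cball w0 r")
  case True
  let ?\<pi> = "\<lambda>w :: ('m, 'k) gpoint \<times> real. fst (fst w)"
  have pos: "0 < ?\<pi> w \<bullet> ?\<pi> w" using x True by simp
  have "((\<lambda>w. (?\<pi> w \<bullet> ?\<pi> w) powr (s / 2)) has_derivative
     (\<lambda>v. 2 * (?\<pi> w \<bullet> ?\<pi> v) * (s / 2 * (?\<pi> w \<bullet> ?\<pi> w) powr (s / 2 - 1)))) (at w)"
    by (rule DERIV_compose_FDERIV[where f="\<lambda>x. x powr (s / 2)" and g="\<lambda>w. ?\<pi> w \<bullet> ?\<pi> w", OF has_real_derivative_powr[OF pos]])
       (auto intro!: derivative_eq_intros simp: inner_commute)
  then have 1: "((\<lambda>w. norm (?\<pi> w) powr s) has_derivative (\<lambda>v. s * (?\<pi> w \<bullet> ?\<pi> v) * norm (?\<pi> w) powr (s - 2))) (at w)"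
  proof -
    have "norm y powr s = (y \<bullet> y) powr (s / 2)" "norm y powr (s - 2) = (y \<bullet> y) powr (s / 2 - 1)" for y :: "real ^ 'm"
      using norm_powr_double[of y "s / 2"] norm_powr_double[of y "s / 2 - 1"] by (simp_all add: algebra_simps)
    then show ?thesis using \<open>((\<lambda>w. (?\<pi> w \<bullet> ?\<pi> w) powr (s / 2)) has_derivative
     (\<lambda>v. 2 * (?\<pi> w \<bullet> ?\<pi> v) * (s / 2 * (?\<pi> w \<bullet> ?\<pi> w) powr (s / 2 - 1)))) (at w)\<close>
      by (simp add: algebra_simps)
  qed
  have 2: "((\<lambda>w. mollifier r (w0 - w)) has_derivative (\<lambda>v. mollifier_grad r (w0 - w) \<bullet> (- v))) (at w)"
    by (rule has_derivative_compose[OF _ has_derivative_mollifier]) (auto intro!: derivative_eq_intros)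
  show ?thesis
    unfolding kernel_test_def[abs_def] kernel_test_grad_def
    by (rule has_derivative_eq_rhs, rule has_derivative_mult[OF 1 2])
       (auto simp: fun_eq_iff inner_diff_left inner_prod_def algebra_simps)
next
  case False
  have out: "r \<le> norm (w0 - y)" if "y \<in> - cball w0 r" for y using that by (simp add: dist_norm)
  have "(kernel_test s r w0 has_derivative (\<lambda>v. 0)) (at w)"
    by (rule has_derivative_transform_within_open[OF has_derivative_const, of "- cball w0 r"])
       (use False mollifier_outside[OF r out] in \<open>auto simp: kernel_test_def\<close>)
  moreover have "kernel_test_grad s r w0 w = 0"
    using mollifier_outside[OF r out, of w] mollifier_grad_outside[OF r out, of w] False by (simp add: kernel_test_grad_def flip: zero_prod_def)
  ultimately show ?thesis by simp
qed

text \<open>Translates the coordinate derivatives of the definitions into components of a single space-time gradient.\<close>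
lemma slice_derivatives:
  fixes f :: "('m::finite, 'k::finite) gpoint \<times> real \<Rightarrow> real"
  assumes f: "(f has_derivative (\<lambda>v. g \<bullet> v)) (at w)"
  shows "grad_\<gamma> \<gamma> (\<lambda>z. f (z, snd w)) (fst w) = weighted \<gamma> (fst w) (fst g)"
    and "deriv (\<lambda>t. f (fst w, t)) (snd w) = snd g"
proof -
  have "((\<lambda>z. f (z, snd w)) has_derivative (\<lambda>v. g \<bullet> (v, 0))) (at (fst w))"
    using f by (intro has_derivative_compose[of "\<lambda>z. (z, snd w)" "\<lambda>v. (v, 0)" _ UNIV f "\<lambda>v. g \<bullet> v"])
      (auto intro!: derivative_eq_intros)
  from frechet_derivative_at[OF this]
  have "frechet_derivative (\<lambda>z. f (z, snd w)) (at (fst w)) = (\<lambda>v. g \<bullet> (v, 0))" by simp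
  then show "grad_\<gamma> \<gamma> (\<lambda>z. f (z, snd w)) (fst w) = weighted \<gamma> (fst w) (fst g)"
    by (simp add: grad_\<gamma>_def X_field_def Y_field_def weighted_def vec_eq_iff prod_eq_iff inner_prod_def inner_axis)
  have "((\<lambda>t. f (fst w, t)) has_derivative (\<lambda>v. g \<bullet> (0, v))) (at (snd w))"
    using f by (intro has_derivative_compose[of "\<lambda>t. (fst w, t)" "\<lambda>v. (0, v)" _ UNIV f "\<lambda>v. g \<bullet> v"])
      (auto intro!: derivative_eq_intros)
  then have "((\<lambda>t. f (fst w, t)) has_real_derivative snd g) (at (snd w))"
    by (simp add: has_field_derivative_def inner_prod_def)
  then show "deriv (\<lambda>t. f (fst w, t)) (snd w) = snd g" by (rule DERIV_imp_deriv)
qed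

lemma weighted_adjoint: "weighted \<gamma> z v \<bullet> w = v \<bullet> weighted \<gamma> z w"
  by (simp add: weighted_def inner_prod_def)

lemma integral_mollifier_grad_0:
  fixes e :: "'e::euclidean_space"
  assumes r: "0 < r"
  shows "(LINT y|lborel. mollifier_grad r (w - y) \<bullet> e) = 0"
proof -
  obtain B where B: "\<And>w::'e. norm (mollifier_grad r w) \<le> B" using bounded_mollifier_grad[OF r] by blast
  have "\<bar>mollifier_grad r w \<bullet> e\<bar> \<le> B * norm e" for w
    using Cauchy_Schwarz_ineq2[of "mollifier_grad r w" e] mult_right_mono[OF B[of w], of "norm e"] by simp
  then have "(LINT y|lborel. mollifier_grad r y \<bullet> e) = 0"
    by (intro integral_directional_derivative_eq_0[OF integrable_mollifier[OF r] _ DERIV_along_line[OF has_derivative_mollifier], where r=r])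
       (auto simp: mollifier_outside[OF r])
  then show ?thesis using integral_lborel_reflect[of "\<lambda>y. mollifier_grad r y \<bullet> e" w] by simp
qed

section \<open>Space-time integrability of solutions\<close>
lemma borel_measurable_fst' [measurable (raw)]:
  fixes f :: "'a \<Rightarrow> 'b::euclidean_space \<times> 'c::euclidean_space"
  assumes "f \<in> borel_measurable M"
  shows "(\<lambda>x. fst (f x)) \<in> borel_measurable M" "(\<lambda>x. snd (f x)) \<in> borel_measurable M"
  using assms by (auto intro!: borel_measurable_continuous_on[where f=fst] borel_measurable_continuous_on[where f=snd] continuous_intros)

lemma borel_measurable_weighted [measurable (raw)]:
  fixes f g :: "'a \<Rightarrow> ('m::finite, 'k::finite) gpoint"
  assumes [measurable]: "f \<in> borel_measurable M" "g \<in> borel_measurable M"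
  shows "(\<lambda>x. weighted \<gamma> (f x) (g x)) \<in> borel_measurable M"
  unfolding weighted_def by (intro borel_measurable_Pair borel_measurable_scaleR) measurable

lemma borel_measurable_potential [measurable]:
  "(potential \<gamma> p R :: ('m::finite, 'k::finite) gpoint \<Rightarrow> real) \<in> borel_measurable borel"
  unfolding potential_def[abs_def] by measurable

lemma borel_measurable_kernel_test [measurable]:
  fixes w0 :: "('m::finite, 'k::finite) gpoint \<times> real"
  shows "kernel_test s r w0 \<in> borel_measurable borel" "kernel_test_grad s r w0 \<in> borel_measurable borel"
  unfolding kernel_test_def[abs_def] kernel_test_grad_def[abs_def]
  by (intro borel_measurable_times borel_measurable_diff borel_measurable_scaleR borel_measurable_Pair; measurable)+

lemma continuous_into_L1_bounded:
  assumes u: "continuous_into_L1 u \<Omega> T" and t: "0 < t1" "t2 < T"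
  obtains S where "\<And>t. t \<in> {t1..t2} \<Longrightarrow> (LINT z:\<Omega>|lebesgue. \<bar>u t z\<bar>) \<le> S"
proof -
  let ?F = "\<lambda>t. LINT z:\<Omega>|lebesgue. \<bar>u t z\<bar>"
  have i: "set_integrable lebesgue \<Omega> (u t)" if "t \<in> {0..<T}" for t
    using u that by (simp add: continuous_into_L1_def)
  have l: "((\<lambda>s. LINT z:\<Omega>|lebesgue. \<bar>u s z - u t z\<bar>) \<longlongrightarrow> 0) (at t within {0..<T})" if "t \<in> {0..<T}" for t
    using u that by (simp add: continuous_into_L1_def)
  have "(?F \<longlongrightarrow> ?F t) (at t within {0..<T})" if t: "t \<in> {0..<T}" for t
  proof (rule LIM_zero_cancel, rule Lim_null_comparison[OF _ l[OF t]])
    show "\<forall>\<^sub>F s in at t within {0..<T}. norm (?F s - ?F t) \<le> (LINT z:\<Omega>|lebesgue. \<bar>u s z - u t z\<bar>)"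
      unfolding eventually_at_filter
    proof (rule always_eventually, intro allI impI)
      fix s assume s: "s \<in> {0..<T}"
      have d: "set_integrable lebesgue \<Omega> (\<lambda>z. \<bar>u s z - u t z\<bar>)"
        by (intro set_integrable_abs set_integral_diff i s t)
      have 1: "?F s \<le> ?F t + (LINT z:\<Omega>|lebesgue. \<bar>u s z - u t z\<bar>)"
        by (subst set_integral_add(2)[symmetric], intro set_integrable_abs i t, rule d, intro set_integral_mono)
           (auto intro!: set_integrable_abs i s t d set_integral_add)
      have 2: "?F t \<le> ?F s + (LINT z:\<Omega>|lebesgue. \<bar>u s z - u t z\<bar>)"
        by (subst set_integral_add(2)[symmetric], intro set_integrable_abs i s, rule d, intro set_integral_mono)
           (auto intro!: set_integrable_abs i s t d set_integral_add)
      show "norm (?F s - ?F t) \<le> (LINT z:\<Omega>|lebesgue. \<bar>u s z - u t z\<bar>)" using 1 2 by simp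
    qed
  qed
  then have "continuous_on {0..<T} ?F" by (simp add: continuous_on_def)
  then have "continuous_on {t1..t2} ?F" by (rule continuous_on_subset) (use t in auto)
  then have "bounded (?F ` {t1..t2})" by (intro compact_imp_bounded compact_continuous_image) auto
  then obtain S where "\<forall>y \<in> ?F ` {t1..t2}. norm y \<le> S" unfolding bounded_iff by blast
  then show ?thesis by (intro that[of S]) (simp add: abs_le_iff)
qed

lemma locally_integrable_imp_set_borel_measurable:
  fixes f :: "'a::euclidean_space \<Rightarrow> real"
  assumes f: "locally_integrable_on f W" and W: "open W"
  shows "(\<lambda>w. indicator W w * f w) \<in> borel_measurable lebesgue"
proof -
  obtain C where C: "\<And>n. compact (C n)" "\<And>n. C n \<subseteq> W" "\<And>n. C n \<subseteq> interior (C (Suc n))" "\<Union>(range C) = W"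
    using open_Union_compact_subsets[OF W] by metis
  have mono: "C n \<subseteq> C m" if "n \<le> m" for n m :: nat
    using C(3) interior_subset by (intro lift_Suc_mono_le[of C, OF _ that]) blast
  show ?thesis
  proof (rule borel_measurable_LIMSEQ_real)
    show "(\<lambda>w. indicator (C n) w *\<^sub>R f w) \<in> borel_measurable lebesgue" for n
      using f C(1,2) unfolding locally_integrable_on_def set_integrable_def by (blast intro: borel_measurable_integrable)
    fix w
    show "(\<lambda>n. indicator (C n) w *\<^sub>R f w) \<longlonglongrightarrow> indicator W w * f w"
    proof (cases "w \<in> W")
      case True
      then obtain n0 where n0: "w \<in> C n0" using C(4) by blast
      have "\<forall>\<^sub>F n in sequentially. indicator W w * f w = indicator (C n) w *\<^sub>R f w"
        using eventually_ge_at_top[of n0] by eventually_elim (use mono n0 True in \<open>auto simp: indicator_def\<close>)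
      then show ?thesis by (rule Lim_transform_eventually[OF tendsto_const])
    next
      case False
      then have "w \<notin> C n" for n using C(2) by blast
      then show ?thesis using False by simp
    qed
  qed
qed

text \<open>The norm of \<open>u t\<close> in \<open>L\<^sup>1\<close> is continuous in \<open>t\<close>, hence bounded on a compact interval, and Tonelli's theorem
  applies to a Borel representative of \<open>u\<close>. That representative agrees with \<open>u t\<close> almost everywhere for almost every
  \<open>t\<close> only, because the exceptional null set lives in space-time.\<close>
lemma spacetime_integral_finite:
  fixes u :: "real \<Rightarrow> 'a::euclidean_space \<Rightarrow> real"
  assumes u: "continuous_into_L1 u \<Omega> T" and li: "locally_integrable_on (st u) (\<Omega> \<times> {0<..<T})"
    and \<Omega>: "open \<Omega>" and t: "0 < t1" "t2 < T"
  shows "(\<integral>\<^sup>+w. ennreal (indicator (\<Omega> \<times> {t1..t2}) w * \<bar>st u w\<bar>) \<partial>lebesgue) < \<infinity>"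
proof -
  let ?W = "\<Omega> \<times> {0<..<T}"
  have [measurable]: "\<Omega> \<in> sets borel" using \<Omega> by simp
  then have [measurable]: "\<Omega> \<times> {t1..t2} \<in> sets borel" by (intro borel_Times) auto
  have "open ?W" using \<Omega> by (intro open_Times) auto
  from ex_borel_version[OF locally_integrable_imp_set_borel_measurable[OF li this]]
  obtain U where U: "U \<in> borel_measurable borel" "AE w in lebesgue. indicator ?W w * st u w = U w"
    by blast
  note [measurable] = U(1)
  obtain S where S: "\<And>t. t \<in> {t1..t2} \<Longrightarrow> (LINT z:\<Omega>|lebesgue. \<bar>u t z\<bar>) \<le> S"
    using continuous_into_L1_bounded[OF u t] by blast
  have "AE w in lborel. indicator ?W w * st u w = U w" using U(2) by (simp add: AE_completion_iff)
  then obtain N where N: "N \<in> null_sets lborel" "{w. indicator ?W w * st u w \<noteq> U w} \<subseteq> N"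
    unfolding eventually_ae_filter by auto
  have offN: "indicator ?W w * st u w = U w" if "w \<notin> N" for w using N(2) that by blast
  have [measurable]: "N \<in> sets borel" using N(1) by auto
  have "(\<integral>\<^sup>+w. indicator N w \<partial>lborel) = 0" using null_setsD1[OF N(1)] by simp
  also have "(\<integral>\<^sup>+w. indicator N w \<partial>lborel) = (\<integral>\<^sup>+s. \<integral>\<^sup>+z. indicator N (z, s) \<partial>lborel \<partial>lborel)"
    by (subst lborel_prod[symmetric], subst lborel_pair.nn_integral_snd[symmetric]) (auto simp: lborel_prod)
  finally have "AE s in lborel. (\<integral>\<^sup>+z. indicator N (z, s) \<partial>lborel) = 0"
    by (subst (asm) nn_integral_0_iff_AE) (auto simp: lborel_prod)
  then have ae: "AE s in lborel. AE z in lborel. (z, s) \<notin> N"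
  proof eventually_elim
    case (elim s)
    then show ?case by (subst (asm) nn_integral_0_iff_AE) (auto simp: indicator_def elim!: eventually_mono)
  qed
  have "(\<integral>\<^sup>+w. ennreal (indicator (\<Omega> \<times> {t1..t2}) w * \<bar>st u w\<bar>) \<partial>lebesgue)
      = (\<integral>\<^sup>+w. ennreal (indicator (\<Omega> \<times> {t1..t2}) w * \<bar>U w\<bar>) \<partial>lebesgue)"
  proof (rule nn_integral_cong_AE)
    show "AE w in lebesgue. ennreal (indicator (\<Omega> \<times> {t1..t2}) w * \<bar>st u w\<bar>) = ennreal (indicator (\<Omega> \<times> {t1..t2}) w * \<bar>U w\<bar>)"
      using U(2)
    proof eventually_elim
      case (elim w)
      show ?case
      proof (cases "w \<in> \<Omega> \<times> {t1..t2}")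
        case True
        then have "w \<in> ?W" using t by (cases w) auto
        then show ?thesis using elim by simp
      qed simp
    qed
  qed
  also have "\<dots> = (\<integral>\<^sup>+w. ennreal (indicator (\<Omega> \<times> {t1..t2}) w * \<bar>U w\<bar>) \<partial>lborel)" by (rule nn_integral_completion)
  also have "\<dots> = (\<integral>\<^sup>+s. \<integral>\<^sup>+z. ennreal (indicator (\<Omega> \<times> {t1..t2}) (z, s) * \<bar>U (z, s)\<bar>) \<partial>lborel \<partial>lborel)"
    by (subst lborel_prod[symmetric], subst lborel_pair.nn_integral_snd[symmetric]) (auto simp: lborel_prod)
  also have "\<dots> \<le> (\<integral>\<^sup>+s. ennreal S * indicator {t1..t2} s \<partial>lborel)"
  proof (rule nn_integral_mono_AE)
    show "AE s in lborel. (\<integral>\<^sup>+z. ennreal (indicator (\<Omega> \<times> {t1..t2}) (z, s) * \<bar>U (z, s)\<bar>) \<partial>lborel) \<le> ennreal S * indicator {t1..t2} s"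
      using ae
    proof eventually_elim
      case (elim s)
      show ?case
      proof (cases "s \<in> {t1..t2}")
        case True
        have i: "integrable lebesgue (\<lambda>z. indicator \<Omega> z *\<^sub>R \<bar>u s z\<bar>)"
        proof -
          have "set_integrable lebesgue \<Omega> (u s)" using u True t by (auto simp: continuous_into_L1_def)
          from set_integrable_abs[OF this] show ?thesis by (simp add: set_integrable_def)
        qed
        have "AE z in lebesgue. (z, s) \<notin> N" using elim by (rule AE_completion)
        then have "(\<integral>\<^sup>+z. ennreal (indicator (\<Omega> \<times> {t1..t2}) (z, s) * \<bar>U (z, s)\<bar>) \<partial>lebesgue)
          = (\<integral>\<^sup>+z. ennreal (indicator \<Omega> z *\<^sub>R \<bar>u s z\<bar>) \<partial>lebesgue)"
        proof (intro nn_integral_cong_AE, eventually_elim)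
          case (elim z)
          then have "indicator ?W (z, s) * u s z = U (z, s)" using offN[of "(z, s)"] by simp
          then show ?case using True t by (auto simp: indicator_def)
        qed
        also have "\<dots> = ennreal (LINT z:\<Omega>|lebesgue. \<bar>u s z\<bar>)"
          unfolding set_lebesgue_integral_def by (rule nn_integral_eq_integral[OF i]) (auto simp: indicator_def)
        also have "\<dots> \<le> ennreal S" by (rule ennreal_leI[OF S[OF True]])
        finally show ?thesis using True by (simp add: nn_integral_completion)
      next
        case False
        then have "indicator (\<Omega> \<times> {t1..t2}) (z, s) = (0 :: real)" for z by auto
        then show ?thesis by simp
      qed
    qed
  qed
  also have "\<dots> < \<infinity>" using emeasure_bounded_finite[of "{t1..t2}"] by (simp add: nn_integral_cmult ennreal_mult_less_top)
  finally show ?thesis .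
qed

section \<open>From distributional solutions to the chain rule\<close>
lemma set_integral_lebesgue_eq_lborel:
  fixes X Y :: "'a::euclidean_space \<Rightarrow> 'b::euclidean_space"
  assumes Y: "Y \<in> borel_measurable borel" and ae: "AE w in lebesgue. w \<in> W \<longrightarrow> X w = Y w"
    and out: "\<And>w. w \<notin> W \<Longrightarrow> Y w = 0"
  shows "(LINT w:W|lebesgue. X w) = (LINT w|lborel. Y w)"
  unfolding set_lebesgue_integral_def
proof (rule integral_lebesgue_eq_lborel[OF Y])
  show "AE w in lebesgue. indicator W w *\<^sub>R X w = Y w"
    using ae by eventually_elim (use out in \<open>auto simp: indicator_def\<close>)
qed

text \<open>The equation tested with \<open>\<zeta> u\<^sup>1\<^sup>-\<^sup>p\<close>. On a compact neighbourhood \<open>K1\<close> of \<open>K0\<close> inside \<open>W\<close> and away from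
  \<open>x = 0\<close> the matrix of the structure is bounded and invertible, so \<open>D\<close> is the Euclidean gradient of \<open>u\<close> and \<open>H\<close> the
  Euclidean flux. All functions are replaced by Borel representatives cut off outside \<open>K1\<close>, which mollification does not
  notice at points of \<open>K0\<close> when the radius is small.\<close>
lemma solution_chain_rule:
  fixes \<gamma> p q c lam R T :: real and u :: "real \<Rightarrow> ('m::finite, 'k::finite) gpoint \<Rightarrow> real"
    and G :: "('m, 'k) gpoint \<times> real \<Rightarrow> ('m, 'k) gpoint"
    and \<zeta> \<zeta>t :: "('m, 'k) gpoint \<times> real \<Rightarrow> real" and \<zeta>x :: "('m, 'k) gpoint \<times> real \<Rightarrow> ('m, 'k) gpoint"
  defines "W \<equiv> rho_ball \<gamma> R \<times> {0<..<T}"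
  assumes \<gamma>: "0 \<le> \<gamma>" and p: "1 < p" "p < 2" and q: "0 < q"
    and li: "locally_integrable_on (st u) W" and pos: "AE w in lebesgue. w \<in> W \<longrightarrow> 0 < st u w"
    and eb: "ess_locally_bounded_on (st u) W" "ess_locally_bounded_on (\<lambda>w. 1 / st u w) W"
    and grad: "distr_grad_\<gamma> \<gamma> u G W" and Lp: "Lp_loc_on p G W" and sol: "distr_solution \<gamma> p q c lam R u G W"
    and K0: "compact K0" "K0 \<noteq> {}" "K0 \<subseteq> W" "\<And>w. w \<in> K0 \<Longrightarrow> fst (fst w) \<noteq> 0"
    and \<zeta>m[measurable]: "\<zeta> \<in> borel_measurable borel" "\<zeta>x \<in> borel_measurable borel" "\<zeta>t \<in> borel_measurable borel"
    and \<zeta>b: "bounded (range \<zeta>)" "bounded (range \<zeta>x)" "bounded (range \<zeta>t)"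
    and \<zeta>0: "\<And>w. w \<notin> K0 \<Longrightarrow> \<zeta> w = 0" "\<And>w. w \<notin> K0 \<Longrightarrow> \<zeta>x w = 0" "\<And>w. w \<notin> K0 \<Longrightarrow> \<zeta>t w = 0"
    and dx: "\<And>w b. b \<in> Basis \<Longrightarrow> ((\<lambda>t. \<zeta> (w + t *\<^sub>R (b, 0))) has_real_derivative \<zeta>x w \<bullet> b) (at 0)"
    and dt: "\<And>w. ((\<lambda>t. \<zeta> (w + t *\<^sub>R (0, 1))) has_real_derivative \<zeta>t w) (at 0)"
  obtains U D H f G' where "U \<in> borel_measurable borel" "\<forall>w. 0 < U w" "AE w in lebesgue. w \<in> K0 \<longrightarrow> st u w = U w"
    "\<forall>w\<in>K0. D w = (fst (G' w), norm (fst (fst w)) powr (- \<gamma>) *\<^sub>R snd (G' w))"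
    "\<forall>w\<in>K0. H w = norm (G' w) powr (p - 2) *\<^sub>R weighted \<gamma> (fst w) (G' w)"
    "\<forall>w\<in>K0. f w = c * potential \<gamma> p R (fst w) * U w powr (p - 1) + lam * U w powr q"
    "integrable lborel (\<lambda>w. U w powr (1 - p) * (\<zeta>x w \<bullet> H w))"
    "integrable lborel (\<lambda>w. (1 - p) * U w powr (- p) * (\<zeta> w * (H w \<bullet> D w)))"
    "integrable lborel (\<lambda>w. U w powr (1 - p) * (\<zeta> w * f w))"
    "integrable lborel (\<lambda>w. U w powr (2 - p) / (2 - p) * \<zeta>t w)"
    "(LINT w|lborel. U w powr (2 - p) / (2 - p) * \<zeta>t w) =
       (LINT w|lborel. U w powr (1 - p) * (\<zeta>x w \<bullet> H w)) + (LINT w|lborel. (1 - p) * U w powr (- p) * (\<zeta> w * (H w \<bullet> D w)))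
       - (LINT w|lborel. U w powr (1 - p) * (\<zeta> w * f w))"
proof -
  let ?X = "\<lambda>w :: ('m, 'k) gpoint \<times> real. fst (fst w)"
  let ?W' = "W \<inter> {w. ?X w \<noteq> 0}"
  have "open (rho_ball \<gamma> R :: ('m, 'k) gpoint set)"
    unfolding rho_ball_def by (intro open_Collect_less continuous_intros continuous_on_rho \<gamma>)
  then have "open W" unfolding W_def by (intro open_Times) auto
  moreover have "open {w :: ('m, 'k) gpoint \<times> real. ?X w \<noteq> 0}" by (intro open_Collect_neq continuous_intros)
  ultimately have oW': "open ?W'" by (rule open_Int)
  have "K0 \<subseteq> ?W'" using K0(3,4) by blast
  from compact_in_open_separated[OF K0(2,1) oW' this]
  obtain r0 where r0: "0 < r0" "{w. infdist w K0 \<le> r0} \<subseteq> ?W'" by blast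
  define K1 where "K1 = {w. infdist w K0 \<le> r0}"
  have K1: "compact K1" "K1 \<subseteq> W" "\<And>w. w \<in> K1 \<Longrightarrow> ?X w \<noteq> 0"
    using compact_infdist_le[OF K0(2,1) r0(1)] r0(2) by (auto simp: K1_def)
  have cb: "cball w0 r \<subseteq> K1" if "w0 \<in> K0" "r \<le> r0" for w0 r
  proof
    fix w assume "w \<in> cball w0 r"
    then have "dist w w0 \<le> r0" using that(2) by (simp add: dist_commute)
    then show "w \<in> K1" unfolding K1_def using infdist_le2[OF that(1), of w r0] by simp
  qed
  have K01: "K0 \<subseteq> K1" using r0(1) by (auto simp: K1_def)
  have [measurable]: "K1 \<in> sets borel" using K1(1) by (intro borel_closed compact_imp_closed)
  obtain \<rho> where \<rho>: "\<And>w. w \<in> K1 \<Longrightarrow> norm w \<le> \<rho>"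
    using compact_imp_bounded[OF K1(1)] by (auto simp: bounded_iff)
  have K1\<rho>: "w \<notin> K1" if "\<rho> < norm w" for w using \<rho>[of w] that by (meson not_less)
  have K0\<rho>: "w \<notin> K0" if "\<rho> < norm w" for w using K1\<rho>[OF that] K01 by blast
  have kb: "\<exists>B\<ge>0. \<forall>w\<in>K1. norm (h w) \<le> B" if "continuous_on K1 h" for h :: "('m, 'k) gpoint \<times> real \<Rightarrow> 'b::real_normed_vector"
  proof -
    have "bounded (h ` K1)" using that K1(1) by (intro compact_imp_bounded compact_continuous_image)
    then obtain B where "\<forall>x\<in>h ` K1. norm x \<le> B" unfolding bounded_iff by blast
    then show ?thesis by (intro exI[of _ "max B 0"]) (auto simp: le_max_iff_disj)
  qed

  obtain C1 where C1: "AE w in lebesgue. w \<in> K1 \<longrightarrow> \<bar>st u w\<bar> \<le> C1"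
    using eb(1) K1 unfolding ess_locally_bounded_on_def by blast
  obtain C2 where C2: "AE w in lebesgue. w \<in> K1 \<longrightarrow> \<bar>1 / st u w\<bar> \<le> C2"
    using eb(2) K1 unfolding ess_locally_bounded_on_def by blast
  \<comment> \<open>The maximum with \<open>1\<close> guards against a bound \<open>C2\<close> that is not positive, as for a null set \<open>K1\<close>.\<close>
  define c0 where "c0 = 1 / max C2 1"
  define M where "M = max C1 0"
  have c0: "0 < c0" by (simp add: c0_def)
  have M: "0 \<le> M" by (simp add: M_def)
  have bnd: "AE w in lebesgue. w \<in> K1 \<longrightarrow> c0 \<le> st u w \<and> st u w \<le> c0 + M"
    using C1 C2 pos
  proof eventually_elim
    case (elim w)
    show ?case
    proof
      assume w: "w \<in> K1"
      then have e: "\<bar>st u w\<bar> \<le> C1" "\<bar>1 / st u w\<bar> \<le> C2" "0 < st u w" using elim K1(2) by auto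
      have "1 / st u w \<le> max C2 1" using e(2) by linarith
      then have "1 / max C2 1 \<le> st u w" using e(3) by (simp add: divide_le_eq mult.commute)
      then have "c0 \<le> st u w" by (simp add: c0_def)
      moreover have "C1 \<le> M" by (simp add: M_def)
      ultimately show "c0 \<le> st u w \<and> st u w \<le> c0 + M" using e(1) c0 by linarith
    qed
  qed
  have "(\<lambda>w. indicator K1 w *\<^sub>R st u w) \<in> borel_measurable lebesgue"
    using li K1 unfolding locally_integrable_on_def set_integrable_def by (blast intro: borel_measurable_integrable)
  from ex_borel_version[OF this] obtain U0 where U0 [measurable]: "U0 \<in> borel_measurable borel"
    and U0': "AE w in lebesgue. indicator K1 w *\<^sub>R st u w = U0 w" by blast
  have "(\<lambda>w. indicator K1 w *\<^sub>R G w) \<in> borel_measurable lebesgue"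
    using Lp K1 unfolding Lp_loc_on_def set_borel_measurable_def by blast
  from ex_borel_version[OF this] obtain G0 where G0 [measurable]: "G0 \<in> borel_measurable borel"
    and G0': "AE w in lebesgue. indicator K1 w *\<^sub>R G w = G0 w" by blast
  \<comment> \<open>Subtracting the lower bound \<open>c0\<close> before cutting off keeps \<open>c0 + v\<close>, and all its mollifications, in \<open>[c0, c0 + M]\<close>.\<close>
  define v where "v w = (if w \<in> K1 then min M (max 0 (U0 w - c0)) else 0)" for w
  define U where "U w = c0 + v w" for w
  define G' where "G' w = (if w \<in> K1 then G0 w else 0)" for w
  have [measurable]: "v \<in> borel_measurable borel" unfolding v_def[abs_def] by measurable
  have [measurable]: "U \<in> borel_measurable borel" unfolding U_def[abs_def] by measurable
  have [measurable]: "G' \<in> borel_measurable borel" unfolding G'_def[abs_def] by measurable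
  have v: "0 \<le> v w" "v w \<le> M" for w using M by (auto simp: v_def)
  have vi: "integrable lborel v"
  proof (rule integrable_bounded_support[where \<rho>=\<rho>])
    have "norm (v w) \<le> M" for w using v[of w] by simp
    then show "bounded (range v)" unfolding bounded_iff by blast
    show "v w = 0" if "\<rho> < norm w" for w using K1\<rho>[OF that] by (simp add: v_def)
  qed measurable
  have Upos: "0 < U w" "c0 \<le> U w" "U w \<le> c0 + M" for w using v[of w] c0 by (auto simp: U_def)
  have Uae: "AE w in lebesgue. w \<in> K1 \<longrightarrow> st u w = U w"
    using U0' bnd by eventually_elim (auto simp: U_def v_def min_def max_def)
  have Gae: "AE w in lebesgue. w \<in> K1 \<longrightarrow> G w = G' w"
    using G0' by eventually_elim (auto simp: G'_def)
  have Gp: "integrable lborel (\<lambda>w. norm (G' w) powr p)"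
  proof -
    have "integrable lebesgue (\<lambda>w. indicator K1 w *\<^sub>R norm (G w) powr p)"
      using Lp K1 unfolding Lp_loc_on_def set_integrable_def by blast
    moreover have "AE w in lebesgue. indicator K1 w *\<^sub>R norm (G w) powr p = norm (G' w) powr p"
      using Gae by eventually_elim (auto simp: G'_def indicator_def)
    moreover have m: "(\<lambda>w. norm (G' w) powr p) \<in> borel_measurable lborel" by measurable
    ultimately have "integrable lebesgue (\<lambda>w. norm (G' w) powr p)"
      using integrable_cong_AE_imp measurable_completion[OF m] by blast
    then show ?thesis using integrable_completion[OF m] by blast
  qed

  have xc: "continuous_on K1 (\<lambda>w. norm (?X w))" by (intro continuous_intros)
  have x0: "norm (?X w) \<noteq> 0" if "w \<in> K1" for w using K1(3)[OF that] by simp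
  have powc: "continuous_on K1 (\<lambda>w. norm (?X w) powr e)" for e
    by (intro continuous_on_powr xc continuous_on_const ballI) (use x0 in auto)
  have rpc: "continuous_on K1 (\<lambda>w. rpow (norm (?X w)) \<gamma>)"
    using powc[of \<gamma>] by (cases "\<gamma> = 0") (simp_all add: rpow_def)
  obtain B1 where B1: "0 \<le> B1" "\<And>w. w \<in> K1 \<Longrightarrow> norm (?X w) powr (- \<gamma>) \<le> B1"
    using kb[OF powc[of "- \<gamma>"]] unfolding real_norm_def by (meson abs_le_D1)
  obtain B2 where B2: "0 \<le> B2" "\<And>w. w \<in> K1 \<Longrightarrow> rpow (norm (?X w)) \<gamma> \<le> B2"
    using kb[OF rpc] unfolding real_norm_def by (meson abs_le_D1)
  have rp: "rho \<gamma> (fst w) < R" "0 < rho \<gamma> (fst w)" if "w \<in> K1" for w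
  proof -
    show "rho \<gamma> (fst w) < R" using that K1(2) by (auto simp: W_def rho_ball_def)
    show "0 < rho \<gamma> (fst w)" using norm_fst_le_rho[OF \<gamma>, of "fst w"] K1(3)[OF that] by (meson less_le_trans zero_less_norm_iff)
  qed
  have rc: "continuous_on K1 (\<lambda>w. rho \<gamma> (fst w))"
    by (rule continuous_on_compose2[OF continuous_on_rho[OF \<gamma>, of UNIV]]) (auto intro!: continuous_intros)
  obtain B3 where B3: "0 \<le> B3" "\<And>w. w \<in> K1 \<Longrightarrow> \<bar>potential \<gamma> p R (fst w)\<bar> \<le> B3"
  proof -
    have c1: "continuous_on K1 (\<lambda>w. rpow (norm (?X w)) (\<gamma> * p))"
      using powc[of "\<gamma> * p"] by (cases "\<gamma> * p = 0") (auto simp: rpow_def)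
    have "continuous_on K1 (\<lambda>w. rho \<gamma> (fst w) powr (\<gamma> * p))"
      by (intro continuous_on_powr rc continuous_on_const ballI) (use rp in force)
    then have c2: "continuous_on K1 (\<lambda>w. rpow (rho \<gamma> (fst w)) (\<gamma> * p))"
      by (cases "\<gamma> * p = 0") (auto simp: rpow_def)
    have c3: "continuous_on K1 (\<lambda>w. (R - rho \<gamma> (fst w)) powr p)"
      by (intro continuous_on_powr continuous_on_diff rc continuous_on_const ballI) (use rp in force)
    have "(R - rho \<gamma> (fst w)) powr p * rpow (rho \<gamma> (fst w)) (\<gamma> * p) \<noteq> 0" if "w \<in> K1" for w
      using rp[OF that] by (auto simp: rpow_def)
    then have "continuous_on K1 (\<lambda>w. potential \<gamma> p R (fst w))"
      unfolding potential_def by (intro continuous_on_divide continuous_on_mult c1 c2 c3) auto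
    from kb[OF this] show ?thesis using that by auto
  qed

  define D where "D w = (fst (G' w), norm (?X w) powr (- \<gamma>) *\<^sub>R snd (G' w))" for w
  define H where "H w = norm (G' w) powr (p - 2) *\<^sub>R weighted \<gamma> (fst w) (G' w)" for w
  define f where "f w = (if w \<in> K1 then c * potential \<gamma> p R (fst w) * U w powr (p - 1) + lam * U w powr q else 0)" for w
  have [measurable]: "D \<in> borel_measurable borel" unfolding D_def[abs_def] by (intro borel_measurable_Pair) measurable
  have [measurable]: "H \<in> borel_measurable borel" unfolding H_def[abs_def] by measurable
  have [measurable]: "f \<in> borel_measurable borel" unfolding f_def[abs_def] by measurable
  have wb: "norm (weighted \<gamma> (fst w) X) \<le> (1 + B2) * norm X" if "w \<in> K1" for w X
  proof -
    have "norm (weighted \<gamma> (fst w) X) \<le> norm (fst X) + rpow (norm (?X w)) \<gamma> * norm (snd X)"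
      using norm_Pair_le[of "fst X" "rpow (norm (?X w)) \<gamma> *\<^sub>R snd X"]
      by (simp add: weighted_def abs_of_nonneg rpow_def split: if_splits)
    also have "\<dots> \<le> norm X + B2 * norm X"
      using B2(2)[OF that] B2(1) norm_fst_le[of "fst X" "snd X"] norm_snd_le[of "snd X" "fst X"]
      by (intro add_mono mult_mono) auto
    finally show ?thesis by (simp add: algebra_simps)
  qed
  have Db: "norm (D w) \<le> (1 + B1) * norm (G' w)" for w
  proof (cases "w \<in> K1")
    case True
    have "norm (D w) \<le> norm (fst (G' w)) + norm (?X w) powr (- \<gamma>) * norm (snd (G' w))"
      using norm_Pair_le[of "fst (G' w)" "norm (?X w) powr (- \<gamma>) *\<^sub>R snd (G' w)"] by (simp add: D_def)
    also have "\<dots> \<le> norm (G' w) + B1 * norm (G' w)"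
      using B1(2)[OF True] B1(1) norm_fst_le[of "fst (G' w)" "snd (G' w)"] norm_snd_le[of "snd (G' w)" "fst (G' w)"]
      by (intro add_mono mult_mono) auto
    finally show ?thesis by (simp add: algebra_simps)
  qed (simp add: D_def G'_def)
  have Hb: "norm (H w) \<le> (1 + B2) * norm (G' w) powr (p - 1)" for w
  proof (cases "w \<in> K1 \<and> G' w \<noteq> 0")
    case True
    have "norm (H w) \<le> norm (G' w) powr (p - 2) * ((1 + B2) * norm (G' w))"
      unfolding H_def using wb[of w "G' w"] True by (simp add: mult_left_mono)
    also have "norm (G' w) powr (p - 2) * ((1 + B2) * norm (G' w)) = (1 + B2) * (norm (G' w) powr (p - 2) * norm (G' w) powr 1)"
      by simp
    also have "norm (G' w) powr (p - 2) * norm (G' w) powr 1 = norm (G' w) powr (p - 1)"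
      unfolding powr_add[symmetric] by simp
    finally show ?thesis .
  next
    case False
    then have "G' w = 0" by (auto simp: G'_def)
    then show ?thesis by (simp add: H_def weighted_def flip: zero_prod_def)
  qed
  let ?p' = "p / (p - 1)"
  have s: "1 < p" "1 < ?p'" "1 / p + 1 / ?p' = 1" using p by (auto simp: field_simps)
  have K1i: "integrable lborel (\<lambda>w. indicator K1 w :: real)"
    using emeasure_bounded_finite[OF compact_imp_bounded[OF K1(1)]] by (intro integrable_real_indicator) auto
  have dom: "integrable lborel X" if "X \<in> borel_measurable borel" "\<And>w. norm (X w) \<le> C * (indicator K1 w + norm (G' w) powr p)"
    for X :: "('m, 'k) gpoint \<times> real \<Rightarrow> 'b::euclidean_space" and C :: real
    by (rule Bochner_Integration.integrable_bound[of _ "\<lambda>w. C * (indicator K1 w + norm (G' w) powr p)"])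
       (use that K1i Gp in \<open>auto intro!: AE_I2 order_trans[OF that(2) abs_ge_self]\<close>)
  have pw: "norm (G' w) powr e \<le> indicator K1 w + norm (G' w) powr p" if "0 < e" "e \<le> p" for e w
  proof (cases "w \<in> K1")
    case True
    show ?thesis
    proof (cases "norm (G' w) \<le> 1")
      case True
      then have "norm (G' w) powr e \<le> 1" using that by (intro powr_le1) auto
      then show ?thesis using \<open>w \<in> K1\<close> by (simp add: add_increasing2)
    next
      case False
      then have "norm (G' w) powr e \<le> norm (G' w) powr p" using that by (intro powr_mono) auto
      then show ?thesis by (simp add: add_increasing)
    qed
  qed (simp add: G'_def)
  have Di: "integrable lborel D"
  proof (rule dom)
    fix w
    have "(1 + B1) * norm (G' w) \<le> (1 + B1) * (indicator K1 w + norm (G' w) powr p)"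
      using pw[of 1 w] p B1(1) by (intro mult_left_mono) auto
    then show "norm (D w) \<le> (1 + B1) * (indicator K1 w + norm (G' w) powr p)" using Db[of w] by linarith
  qed measurable
  have Hi: "integrable lborel H"
  proof (rule dom)
    fix w
    have "(1 + B2) * norm (G' w) powr (p - 1) \<le> (1 + B2) * (indicator K1 w + norm (G' w) powr p)"
      using pw[of "p - 1" w] p B2(1) by (intro mult_left_mono) auto
    then show "norm (H w) \<le> (1 + B2) * (indicator K1 w + norm (G' w) powr p)" using Hb[of w] by linarith
  qed measurable
  have Dp: "integrable lborel (\<lambda>w. norm (D w) powr p)"
  proof (rule dom)
    fix w
    have "norm (D w) powr p \<le> ((1 + B1) * norm (G' w)) powr p" using Db p by (intro powr_mono2) auto
    also have "\<dots> = (1 + B1) powr p * norm (G' w) powr p" using B1(1) by (simp add: powr_mult)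
    also have "\<dots> \<le> (1 + B1) powr p * (indicator K1 w + norm (G' w) powr p)" by (intro mult_left_mono) auto
    finally show "norm (norm (D w) powr p) \<le> (1 + B1) powr p * (indicator K1 w + norm (G' w) powr p)" by simp
  qed measurable
  have Hp: "integrable lborel (\<lambda>w. norm (H w) powr ?p')"
  proof (rule dom)
    fix w
    have "norm (H w) powr ?p' \<le> ((1 + B2) * norm (G' w) powr (p - 1)) powr ?p'" using Hb p by (intro powr_mono2) auto
    also have "\<dots> = (1 + B2) powr ?p' * norm (G' w) powr p" using B2(1) p by (simp add: powr_mult powr_powr)
    also have "\<dots> \<le> (1 + B2) powr ?p' * (indicator K1 w + norm (G' w) powr p)" by (intro mult_left_mono) auto
    finally show "norm (norm (H w) powr ?p') \<le> (1 + B2) powr ?p' * (indicator K1 w + norm (G' w) powr p)" by simp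
  qed measurable
  have fi: "integrable lborel f"
  proof (rule integrable_bounded_support[where \<rho>=\<rho>])
    have "\<bar>f w\<bar> \<le> \<bar>c\<bar> * B3 * (c0 + M) powr (p - 1) + \<bar>lam\<bar> * (c0 + M) powr q" for w
    proof (cases "w \<in> K1")
      case True
      have "U w powr (p - 1) \<le> (c0 + M) powr (p - 1)" "U w powr q \<le> (c0 + M) powr q"
        using Upos[of w] p q by (auto intro!: powr_mono2)
      then have "\<bar>c * potential \<gamma> p R (fst w) * U w powr (p - 1)\<bar> \<le> \<bar>c\<bar> * B3 * (c0 + M) powr (p - 1)"
        "\<bar>lam * U w powr q\<bar> \<le> \<bar>lam\<bar> * (c0 + M) powr q"
        unfolding abs_mult using B3(2)[OF True] B3(1) by (auto intro!: mult_mono)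
      then show ?thesis using True unfolding f_def by (simp add: order_trans[OF abs_triangle_ineq add_mono])
    qed (use B3(1) in \<open>simp add: f_def\<close>)
    then show "bounded (range f)" unfolding bounded_iff by (metis UNIV_I imageE real_norm_def)
    show "f w = 0" if "\<rho> < norm w" for w using K1\<rho>[OF that] by (simp add: f_def)
  qed measurable

  have mg_out: "mollifier r (w0 - w) = 0" "mollifier_grad r (w0 - w) = 0" if "w \<notin> cball w0 r" "0 < r"
    for r and w w0 :: "('m, 'k) gpoint \<times> real"
    using mollifier_outside[OF that(2), of "w0 - w"] mollifier_grad_outside[OF that(2), of "w0 - w"] that(1)
    by (simp_all add: dist_norm)
  \<comment> \<open>Adding the constant \<open>c0\<close> to \<open>v\<close> changes nothing, as the gradient of the mollifier has integral \<open>0\<close>.\<close>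
  have convU: "conv (\<lambda>z. mollifier_grad r z \<bullet> e) v w0 = (LINT w|lborel. U w * (mollifier_grad r (w0 - w) \<bullet> e))"
    if r: "0 < r" for r e w0
  proof -
    obtain B where B: "\<And>w::('m, 'k) gpoint \<times> real. norm (mollifier_grad r w) \<le> B" using bounded_mollifier_grad[OF r] by blast
    have kB: "norm (mollifier_grad r w \<bullet> e) \<le> B * norm e" for w
      using Cauchy_Schwarz_ineq2[of "mollifier_grad r w" e] mult_right_mono[OF B[of w], of "norm e"] by simp
    have i1: "integrable lborel (\<lambda>w. (mollifier_grad r (w0 - w) \<bullet> e) *\<^sub>R v w)"
      by (rule integrable_bounded_kernel(1)[where k="\<lambda>z. mollifier_grad r z \<bullet> e", OF _ vi kB]) measurable
    have "integrable lborel (\<lambda>w. mollifier_grad r w \<bullet> e)"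
    proof (rule integrable_bounded_support[where \<rho>=r])
      show "bounded (range (\<lambda>w. mollifier_grad r w \<bullet> e))" using kB unfolding bounded_iff by blast
      show "mollifier_grad r w \<bullet> e = 0" if "r < norm w" for w
        using mollifier_grad_outside[OF r, of w] that by simp
    qed measurable
    then have i2: "integrable lborel (\<lambda>w. mollifier_grad r (w0 - w) \<bullet> e)"
      by (subst integrable_lborel_reflect[of "\<lambda>w. mollifier_grad r w \<bullet> e"]) auto
    have "(LINT w|lborel. U w * (mollifier_grad r (w0 - w) \<bullet> e)) =
        (LINT w|lborel. c0 * (mollifier_grad r (w0 - w) \<bullet> e) + (mollifier_grad r (w0 - w) \<bullet> e) *\<^sub>R v w)"
      by (intro Bochner_Integration.integral_cong) (auto simp: U_def algebra_simps)
    also have "\<dots> = c0 * (LINT w|lborel. mollifier_grad r (w0 - w) \<bullet> e) + conv (\<lambda>z. mollifier_grad r z \<bullet> e) v w0"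
      unfolding conv_def using i1 i2 by (subst Bochner_Integration.integral_add) auto
    finally show ?thesis using integral_mollifier_grad_0[OF r, of w0 e] by simp
  qed
  have dpsi: "grad_\<gamma> \<gamma> (\<lambda>z. kernel_test e r w0 (z, snd w)) (fst w) = weighted \<gamma> (fst w) (fst (kernel_test_grad e r w0 w))"
    "deriv (\<lambda>t. kernel_test e r w0 (fst w, t)) (snd w) = snd (kernel_test_grad e r w0 w)"
    if "cball w0 r \<subseteq> K1" "0 < r" for e r w0 w
  proof -
    have "?X w \<noteq> 0 \<or> w \<notin> cball w0 r" using that(1) K1(3) by blast
    from slice_derivatives[OF has_derivative_kernel_test[OF this that(2)]]
    show "grad_\<gamma> \<gamma> (\<lambda>z. kernel_test e r w0 (z, snd w)) (fst w) = weighted \<gamma> (fst w) (fst (kernel_test_grad e r w0 w))"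
      "deriv (\<lambda>t. kernel_test e r w0 (fst w, t)) (snd w) = snd (kernel_test_grad e r w0 w)" by auto
  qed
  \<comment> \<open>Outside the ball around \<open>w0\<close> every integrand below vanishes, so only the almost everywhere identities on \<open>K1\<close> enter.\<close>
  have out: "kernel_test e r w0 w = 0" "kernel_test_grad e r w0 w = 0" if "w \<notin> cball w0 r" "0 < r"
    for e r and w0 w :: "('m, 'k) gpoint \<times> real"
    using mg_out[OF that] by (simp_all add: kernel_test_def kernel_test_grad_def flip: zero_prod_def)
  have w_zero: "weighted \<gamma> z 0 = 0" for z :: "('m, 'k) gpoint" by (simp add: weighted_def flip: zero_prod_def)

  have wkgrad: "conv (\<lambda>z. mollifier_grad r z \<bullet> (b, 0)) v w0 = conv (mollifier r) D w0 \<bullet> b"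
    if r: "0 < r" "r < r0" and w0: "w0 \<in> K0" and b: "b \<in> Basis" for r w0 b
  proof -
    have cK: "cball w0 r \<subseteq> K1" using cb[OF w0] r by simp
    then have cW: "cball w0 r \<subseteq> W" using K1(2) by blast
    \<comment> \<open>Derivatives in \<open>x\<close> are tested with the mollifier, derivatives in \<open>y\<close> with \<open>|x|\<^sup>-\<^sup>\<gamma>\<close> times it.\<close>
    define e where "e = (if snd b = 0 then 0 else - \<gamma>)"
    let ?\<psi> = "kernel_test e r w0" and ?g = "kernel_test_grad e r w0"
    have "?\<psi> \<in> test_functions W" using kernel_test_mem[OF r(1) cW] cK K1(3) by blast
    then have E: "(LINT w:W|lebesgue. st u w *\<^sub>R grad_\<gamma> \<gamma> (\<lambda>z. ?\<psi> (z, snd w)) (fst w)) = - (LINT w:W|lebesgue. ?\<psi> w *\<^sub>R G w)"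
      using grad unfolding distr_grad_\<gamma>_def by blast
    have L: "(LINT w:W|lebesgue. st u w *\<^sub>R grad_\<gamma> \<gamma> (\<lambda>z. ?\<psi> (z, snd w)) (fst w)) = (LINT w|lborel. U w *\<^sub>R weighted \<gamma> (fst w) (fst (?g w)))"
    proof (rule set_integral_lebesgue_eq_lborel)
      show "AE w in lebesgue. w \<in> W \<longrightarrow> st u w *\<^sub>R grad_\<gamma> \<gamma> (\<lambda>z. ?\<psi> (z, snd w)) (fst w) = U w *\<^sub>R weighted \<gamma> (fst w) (fst (?g w))"
        using Uae
      proof eventually_elim
        case (elim w)
        show ?case
          using elim cK out(2)[of w w0 r e] r(1) by (cases "w \<in> cball w0 r") (auto simp: dpsi[OF cK r(1)] w_zero)
      qed
      show "U w *\<^sub>R weighted \<gamma> (fst w) (fst (?g w)) = 0" if "w \<notin> W" for w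
      proof -
        have "w \<notin> cball w0 r" using that cW by blast
        then show ?thesis using out(2)[of w w0 r e] r(1) by (simp add: w_zero)
      qed
    qed measurable
    have Rr: "(LINT w:W|lebesgue. ?\<psi> w *\<^sub>R G w) = (LINT w|lborel. ?\<psi> w *\<^sub>R G' w)"
    proof (rule set_integral_lebesgue_eq_lborel)
      show "AE w in lebesgue. w \<in> W \<longrightarrow> ?\<psi> w *\<^sub>R G w = ?\<psi> w *\<^sub>R G' w"
        using Gae
      proof eventually_elim
        case (elim w)
        show ?case using elim cK out(1)[of w w0 r e] r(1) by (cases "w \<in> cball w0 r") auto
      qed
      show "?\<psi> w *\<^sub>R G' w = 0" if "w \<notin> W" for w
      proof -
        have "w \<notin> cball w0 r" using that cW by blast
        then show ?thesis using out(1)[of w w0 r e] r(1) by simp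
      qed
    qed measurable
    have mc: "continuous_on K1 (\<lambda>w. mollifier r (w0 - w))" "continuous_on K1 (\<lambda>w. mollifier_grad r (w0 - w))"
      by (rule continuous_on_compose2[OF continuous_on_mollifier[of UNIV]], auto intro!: continuous_intros)
         (rule continuous_on_compose2[OF continuous_on_mollifier_grad[of UNIV]], auto intro!: continuous_intros)
    have gc: "continuous_on K1 (\<lambda>w. weighted \<gamma> (fst w) (fst (?g w)))"
      unfolding weighted_def kernel_test_grad_def
      by (intro continuous_on_Pair continuous_on_scaleR continuous_on_fst continuous_on_snd continuous_on_diff continuous_on_mult
          continuous_on_const continuous_on_id mc powc rpc)
    obtain Bg where Bg: "0 \<le> Bg" "\<And>w. w \<in> K1 \<Longrightarrow> norm (weighted \<gamma> (fst w) (fst (?g w))) \<le> Bg" using kb[OF gc] by auto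
    have iL: "integrable lborel (\<lambda>w. U w *\<^sub>R weighted \<gamma> (fst w) (fst (?g w)))"
    proof (rule integrable_bounded_support[where \<rho>=\<rho>])
      have "norm (U w *\<^sub>R weighted \<gamma> (fst w) (fst (?g w))) \<le> (c0 + M) * Bg" for w
      proof (cases "w \<in> K1")
        case True
        then show ?thesis using Upos[of w] Bg(2)[OF True] by (simp add: mult_mono)
      next
        case False
        then have "w \<notin> cball w0 r" using cK by blast
        then show ?thesis using out(2)[of w w0 r e] r(1) c0 M Bg(1) by (simp add: w_zero)
      qed
      then show "bounded (range (\<lambda>w. U w *\<^sub>R weighted \<gamma> (fst w) (fst (?g w))))" unfolding bounded_iff by blast
      show "U w *\<^sub>R weighted \<gamma> (fst w) (fst (?g w)) = 0" if "\<rho> < norm w" for w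
      proof -
        have "w \<notin> cball w0 r" using K1\<rho>[OF that] cK by blast
        then show ?thesis using out(2)[of w w0 r e] r(1) by (simp add: w_zero)
      qed
    qed measurable
    have psic: "continuous_on K1 ?\<psi>" unfolding kernel_test_def[abs_def] by (intro continuous_on_mult powc mc)
    obtain Bp where Bp: "0 \<le> Bp" "\<And>w. w \<in> K1 \<Longrightarrow> norm (?\<psi> w) \<le> Bp" using kb[OF psic] by auto
    have iR: "integrable lborel (\<lambda>w. ?\<psi> w *\<^sub>R G' w)"
    proof (rule dom)
      fix w
      show "norm (?\<psi> w *\<^sub>R G' w) \<le> Bp * (indicator K1 w + norm (G' w) powr p)"
      proof (cases "w \<in> K1")
        case True
        then show ?thesis using pw[of 1 w] p Bp by (simp add: mult_mono)
      qed (simp add: G'_def)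
    qed measurable
    have bs: "(snd b = 0 \<and> e = 0) \<or> (fst b = 0 \<and> e = - \<gamma>)"
      using b by (auto simp: Basis_prod_def e_def)
    have pL: "(U w *\<^sub>R weighted \<gamma> (fst w) (fst (?g w))) \<bullet> b = - (U w * (mollifier_grad r (w0 - w) \<bullet> (b, 0)))" for w
    proof (cases "w \<in> cball w0 r")
      case True
      then have x: "?X w \<noteq> 0" using cK K1(3) by blast
      have "rpow (norm (?X w)) \<gamma> * norm (?X w) powr (- \<gamma>) = 1"
        using x by (auto simp: rpow_def powr_minus)
      then show ?thesis using bs x
        by (auto simp: weighted_def kernel_test_grad_def inner_prod_def simp flip: mult.assoc)
    next
      case False
      then show ?thesis using out(2)[OF False r(1)] mg_out[OF False r(1)] by (simp add: w_zero)
    qed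
    have pR: "(?\<psi> w *\<^sub>R G' w) \<bullet> b = (mollifier r (w0 - w) *\<^sub>R D w) \<bullet> b" for w
    proof (cases "w \<in> cball w0 r")
      case True
      then have "?X w \<noteq> 0" using cK K1(3) by blast
      then show ?thesis using bs by (auto simp: kernel_test_def D_def inner_prod_def)
    next
      case False
      then show ?thesis using out(1)[OF False r(1)] mg_out[OF False r(1)] by simp
    qed
    have "(LINT w|lborel. U w *\<^sub>R weighted \<gamma> (fst w) (fst (?g w))) \<bullet> b = - (LINT w|lborel. ?\<psi> w *\<^sub>R G' w) \<bullet> b"
      using E unfolding L Rr by simp
    then have "(LINT w|lborel. (U w *\<^sub>R weighted \<gamma> (fst w) (fst (?g w))) \<bullet> b) = - (LINT w|lborel. (?\<psi> w *\<^sub>R G' w) \<bullet> b)"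
      unfolding integral_inner_left[OF iL] integral_inner_left[OF iR] by (simp only: inner_minus_left)
    then have "(LINT w|lborel. U w * (mollifier_grad r (w0 - w) \<bullet> (b, 0))) = (LINT w|lborel. (mollifier r (w0 - w) *\<^sub>R D w) \<bullet> b)"
      unfolding pL pR by simp
    moreover obtain Bk where "\<And>w::('m, 'k) gpoint \<times> real. norm (mollifier r w) \<le> Bk" using bounded_mollifier[OF r(1)] by blast
    then have "integrable lborel (\<lambda>w. mollifier r (w0 - w) *\<^sub>R D w)"
      by (intro integrable_bounded_kernel(1)[OF _ Di]) auto
    ultimately show ?thesis unfolding convU[OF r(1)] by (simp only: conv_def integral_inner_left)
  qed

  have wkeq: "conv (\<lambda>z. mollifier_grad r z \<bullet> (0, 1)) v w0 =
      (LINT y|lborel. fst (mollifier_grad r (w0 - y)) \<bullet> H y) + conv (mollifier r) f w0"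
    if r: "0 < r" "r < r0" and w0: "w0 \<in> K0" for r w0
  proof -
    have cK: "cball w0 r \<subseteq> K1" using cb[OF w0] r by simp
    then have cW: "cball w0 r \<subseteq> W" using K1(2) by blast
    let ?\<psi> = "kernel_test 0 r w0" and ?g = "kernel_test_grad 0 r w0"
    have g: "?g w = - mollifier_grad r (w0 - w)" "?\<psi> w = mollifier r (w0 - w)" for w
    proof -
      have "?X w \<noteq> 0 \<or> w \<notin> cball w0 r" using cK K1(3) by blast
      then show "?g w = - mollifier_grad r (w0 - w)" "?\<psi> w = mollifier r (w0 - w)"
        using mg_out[of w w0 r] r(1) by (auto simp: kernel_test_grad_def kernel_test_def simp flip: zero_prod_def)
    qed
    have d: "deriv (\<lambda>t. ?\<psi> (fst w, t)) (snd w) = - (mollifier_grad r (w0 - w) \<bullet> (0, 1))"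
      "grad_\<gamma> \<gamma> (\<lambda>z. ?\<psi> (z, snd w)) (fst w) = weighted \<gamma> (fst w) (- fst (mollifier_grad r (w0 - w)))" for w
      unfolding dpsi[OF cK r(1)] g(1) by (simp_all add: inner_prod_def)
    have "?\<psi> \<in> test_functions W" using kernel_test_mem[OF r(1) cW] cK K1(3) by blast
    then have E: "- (LINT w:W|lebesgue. st u w * deriv (\<lambda>t. ?\<psi> (fst w, t)) (snd w)) =
        - (LINT w:W|lebesgue. (norm (G w) powr (p - 2) *\<^sub>R G w) \<bullet> grad_\<gamma> \<gamma> (\<lambda>z. ?\<psi> (z, snd w)) (fst w))
        + (LINT w:W|lebesgue. (c * potential \<gamma> p R (fst w) * st u w powr (p - 1) + lam * st u w powr q) * ?\<psi> w)"
      using sol unfolding distr_solution_def by blast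
    have 1: "(LINT w:W|lebesgue. st u w * deriv (\<lambda>t. ?\<psi> (fst w, t)) (snd w)) = (LINT w|lborel. - (U w * (mollifier_grad r (w0 - w) \<bullet> (0, 1))))"
    proof (rule set_integral_lebesgue_eq_lborel)
      show "AE w in lebesgue. w \<in> W \<longrightarrow> st u w * deriv (\<lambda>t. ?\<psi> (fst w, t)) (snd w) = - (U w * (mollifier_grad r (w0 - w) \<bullet> (0, 1)))"
        using Uae
      proof eventually_elim
        case (elim w)
        show ?case
        proof (cases "w \<in> cball w0 r")
          case True
          then have "st u w = U w" using elim cK by blast
          then show ?thesis unfolding d by simp
        next
          case False
          then show ?thesis unfolding d using mg_out[OF False r(1)] by simp
        qed
      qed
      show "- (U w * (mollifier_grad r (w0 - w) \<bullet> (0, 1))) = 0" if "w \<notin> W" for w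
      proof -
        have "w \<notin> cball w0 r" using that cW by blast
        then show ?thesis using mg_out[of w w0 r] r(1) by simp
      qed
    qed measurable
    have 2: "(LINT w:W|lebesgue. (norm (G w) powr (p - 2) *\<^sub>R G w) \<bullet> grad_\<gamma> \<gamma> (\<lambda>z. ?\<psi> (z, snd w)) (fst w)) =
        (LINT w|lborel. - (fst (mollifier_grad r (w0 - w)) \<bullet> H w))"
    proof (rule set_integral_lebesgue_eq_lborel)
      have a: "(norm (G' w) powr (p - 2) *\<^sub>R G' w) \<bullet> weighted \<gamma> (fst w) (- fst (mollifier_grad r (w0 - w))) = - (fst (mollifier_grad r (w0 - w)) \<bullet> H w)" for w
      proof -
        have "weighted \<gamma> z (- x) = - weighted \<gamma> z x" for z x :: "('m, 'k) gpoint" by (simp add: weighted_def prod_eq_iff)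
        moreover have "G' w \<bullet> weighted \<gamma> (fst w) x = x \<bullet> weighted \<gamma> (fst w) (G' w)" for x
          by (metis weighted_adjoint inner_commute)
        ultimately show ?thesis by (simp add: H_def)
      qed
      show "AE w in lebesgue. w \<in> W \<longrightarrow> (norm (G w) powr (p - 2) *\<^sub>R G w) \<bullet> grad_\<gamma> \<gamma> (\<lambda>z. ?\<psi> (z, snd w)) (fst w) = - (fst (mollifier_grad r (w0 - w)) \<bullet> H w)"
        using Gae
      proof eventually_elim
        case (elim w)
        show ?case
        proof (cases "w \<in> cball w0 r")
          case True
          then have "G w = G' w" using elim cK by blast
          then show ?thesis using a[of w] by (simp only: d simp_thms)
        next
          case False
          then show ?thesis unfolding d using mg_out[OF False r(1)] by (simp add: w_zero)
        qed
      qed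
      show "- (fst (mollifier_grad r (w0 - w)) \<bullet> H w) = 0" if "w \<notin> W" for w
      proof -
        have "w \<notin> cball w0 r" using that cW by blast
        then show ?thesis using mg_out[of w w0 r] r(1) by simp
      qed
    qed measurable
    have 3: "(LINT w:W|lebesgue. (c * potential \<gamma> p R (fst w) * st u w powr (p - 1) + lam * st u w powr q) * ?\<psi> w) =
        (LINT w|lborel. mollifier r (w0 - w) *\<^sub>R f w)"
    proof (rule set_integral_lebesgue_eq_lborel)
      show "AE w in lebesgue. w \<in> W \<longrightarrow> (c * potential \<gamma> p R (fst w) * st u w powr (p - 1) + lam * st u w powr q) * ?\<psi> w = mollifier r (w0 - w) *\<^sub>R f w"
        using Uae
      proof eventually_elim
        case (elim w)
        show ?case
        proof (cases "w \<in> cball w0 r")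
          case True
          then have "w \<in> K1" "st u w = U w" using elim cK by blast+
          then show ?thesis by (simp add: g f_def)
        next
          case False
          then show ?thesis using mg_out[OF False r(1)] by (simp add: g)
        qed
      qed
      show "mollifier r (w0 - w) *\<^sub>R f w = 0" if "w \<notin> W" for w
      proof -
        have "w \<notin> cball w0 r" using that cW by blast
        then show ?thesis using mg_out[of w w0 r] r(1) by simp
      qed
    qed measurable
    show ?thesis using E unfolding 1 2 3 convU[OF r(1)] by (simp add: conv_def)
  qed

  have \<zeta>\<rho>: "\<And>w. norm w > \<rho> \<Longrightarrow> \<zeta> w = 0" "\<And>w. norm w > \<rho> \<Longrightarrow> \<zeta>x w = 0" "\<And>w. norm w > \<rho> \<Longrightarrow> \<zeta>t w = 0"
    using \<zeta>0 K0\<rho> by blast+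
  have dF: "((\<lambda>x. x powr (1 - p)) has_real_derivative (1 - p) * x powr (- p)) (at x)"
    "((\<lambda>x. x powr (2 - p) / (2 - p)) has_real_derivative x powr (1 - p)) (at x)" if "c0 \<le> x" for x
  proof -
    have x: "0 < x" using that c0 by linarith
    show "((\<lambda>x. x powr (1 - p)) has_real_derivative (1 - p) * x powr (- p)) (at x)"
      using has_real_derivative_powr[OF x, of "1 - p"] by simp
    show "((\<lambda>x. x powr (2 - p) / (2 - p)) has_real_derivative x powr (1 - p)) (at x)"
      using DERIV_cdivide[OF has_real_derivative_powr[OF x, of "2 - p"], of "2 - p"] p by simp
  qed
  have F'c: "continuous_on {c0..c0 + M} (\<lambda>x. (1 - p) * x powr (- p))"
    using c0 by (intro continuous_intros ballI) auto
  have \<zeta>K: "w \<in> K0" if "\<zeta> w \<noteq> 0" for w using \<zeta>0(1) that by blast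
  have id: "(LINT w|lborel. (c0 + v w) powr (2 - p) / (2 - p) * \<zeta>t w) =
       (LINT w|lborel. (c0 + v w) powr (1 - p) * (\<zeta>x w \<bullet> H w)) + (LINT w|lborel. (1 - p) * (c0 + v w) powr (- p) * (\<zeta> w * (H w \<bullet> D w)))
       - (LINT w|lborel. (c0 + v w) powr (1 - p) * (\<zeta> w * f w))"
    by (rule weak_chain_rule[where F="\<lambda>x. x powr (1 - p)" and F'="\<lambda>x. (1 - p) * x powr (- p)" and Fh="\<lambda>x. x powr (2 - p) / (2 - p)",
          OF r0(1) s vi v Di Dp Hi Hp fi \<zeta>m \<zeta>b \<zeta>\<rho> dx dt wkgrad wkeq dF F'c])
       (auto intro: \<zeta>K)

  have Ub: "bounded (range (\<lambda>w. U w powr e))" for e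
  proof -
    have "continuous_on {c0..c0 + M} (\<lambda>x. x powr e)" using c0 by (intro continuous_intros ballI) auto
    then have "bounded ((\<lambda>x. x powr e) ` {c0..c0 + M})" by (intro compact_imp_bounded compact_continuous_image) auto
    then show ?thesis by (rule bounded_subset) (use Upos in auto)
  qed
  have bm: "integrable lborel (\<lambda>w. g w * X w)" if "integrable lborel X" "g \<in> borel_measurable borel" and gb: "bounded (range g)"
    for X g :: "('m, 'k) gpoint \<times> real \<Rightarrow> real"
  proof -
    from gb obtain B where B: "\<And>w. \<bar>g w\<bar> \<le> B" unfolding bounded_iff by auto
    show ?thesis
      by (rule Bochner_Integration.integrable_bound[OF integrable_mult_right[OF that(1), of B]])
         (use that B in \<open>auto simp: abs_mult intro!: AE_I2 mult_mono order_trans[OF B abs_ge_self]\<close>)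
  qed
  have i1: "integrable lborel (\<lambda>w. \<zeta>x w \<bullet> H w)"
  proof -
    obtain B where B: "\<And>w. norm (\<zeta>x w) \<le> B" using \<zeta>b(2) by (auto simp: bounded_iff)
    show ?thesis
    proof (rule Bochner_Integration.integrable_bound)
      show "integrable lborel (\<lambda>w. B * norm (H w))" using Hi by auto
      show "AE w in lborel. norm (\<zeta>x w \<bullet> H w) \<le> norm (B * norm (H w))"
        using B by (intro AE_I2) (auto intro!: order_trans[OF Cauchy_Schwarz_ineq2] order_trans[OF _ abs_ge_self] mult_right_mono)
    qed measurable
  qed
  have i2: "integrable lborel (\<lambda>w. H w \<bullet> D w)"
  proof (rule Bochner_Integration.integrable_bound)
    show "integrable lborel (\<lambda>w. norm (D w) powr p + norm (H w) powr ?p')" using Dp Hp by auto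
    show "AE w in lborel. norm (H w \<bullet> D w) \<le> norm (norm (D w) powr p + norm (H w) powr ?p')"
    proof (rule AE_I2)
      fix w
      show "norm (H w \<bullet> D w) \<le> norm (norm (D w) powr p + norm (H w) powr ?p')"
        using Cauchy_Schwarz_ineq2[of "H w" "D w"] weighted_Young[of "norm (D w)" "norm (H w)" 1, OF _ _ _ s]
        by (simp add: mult.commute)
    qed
  qed measurable
  have i4: "integrable lborel \<zeta>t" by (rule integrable_bounded_support[OF _ \<zeta>b(3) \<zeta>\<rho>(3)]) auto
  show ?thesis
  proof (rule that[of U D G' H f])
    show "integrable lborel (\<lambda>w. U w powr (1 - p) * (\<zeta>x w \<bullet> H w))" by (rule bm[OF i1 _ Ub]) measurable
    show "integrable lborel (\<lambda>w. (1 - p) * U w powr (- p) * (\<zeta> w * (H w \<bullet> D w)))"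
    proof -
      have "integrable lborel (\<lambda>w. (1 - p) * (U w powr (- p) * (\<zeta> w * (H w \<bullet> D w))))"
        by (intro integrable_mult_right bm[OF bm[OF i2 _ \<zeta>b(1)] _ Ub]) auto
      then show ?thesis by (simp add: mult.assoc)
    qed
    show "integrable lborel (\<lambda>w. U w powr (1 - p) * (\<zeta> w * f w))" by (intro bm[OF bm[OF fi _ \<zeta>b(1)] _ Ub]) auto
    show "integrable lborel (\<lambda>w. U w powr (2 - p) / (2 - p) * \<zeta>t w)"
    proof -
      have "integrable lborel (\<lambda>w. 1 / (2 - p) * (U w powr (2 - p) * \<zeta>t w))"
        by (intro integrable_mult_right bm[OF i4 _ Ub]) auto
      then show ?thesis by simp
    qed
    show "AE w in lebesgue. w \<in> K0 \<longrightarrow> st u w = U w" using Uae by eventually_elim (use K01 in auto)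
    show "\<forall>w\<in>K0. f w = c * potential \<gamma> p R (fst w) * U w powr (p - 1) + lam * U w powr q"
      using K01 unfolding f_def by auto
    show "\<forall>w. 0 < U w" using Upos(1) by blast
    show "\<forall>w\<in>K0. D w = (fst (G' w), norm (fst (fst w)) powr (- \<gamma>) *\<^sub>R snd (G' w))" unfolding D_def by blast
    show "\<forall>w\<in>K0. H w = norm (G' w) powr (p - 2) *\<^sub>R weighted \<gamma> (fst w) (G' w)" unfolding H_def by blast
  qed (use id in \<open>simp_all only: U_def, measurable\<close>)
qed

section \<open>Nonexistence\<close>
lemma
  fixes g :: "'a::euclidean_space \<Rightarrow> real" and h :: "'b::euclidean_space \<Rightarrow> real"
  assumes g: "integrable lborel g" and h: "integrable lborel h"
  shows integrable_lborel_tensor: "integrable lborel (\<lambda>w. h (snd w) * g (fst w))"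
    and integral_lborel_tensor: "(LINT w|lborel. h (snd w) * g (fst w)) = (LINT y|lborel. h y) * (LINT x|lborel. g x)"
proof -
  have [measurable]: "g \<in> borel_measurable borel" "h \<in> borel_measurable borel" using g h by auto
  have i: "integrable (lborel \<Otimes>\<^sub>M lborel) (\<lambda>(x, y). h y * g x)"
  proof (rule lborel_pair.Fubini_integrable)
    have "(\<lambda>x. LINT y|lborel. norm (h y * g x)) = (\<lambda>x. (LINT y|lborel. \<bar>h y\<bar>) * \<bar>g x\<bar>)"
      by (simp add: abs_mult)
    then show "integrable lborel (\<lambda>x. LINT y|lborel. norm (case (x, y) of (x, y) \<Rightarrow> h y * g x))" using g by simp
    show "AE x in lborel. integrable lborel (\<lambda>y. case (x, y) of (x, y) \<Rightarrow> h y * g x)" using h by simp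
  qed measurable
  then show "integrable lborel (\<lambda>w. h (snd w) * g (fst w))" by (simp add: lborel_prod case_prod_unfold)
  have "(LINT w|lborel. h (snd w) * g (fst w)) = (LINT x|lborel. LINT y|lborel. h y * g x)"
    using lborel_pair.integral_fst'[OF i] by (simp add: lborel_prod case_prod_unfold)
  then show "(LINT w|lborel. h (snd w) * g (fst w)) = (LINT y|lborel. h y) * (LINT x|lborel. g x)" by simp
qed

text \<open>A cutoff of class \<open>C\<^sup>1\<close> on the middle half of \<open>(0, T)\<close>; the bound \<open>T\<^sup>4 + 2 T\<^sup>3\<close> covers the function and
  its derivative at once.\<close>
lemma time_cutoff:
  fixes T :: real
  assumes T: "0 < T"
  defines "m \<equiv> \<lambda>t. max 0 ((t - T / 4) * (3 * T / 4 - t))"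
  defines "\<eta> \<equiv> \<lambda>t. m t powr 2" and "\<eta>' \<equiv> \<lambda>t. 2 * m t * (T - 2 * t)"
  shows "(\<eta> has_real_derivative \<eta>' t) (at t)" and "0 \<le> \<eta> t" and "\<eta> t \<le> T ^ 4 + 2 * T ^ 3" and "\<bar>\<eta>' t\<bar> \<le> T ^ 4 + 2 * T ^ 3"
    and "t \<notin> {T / 4..3 * T / 4} \<Longrightarrow> \<eta> t = 0" and "t \<notin> {T / 4..3 * T / 4} \<Longrightarrow> \<eta>' t = 0"
    and "\<eta> \<in> borel_measurable borel" and "\<eta>' \<in> borel_measurable borel"
    and "integrable lborel \<eta>" and "0 < (LINT t|lborel. \<eta> t)"
proof -
  have [measurable]: "m \<in> borel_measurable borel" unfolding m_def by measurable
  show \<eta>m[measurable]: "\<eta> \<in> borel_measurable borel" unfolding \<eta>_def by measurable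
  show "\<eta>' \<in> borel_measurable borel" unfolding \<eta>'_def by measurable
  have "((\<lambda>t. (t - T / 4) * (3 * T / 4 - t)) has_real_derivative T - 2 * t) (at t)"
    by (auto intro!: derivative_eq_intros simp: algebra_simps)
  from DERIV_chain2[OF DERIV_max_powr[of 2] this]
  show "(\<eta> has_real_derivative \<eta>' t) (at t)" by (simp add: \<eta>_def \<eta>'_def m_def)
  have m0: "0 \<le> m t" for t by (simp add: m_def)
  have out: "m t = 0" if "t \<notin> {T / 4..3 * T / 4}" for t
  proof -
    have "(t - T / 4) * (3 * T / 4 - t) \<le> 0"
      using that T by (auto simp: mult_le_0_iff)
    then show ?thesis by (simp add: m_def)
  qed
  have mT: "m t \<le> T\<^sup>2" for t
  proof (cases "t \<in> {T / 4..3 * T / 4}")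
    case True
    then have "(t - T / 4) * (3 * T / 4 - t) \<le> T * T" using T by (intro mult_mono) auto
    then show ?thesis by (simp add: m_def power2_eq_square)
  qed (simp add: out)
  have \<eta>2: "\<eta> t = (m t)\<^sup>2" for t using m0[of t] by (simp add: \<eta>_def)
  show \<eta>0: "0 \<le> \<eta> t" for t by (simp add: \<eta>_def)
  have "\<eta> t \<le> (T\<^sup>2)\<^sup>2" for t unfolding \<eta>2 by (intro power_mono mT m0)
  moreover have "(T\<^sup>2)\<^sup>2 = T ^ 4" by simp
  ultimately show \<eta>E: "\<eta> t \<le> T ^ 4 + 2 * T ^ 3" for t using T zero_less_power[of T 3] by (smt (verit))
  show "\<bar>\<eta>' t\<bar> \<le> T ^ 4 + 2 * T ^ 3"
  proof (cases "t \<in> {T / 4..3 * T / 4}")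
    case True
    then have "\<bar>T - 2 * t\<bar> \<le> T" by auto
    then have "2 * m t * \<bar>T - 2 * t\<bar> \<le> 2 * T\<^sup>2 * T" using mT[of t] m0[of t] by (intro mult_mono) auto
    then have "\<bar>\<eta>' t\<bar> \<le> 2 * T ^ 3" using m0[of t] by (simp add: \<eta>'_def abs_mult power2_eq_square power3_eq_cube)
    then show ?thesis using zero_less_power[OF T, of 4] by linarith
  qed (use T in \<open>simp add: out \<eta>'_def\<close>)
  show \<eta>out: "\<eta> t = 0" if "t \<notin> {T / 4..3 * T / 4}" for t using out[OF that] by (simp add: \<eta>_def)
  show "\<eta>' t = 0" if "t \<notin> {T / 4..3 * T / 4}" using out[OF that] by (simp add: \<eta>'_def)
  show \<eta>i: "integrable lborel \<eta>"
  proof (rule integrable_bounded_support[where \<rho>=T])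
    have "norm (\<eta> t) \<le> T ^ 4 + 2 * T ^ 3" for t using \<eta>0[of t] \<eta>E[of t] by simp
    then show "bounded (range \<eta>)" unfolding bounded_iff by blast
    show "\<eta> t = 0" if "T < norm t" for t using that T by (intro \<eta>out) auto
  qed measurable
  have "(LINT t|lborel. (T\<^sup>2 / 64)\<^sup>2 * indicator {3 * T / 8..5 * T / 8} t) \<le> (LINT t|lborel. \<eta> t)"
  proof (rule integral_mono[OF _ \<eta>i])
    show "integrable lborel (\<lambda>t. (T\<^sup>2 / 64)\<^sup>2 * indicator {3 * T / 8..5 * T / 8} t :: real)"
      using emeasure_bounded_finite[of "{3 * T / 8..5 * T / 8}"] by (intro integrable_mult_right integrable_real_indicator) auto
    show "(T\<^sup>2 / 64)\<^sup>2 * indicator {3 * T / 8..5 * T / 8} t \<le> \<eta> t" for t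
    proof (cases "t \<in> {3 * T / 8..5 * T / 8}")
      case True
      then have "T / 8 * (T / 8) \<le> (t - T / 4) * (3 * T / 4 - t)" using T by (intro mult_mono) auto
      then have "T\<^sup>2 / 64 \<le> m t" by (simp add: m_def power2_eq_square)
      then have "(T\<^sup>2 / 64)\<^sup>2 \<le> (m t)\<^sup>2" by (intro power_mono) auto
      then show ?thesis using True by (simp add: \<eta>2)
    qed (simp add: \<eta>0)
  qed
  moreover have "(LINT t|lborel. (T\<^sup>2 / 64)\<^sup>2 * indicator {3 * T / 8..5 * T / 8} t) = (T\<^sup>2 / 64)\<^sup>2 * (T / 4)"
    using T by simp
  moreover have "0 < (T\<^sup>2 / 64)\<^sup>2 * (T / 4)" using T by simp
  ultimately show "0 < (LINT t|lborel. \<eta> t)" by linarith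
qed

text \<open>Picone's inequality. Since \<open>H \<bullet> D = |G|\<^sup>p\<close> and \<open>e \<bullet> H \<le> |G|\<^sup>p\<^sup>-\<^sup>1 |\<nabla>\<^sub>\<gamma> \<phi>|\<close> for the Euclidean gradient
  \<open>e\<close> of \<open>\<phi>\<close>, the claim is the tangent inequality at the point \<open>|G| P / U\<close>.\<close>
lemma picone_pointwise:
  fixes z G e :: "('m::finite, 'k::finite) gpoint" and \<gamma> p U P :: real
  assumes p: "1 < p" and U: "0 < U" and P: "0 < P" and x: "fst z \<noteq> 0"
  defines "D \<equiv> (fst G, norm (fst z) powr (- \<gamma>) *\<^sub>R snd G)" and "H \<equiv> norm G powr (p - 2) *\<^sub>R weighted \<gamma> z G"
  shows "- (norm (weighted \<gamma> z e) powr p)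
    \<le> (p - 1) * U powr (- p) * (P powr p * (H \<bullet> D)) - U powr (1 - p) * ((p * P powr (p - 1)) * (e \<bullet> H))"
proof -
  let ?h = "norm (weighted \<gamma> z e)" and ?G = "norm G"
  have GG: "?G powr (p - 2) * (?G * X) = ?G powr (p - 1) * X" for X
  proof (cases "G = 0")
    case False
    have "?G powr (p - 2) * ?G powr 1 = ?G powr (p - 1)" unfolding powr_add[symmetric] by simp
    then have "?G powr (p - 2) * ?G = ?G powr (p - 1)" by simp
    then show ?thesis by (simp only: mult.assoc[symmetric])
  qed simp
  have "rpow (norm (fst z)) \<gamma> * norm (fst z) powr (- \<gamma>) = 1" using x by (auto simp: rpow_def powr_minus)
  then have "weighted \<gamma> z G \<bullet> D = G \<bullet> G"
    by (simp add: weighted_def D_def inner_prod_def mult.commute)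
  then have "H \<bullet> D = ?G powr (p - 2) * (?G * ?G)" by (simp add: H_def dot_square_norm power2_eq_square)
  also have "\<dots> = ?G powr (p - 1) * ?G powr 1" unfolding GG by simp
  also have "\<dots> = ?G powr p" unfolding powr_add[symmetric] by simp
  finally have HD: "H \<bullet> D = ?G powr p" .
  have "e \<bullet> H = ?G powr (p - 2) * (weighted \<gamma> z e \<bullet> G)" by (simp add: H_def weighted_adjoint)
  also have "\<dots> \<le> ?G powr (p - 2) * (?G * ?h)"
    using norm_cauchy_schwarz[of "weighted \<gamma> z e" G] by (intro mult_left_mono) (auto simp: mult.commute)
  finally have eH: "e \<bullet> H \<le> ?G powr (p - 1) * ?h" unfolding GG .
  let ?a = "?G * P / U"
  have a1: "?a powr (p - 1) = U powr (1 - p) * P powr (p - 1) * ?G powr (p - 1)"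
    using U P powr_minus_divide[of U "p - 1"] by (simp add: powr_mult powr_divide)
  have a2: "?a powr p = U powr (- p) * P powr p * ?G powr p"
    using U P by (simp add: powr_mult powr_divide powr_minus_divide)
  have "U powr (1 - p) * ((p * P powr (p - 1)) * (e \<bullet> H)) \<le> U powr (1 - p) * ((p * P powr (p - 1)) * (?G powr (p - 1) * ?h))"
    using p by (intro mult_left_mono eH) auto
  also have "\<dots> = p * ?a powr (p - 1) * ?h" unfolding a1 by simp
  also have "\<dots> \<le> (p - 1) * ?a powr p + ?h powr p"
    using p U P by (intro powr_tangent_le) auto
  also have "(p - 1) * ?a powr p = (p - 1) * U powr (- p) * (P powr p * (H \<bullet> D))" unfolding a2 HD by simp
  finally show ?thesis by simp
qed

lemma hardy_test_powr_le:
  fixes z :: "('m::finite, 'k::finite) gpoint"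
  assumes \<gamma>: "0 \<le> \<gamma>" and p: "1 < p" and \<epsilon>: "0 < \<epsilon>" and R: "0 < R"
  shows "hardy_test \<gamma> p R \<kappa> \<epsilon> z powr p \<le> (R\<^sup>2 * R powr ((p - 1) / p)) powr p"
proof (rule powr_mono2)
  show "hardy_test \<gamma> p R \<kappa> \<epsilon> z \<le> R\<^sup>2 * R powr ((p - 1) / p)"
  proof (cases "rho \<gamma> z < R - \<epsilon>")
    case True
    have "(norm (fst z))\<^sup>2 \<le> R\<^sup>2" using norm_fst_le_rho[OF \<gamma>, of z] True \<epsilon> by (intro power_mono) auto
    then have "(norm (fst z))\<^sup>2 - \<kappa>\<^sup>2 \<le> R\<^sup>2" using zero_le_power2[of \<kappa>] by linarith
    then have "axis_cutoff \<kappa> z \<le> R\<^sup>2" by (simp add: axis_cutoff_def)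
    moreover have "(R - rho \<gamma> z) powr ((p - 1) / p) \<le> R powr ((p - 1) / p)"
      using True \<epsilon> p rho_nonneg[of \<gamma> z] by (intro powr_mono2) auto
    then have "(R - rho \<gamma> z) powr ((p - 1) / p) - \<epsilon> powr ((p - 1) / p) \<le> R powr ((p - 1) / p)"
      using powr_ge_zero[of \<epsilon> "(p - 1) / p"] by linarith
    then have "hardy_profile \<gamma> p R \<epsilon> z \<le> R powr ((p - 1) / p)"
      using True by (simp add: hardy_profile_def)
    ultimately show ?thesis
      unfolding hardy_test_def using hardy_profile_nonneg[OF p \<epsilon>, of \<gamma> R z] by (intro mult_mono) auto
  qed (simp add: hardy_test_def hardy_profile_def)
  show "0 \<le> hardy_test \<gamma> p R \<kappa> \<epsilon> z" by (rule hardy_test_nonneg[OF p \<epsilon>])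
qed (use p in simp)

theorem corollary3p24:
  fixes \<gamma> p q c lam R Q :: real
    and u0 :: "('m::finite, 'k::finite) gpoint \<Rightarrow> real"
  assumes "0 \<le> \<gamma>"
    and "Q = hom_dim TYPE('m) TYPE('k) \<gamma>"
    and "1 < p"
    and "0 < R"
    and "p - 1 < q" and "q \<le> p - 1 + p / Q"
    and "2 * Q / (Q + 1) \<le> p" and "p < 2"
    and "((p - 1) / p) powr p < c"
    and "\<forall>z\<in>rho_ball \<gamma> R. 0 \<le> u0 z"
  shows "\<not> (\<exists>T u. general_positive_local_solution \<gamma> p q c lam R u0 T u)"
proof
  note \<gamma> = assms(1) and p = assms(3,8) and R = assms(4)
  assume "\<exists>T u. general_positive_local_solution \<gamma> p q c lam R u0 T u"
  then obtain T and u :: "real \<Rightarrow> ('m, 'k) gpoint \<Rightarrow> real" where "general_positive_local_solution \<gamma> p q c lam R u0 T u"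
    by blast
  note solution = this[unfolded general_positive_local_solution_def Let_def]
  define \<Omega> where "\<Omega> = (rho_ball \<gamma> R :: ('m, 'k) gpoint set)"
  from solution have T: "0 < T" and L1: "continuous_into_L1 u \<Omega> T"
    and li: "locally_integrable_on (st u) (rho_ball \<gamma> R \<times> {0<..<T})"
    and pos: "AE w in lebesgue. w \<in> rho_ball \<gamma> R \<times> {0<..<T} \<longrightarrow> 0 < st u w"
    and eb: "ess_locally_bounded_on (st u) (rho_ball \<gamma> R \<times> {0<..<T})"
      "ess_locally_bounded_on (\<lambda>w. 1 / st u w) (rho_ball \<gamma> R \<times> {0<..<T})"
    unfolding \<Omega>_def by blast+
  from solution obtain G where G: "distr_grad_\<gamma> \<gamma> u G (rho_ball \<gamma> R \<times> {0<..<T})" "Lp_loc_on p G (rho_ball \<gamma> R \<times> {0<..<T})"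
    "distr_solution \<gamma> p q c lam R u G (rho_ball \<gamma> R \<times> {0<..<T})" by blast
  have q: "0 < q" "0 < q - p + 1" "q - p + 1 \<le> 1"
  proof -
    have "1 \<le> real CARD('m)" "1 \<le> real CARD('k)" using zero_less_card_finite[where 'a='m] zero_less_card_finite[where 'a='k] by linarith+
    then have "1 + 1 * 1 \<le> Q" unfolding assms(2) hom_dim_def using \<gamma> by (intro add_mono mult_mono) auto
    then have "p / Q \<le> 1" using p by (simp add: divide_le_eq)
    then show "0 < q" "0 < q - p + 1" "q - p + 1 \<le> 1" using assms(5,6) p by linarith+
  qed
  define t1 where "t1 = T / 4"
  define t2 where "t2 = 3 * T / 4"
  have t: "0 < t1" "t2 < T" using T by (auto simp: t1_def t2_def)
  define \<eta> where "\<eta> t = max 0 ((t - T / 4) * (3 * T / 4 - t)) powr 2" for t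
  define \<eta>' where "\<eta>' t = 2 * max 0 ((t - T / 4) * (3 * T / 4 - t)) * (T - 2 * t)" for t
  define E where "E = T ^ 4 + 2 * T ^ 3"
  note \<eta> = time_cutoff[OF T, folded \<eta>_def \<eta>'_def E_def t1_def t2_def]
  have \<eta>m[measurable]: "\<eta> \<in> borel_measurable borel" "\<eta>' \<in> borel_measurable borel"
    using \<eta>(7,8) by (simp_all add: \<eta>_def[abs_def] \<eta>'_def[abs_def])
  have \<eta>i: "integrable lborel \<eta>" "0 < (LINT t|lborel. \<eta> t)" using \<eta>(9,10) by (simp_all add: \<eta>_def[abs_def])
  have E: "0 < E" using T by (simp add: E_def add_pos_pos)

  define A where "A = \<Omega> \<times> {t1..t2}"
  have o\<Omega>: "open \<Omega>" unfolding \<Omega>_def rho_ball_def by (intro open_Collect_less continuous_intros continuous_on_rho \<gamma>)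
  define N where "N = (\<integral>\<^sup>+w. ennreal (indicator A w * \<bar>st u w\<bar>) \<partial>lebesgue)"
  have N: "N < \<infinity>" unfolding N_def A_def
    by (rule spacetime_integral_finite[OF L1 _ o\<Omega> t]) (use li in \<open>simp add: \<Omega>_def\<close>)
  have Am: "A \<in> sets lborel" unfolding A_def sets_lborel using o\<Omega> by (intro borel_Times) auto
  have b\<Omega>: "bounded \<Omega>"
  proof (rule bounded_subset[OF bounded_cball[of 0 "R + R powr (1 + \<gamma>)"]], rule subsetI)
    fix z assume "z \<in> \<Omega>"
    then have "rho \<gamma> z \<le> R" by (simp add: \<Omega>_def rho_ball_def)
    then show "z \<in> cball 0 (R + R powr (1 + \<gamma>))" using norm_le_rho[OF \<gamma>, of z R] by (simp add: dist_norm)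
  qed
  have Af: "emeasure lborel A < \<infinity>" unfolding A_def by (intro emeasure_bounded_finite bounded_Times b\<Omega>) auto
  define B where "B = enn2real (emeasure lborel A + N)"
  have B: "emeasure lborel A + N = ennreal B" "0 \<le> B" using Af N by (auto simp: B_def)
  define Zm where "Zm = (R\<^sup>2 * R powr ((p - 1) / p)) powr p"
  have Zm: "0 \<le> Zm" by (simp add: Zm_def)
  \<comment> \<open>The bound for the right-hand side; it depends on \<open>u\<close> and the time cutoff but not on \<open>\<epsilon>\<close>.\<close>
  define C where "C = E * Zm * (1 / (2 - p) + \<bar>lam\<bar>) * B"
  have C: "0 \<le> C" using E Zm p B by (simp add: C_def)

  obtain \<epsilon> and g :: "('m, 'k) gpoint \<Rightarrow> real"
    where \<epsilon>: "0 < \<epsilon>" "\<epsilon> < R" and gi: "integrable lborel g" and gL: "(C + 1) / (LINT t|lborel. \<eta> t) \<le> (LINT z|lborel. g z)"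
    and gpos: "\<And>z. 0 < hardy_test \<gamma> p R (R / 8) \<epsilon> z \<Longrightarrow>
       g z \<le> c * potential \<gamma> p R z * hardy_test \<gamma> p R (R / 8) \<epsilon> z powr p
         - norm (weighted \<gamma> z (hardy_test_grad \<gamma> p R (R / 8) \<epsilon> z)) powr p"
    and gzero: "\<And>z. hardy_test \<gamma> p R (R / 8) \<epsilon> z = 0 \<Longrightarrow> g z \<le> 0"
    using hardy_energy_unbounded[OF \<gamma> p(1) R assms(9), where ?'m='m and ?'k='k] by blast
  let ?\<kappa> = "R / 8"
  have \<kappa>: "0 < ?\<kappa>" using R by simp
  define P where "P = (hardy_test \<gamma> p R ?\<kappa> \<epsilon> :: ('m, 'k) gpoint \<Rightarrow> real)"
  define e where "e = (hardy_test_grad \<gamma> p R ?\<kappa> \<epsilon> :: ('m, 'k) gpoint \<Rightarrow> _)"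
  have [measurable]: "P \<in> borel_measurable borel" "e \<in> borel_measurable borel" unfolding P_def e_def by measurable
  have P0: "0 \<le> P z" for z unfolding P_def by (rule hardy_test_nonneg[OF p(1) \<epsilon>(1)])
  have Pz: "P z powr p \<le> Zm" for z unfolding P_def Zm_def by (rule hardy_test_powr_le[OF \<gamma> p(1) \<epsilon>(1) R])
  define S where "S = {z::('m, 'k) gpoint. ?\<kappa> \<le> norm (fst z) \<and> rho \<gamma> z \<le> R - \<epsilon>}"
  have PS: "P z = 0" if "z \<notin> S" for z
    using that hardy_test_pos_iff(2)[OF p(1) \<epsilon>(1) \<kappa>, of \<gamma> R z] by (auto simp: S_def P_def)
  define K0 where "K0 = S \<times> {t1..t2}"
  have K0: "compact K0" "K0 \<subseteq> rho_ball \<gamma> R \<times> {0<..<T}" "\<And>w. w \<in> K0 \<Longrightarrow> fst (fst w) \<noteq> 0"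
  proof -
    show "compact K0" unfolding K0_def S_def by (intro compact_Times compact_hardy_support \<gamma>) auto
    show "K0 \<subseteq> rho_ball \<gamma> R \<times> {0<..<T}" using t \<epsilon> by (force simp: K0_def S_def rho_ball_def)
    show "fst (fst w) \<noteq> 0" if "w \<in> K0" for w using that \<kappa> by (auto simp: K0_def S_def)
  qed
  \<comment> \<open>For empty \<open>K0\<close> the spatial test function would vanish, so \<open>g \<le> 0\<close>, but \<open>g\<close> has positive integral.\<close>
  have "K0 \<noteq> {}"
  proof
    assume "K0 = {}"
    moreover have "t1 \<in> {t1..t2}" using T by (simp add: t1_def t2_def)
    ultimately have "S = {}" by (auto simp: K0_def)
    then have "g z \<le> 0" for z using PS[of z] gzero[of z] by (simp add: P_def)
    then have "(LINT z|lborel. g z) \<le> (LINT z|(lborel :: ('m, 'k) gpoint measure). 0)" using gi by (intro integral_mono) auto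
    moreover have "0 < (C + 1) / (LINT t|lborel. \<eta> t)" using C \<eta>i by (intro divide_pos_pos) auto
    ultimately show False using gL by simp
  qed
  define \<zeta> where "\<zeta> w = P (fst w) powr p * \<eta> (snd w)" for w
  define \<zeta>x where "\<zeta>x w = \<eta> (snd w) *\<^sub>R ((p * P (fst w) powr (p - 1)) *\<^sub>R e (fst w))" for w
  define \<zeta>t where "\<zeta>t w = P (fst w) powr p * \<eta>' (snd w)" for w
  have \<zeta>m: "\<zeta> \<in> borel_measurable borel" "\<zeta>x \<in> borel_measurable borel" "\<zeta>t \<in> borel_measurable borel"
    unfolding \<zeta>_def[abs_def] \<zeta>x_def[abs_def] \<zeta>t_def[abs_def] by measurable
  note [measurable] = \<zeta>m
  have \<eta>b: "\<bar>\<eta> t\<bar> \<le> E" "\<bar>\<eta>' t\<bar> \<le> E" for t using \<eta>(2-4)[of t] by auto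
  have \<zeta>bd: "0 \<le> \<zeta> w" "\<zeta> w \<le> E * Zm" "\<bar>\<zeta>t w\<bar> \<le> E * Zm" for w
  proof -
    show "0 \<le> \<zeta> w" using \<eta>(2) by (simp add: \<zeta>_def)
    show "\<zeta> w \<le> E * Zm" unfolding \<zeta>_def using \<eta>(2,3)[of "snd w"] Pz[of "fst w"] Zm E by (subst mult.commute, intro mult_mono) auto
    show "\<bar>\<zeta>t w\<bar> \<le> E * Zm" unfolding \<zeta>t_def abs_mult using \<eta>b[of "snd w"] Pz[of "fst w"] Zm E by (subst mult.commute, intro mult_mono) auto
  qed
  have \<zeta>b: "bounded (range \<zeta>)" "bounded (range \<zeta>x)" "bounded (range \<zeta>t)"
  proof -
    have "norm (\<zeta> w) \<le> E * Zm" "norm (\<zeta>t w) \<le> E * Zm" for w using \<zeta>bd[of w] by auto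
    then show "bounded (range \<zeta>)" "bounded (range \<zeta>t)" unfolding bounded_iff by blast+
    obtain M where M: "\<And>z. norm ((p * P z powr (p - 1)) *\<^sub>R e z) \<le> M"
      using bounded_hardy_test_grad[OF \<gamma> p(1) \<epsilon>(1) \<kappa>, of R, where ?'m='m and ?'k='k]
      unfolding bounded_iff P_def[symmetric] e_def[symmetric] by blast
    have "norm (\<zeta>x w) \<le> E * M" for w
    proof -
      have "norm (\<zeta>x w) = \<bar>\<eta> (snd w)\<bar> * norm ((p * P (fst w) powr (p - 1)) *\<^sub>R e (fst w))"
        unfolding \<zeta>x_def by (rule norm_scaleR)
      also have "\<dots> \<le> E * M" using \<eta>b E M by (intro mult_mono) auto
      finally show ?thesis .
    qed
    then show "bounded (range \<zeta>x)" unfolding bounded_iff by blast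
  qed
  have \<zeta>0: "\<zeta> w = 0" "\<zeta>x w = 0" "\<zeta>t w = 0" if "w \<notin> K0" for w
  proof -
    have "fst w \<notin> S \<or> snd w \<notin> {t1..t2}" using that by (cases w) (auto simp: K0_def)
    then have "P (fst w) = 0 \<or> (\<eta> (snd w) = 0 \<and> \<eta>' (snd w) = 0)" using PS \<eta>(5,6) by blast
    then show "\<zeta> w = 0" "\<zeta>x w = 0" "\<zeta>t w = 0" by (auto simp: \<zeta>_def \<zeta>x_def \<zeta>t_def)
  qed
  have dx: "((\<lambda>t. \<zeta> (w + t *\<^sub>R (b, 0))) has_real_derivative \<zeta>x w \<bullet> b) (at 0)" for w b
  proof -
    have "((\<lambda>z. P z powr p) has_derivative (\<lambda>v. ((p * P (fst w) powr (p - 1)) *\<^sub>R e (fst w)) \<bullet> v)) (at (fst w))"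
      unfolding P_def e_def by (rule has_derivative_hardy_test_powr[OF \<gamma> p(1) \<epsilon>(1) \<kappa>])
    from DERIV_cmult_right[OF DERIV_along_line[OF this, of b], of "\<eta> (snd w)"]
    show ?thesis by (simp add: \<zeta>_def \<zeta>x_def mult_ac)
  qed
  have dt: "((\<lambda>t. \<zeta> (w + t *\<^sub>R (0, 1))) has_real_derivative \<zeta>t w) (at 0)" for w
  proof -
    have "(\<eta> has_real_derivative \<eta>' (snd w)) (at (snd w))" using \<eta>(1) by (simp add: \<eta>_def[abs_def])
    then have "((\<lambda>t. \<eta> (t + snd w)) has_real_derivative \<eta>' (snd w)) (at 0)"
      using DERIV_shift[of \<eta> "\<eta>' (snd w)" 0 "snd w"] by simp
    from DERIV_cmult[OF this, of "P (fst w) powr p"]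
    show ?thesis by (simp add: \<zeta>_def \<zeta>t_def add.commute)
  qed
  obtain U D H f G' where U': "U \<in> borel_measurable borel" "\<forall>w. 0 < U w" "AE w in lebesgue. w \<in> K0 \<longrightarrow> st u w = U w"
    and D': "\<forall>w\<in>K0. D w = (fst (G' w), norm (fst (fst w)) powr (- \<gamma>) *\<^sub>R snd (G' w))"
    and H': "\<forall>w\<in>K0. H w = norm (G' w) powr (p - 2) *\<^sub>R weighted \<gamma> (fst w) (G' w)"
    and f': "\<forall>w\<in>K0. f w = c * potential \<gamma> p R (fst w) * U w powr (p - 1) + lam * U w powr q"
    and i1: "integrable lborel (\<lambda>w. U w powr (1 - p) * (\<zeta>x w \<bullet> H w))"
    and i2: "integrable lborel (\<lambda>w. (1 - p) * U w powr (- p) * (\<zeta> w * (H w \<bullet> D w)))"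
    and i3: "integrable lborel (\<lambda>w. U w powr (1 - p) * (\<zeta> w * f w))"
    and i4: "integrable lborel (\<lambda>w. U w powr (2 - p) / (2 - p) * \<zeta>t w)"
    and ident: "(LINT w|lborel. U w powr (2 - p) / (2 - p) * \<zeta>t w) =
       (LINT w|lborel. U w powr (1 - p) * (\<zeta>x w \<bullet> H w)) + (LINT w|lborel. (1 - p) * U w powr (- p) * (\<zeta> w * (H w \<bullet> D w)))
       - (LINT w|lborel. U w powr (1 - p) * (\<zeta> w * f w))"
    by (rule solution_chain_rule[OF \<gamma> p q(1) li pos eb G K0(1) \<open>K0 \<noteq> {}\<close> K0(2,3) \<zeta>m \<zeta>b \<zeta>0 dx dt];
        (assumption | rule that; assumption))
  note U = U'(1) U'(2)[rule_format] U'(3) and D = D'[rule_format] and H = H'[rule_format] and f = f'[rule_format]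
  note [measurable] = U(1)

  \<comment> \<open>Picone's inequality and the lower bound \<open>g\<close>, where \<open>u\<^sup>1\<^sup>-\<^sup>p f = c V + \<lambda> u\<^sup>q\<^sup>-\<^sup>p\<^sup>+\<^sup>1\<close>.\<close>
  have pw: "\<eta> (snd w) * g (fst w) \<le> U w powr (1 - p) * (\<zeta> w * f w) - U w powr (1 - p) * (\<zeta>x w \<bullet> H w)
      - (1 - p) * U w powr (- p) * (\<zeta> w * (H w \<bullet> D w)) + \<bar>lam\<bar> * (U w powr (q - p + 1) * \<zeta> w)" for w
  proof (cases "P (fst w) = 0 \<or> \<eta> (snd w) = 0")
    case True
    then have "\<zeta> w = 0" "\<zeta>x w = 0" by (auto simp: \<zeta>_def \<zeta>x_def)
    moreover have "\<eta> (snd w) * g (fst w) \<le> 0"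
      using True gzero[of "fst w"] \<eta>(2)[of "snd w"] by (auto simp: P_def intro: mult_nonneg_nonpos)
    ultimately show ?thesis by simp
  next
    case False
    then have w: "w \<in> K0" using \<zeta>0(1)[of w] by (auto simp: \<zeta>_def)
    have Pp: "0 < P (fst w)" using False P0[of "fst w"] by simp
    have Up: "0 < U w" by (rule U(2))
    have \<eta>0: "0 \<le> \<eta> (snd w)" by (rule \<eta>(2))
    let ?h = "norm (weighted \<gamma> (fst w) (e (fst w))) powr p"
    let ?V = "c * potential \<gamma> p R (fst w) * P (fst w) powr p"
    have "- ?h \<le> (p - 1) * U w powr (- p) * (P (fst w) powr p * (H w \<bullet> D w))
        - U w powr (1 - p) * ((p * P (fst w) powr (p - 1)) * (e (fst w) \<bullet> H w))"
      unfolding D[OF w] H[OF w] by (rule picone_pointwise[OF p(1) Up Pp K0(3)[OF w]])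
    then have 1: "\<eta> (snd w) * - ?h \<le> \<eta> (snd w) * ((p - 1) * U w powr (- p) * (P (fst w) powr p * (H w \<bullet> D w))
        - U w powr (1 - p) * ((p * P (fst w) powr (p - 1)) * (e (fst w) \<bullet> H w)))"
      using \<eta>0 by (rule mult_left_mono)
    have 2: "\<eta> (snd w) * ((p - 1) * U w powr (- p) * (P (fst w) powr p * (H w \<bullet> D w))
        - U w powr (1 - p) * ((p * P (fst w) powr (p - 1)) * (e (fst w) \<bullet> H w)))
        = - ((1 - p) * U w powr (- p) * (\<zeta> w * (H w \<bullet> D w))) - U w powr (1 - p) * (\<zeta>x w \<bullet> H w)"
      by (simp add: \<zeta>_def \<zeta>x_def algebra_simps)
    have u1: "U w powr (1 - p) * U w powr (p - 1) = 1" "U w powr (1 - p) * U w powr q = U w powr (q - p + 1)"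
      using Up unfolding powr_add[symmetric] by (simp_all add: algebra_simps)
    have "U w powr (1 - p) * (\<zeta> w * f w) = \<zeta> w * (c * potential \<gamma> p R (fst w) * (U w powr (1 - p) * U w powr (p - 1))
        + lam * (U w powr (1 - p) * U w powr q))"
      unfolding f[OF w] by (simp add: algebra_simps)
    then have 3: "U w powr (1 - p) * (\<zeta> w * f w) = \<eta> (snd w) * ?V + lam * (U w powr (q - p + 1) * \<zeta> w)"
      unfolding u1 by (simp add: \<zeta>_def algebra_simps)
    have "\<eta> (snd w) * g (fst w) \<le> \<eta> (snd w) * (?V - ?h)"
      using gpos[of "fst w"] Pp \<eta>0 unfolding P_def e_def by (intro mult_left_mono) auto
    then have 4: "\<eta> (snd w) * g (fst w) \<le> \<eta> (snd w) * ?V + \<eta> (snd w) * - ?h" by (simp add: right_diff_distrib)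
    have "- (lam * (U w powr (q - p + 1) * \<zeta> w)) \<le> \<bar>lam\<bar> * (U w powr (q - p + 1) * \<zeta> w)"
      using mult_right_mono[of "- lam" "\<bar>lam\<bar>" "U w powr (q - p + 1) * \<zeta> w"] \<zeta>bd(1)[of w] by simp
    then show ?thesis using 1 2 3 4 by linarith
  qed

  define Y where "Y w = indicator K0 w * (1 + U w)" for w
  have K0m[measurable]: "K0 \<in> sets borel" using K0(1) by (intro borel_closed compact_imp_closed)
  have Y0: "0 \<le> Y w" for w using U(2)[of w] by (simp add: Y_def)
  have K0A: "K0 \<subseteq> A" using \<epsilon> by (force simp: K0_def S_def A_def \<Omega>_def rho_ball_def)
  have "(\<integral>\<^sup>+w. ennreal (Y w) \<partial>lborel) = (\<integral>\<^sup>+w. indicator K0 w + ennreal (indicator K0 w * U w) \<partial>lborel)"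
    using U(2) by (intro nn_integral_cong) (auto simp: Y_def indicator_def less_imp_le)
  also have "\<dots> = emeasure lborel K0 + (\<integral>\<^sup>+w. ennreal (indicator K0 w * U w) \<partial>lborel)"
    by (subst nn_integral_add) auto
  also have "(\<integral>\<^sup>+w. ennreal (indicator K0 w * U w) \<partial>lborel) = (\<integral>\<^sup>+w. ennreal (indicator K0 w * U w) \<partial>lebesgue)"
    by (rule nn_integral_completion[symmetric])
  also have "\<dots> \<le> N"
    unfolding N_def
  proof (rule nn_integral_mono_AE)
    show "AE w in lebesgue. ennreal (indicator K0 w * U w) \<le> ennreal (indicator A w * \<bar>st u w\<bar>)"
      using U(3)
    proof eventually_elim
      case (elim w)
      show ?case using elim K0A by (cases "w \<in> K0") (auto intro!: ennreal_leI)
    qed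
  qed
  also have "emeasure lborel K0 \<le> emeasure lborel A" by (rule emeasure_mono[OF K0A Am])
  finally have Yn: "(\<integral>\<^sup>+w. ennreal (Y w) \<partial>lborel) \<le> ennreal B" unfolding B(1)[symmetric] by (simp add: add_mono)
  have Ym[measurable]: "Y \<in> borel_measurable borel" unfolding Y_def[abs_def] by measurable
  have Yi: "integrable lborel Y"
    using Yn Y0 by (intro integrableI_nonneg) (auto intro: order.strict_trans1)
  have YB: "(LINT w|lborel. Y w) \<le> B"
    using Yn Y0 B(2) by (simp add: nn_integral_eq_integral[OF Yi])

  \<comment> \<open>This is where the exponents \<open>2 - p\<close> and \<open>q - p + 1\<close> have to lie in \<open>(0, 1]\<close>.\<close>
  have Upow: "U w powr s \<le> 1 + U w" if "0 < s" "s \<le> 1" for s w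
  proof (cases "U w \<le> 1")
    case True
    then have "U w powr s \<le> 1" using that U(2)[of w] by (intro powr_le1) auto
    then show ?thesis using U(2)[of w] by linarith
  next
    case False
    then have "U w powr s \<le> U w powr 1" using that by (intro powr_mono) auto
    then show ?thesis using U(2)[of w] by simp
  qed
  have b1: "- (U w powr (2 - p) / (2 - p) * \<zeta>t w) \<le> E * Zm / (2 - p) * Y w" for w
  proof (cases "w \<in> K0")
    case True
    have "U w powr (2 - p) * \<bar>\<zeta>t w\<bar> \<le> (1 + U w) * (E * Zm)"
      using Upow[of "2 - p" w] \<zeta>bd(3)[of w] U(2)[of w] p by (intro mult_mono) auto
    then have "U w powr (2 - p) * \<bar>\<zeta>t w\<bar> / (2 - p) \<le> (1 + U w) * (E * Zm) / (2 - p)"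
      using p by (intro divide_right_mono) auto
    moreover have "- (U w powr (2 - p) / (2 - p) * \<zeta>t w) \<le> U w powr (2 - p) / (2 - p) * \<bar>\<zeta>t w\<bar>"
      using mult_left_mono[of "- \<zeta>t w" "\<bar>\<zeta>t w\<bar>" "U w powr (2 - p) / (2 - p)"] p by simp
    ultimately show ?thesis using True by (simp add: Y_def mult_ac)
  qed (simp add: \<zeta>0 Y_def)
  have b2: "U w powr (q - p + 1) * \<zeta> w \<le> E * Zm * Y w" for w
  proof (cases "w \<in> K0")
    case True
    have "U w powr (q - p + 1) * \<zeta> w \<le> (1 + U w) * (E * Zm)"
      using Upow[OF q(2,3), of w] \<zeta>bd(1,2)[of w] U(2)[of w] by (intro mult_mono) auto
    then show ?thesis using True by (simp add: Y_def mult_ac)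
  qed (simp add: \<zeta>0 Y_def)
  have i5: "integrable lborel (\<lambda>w. U w powr (q - p + 1) * \<zeta> w)"
  proof (rule Bochner_Integration.integrable_bound)
    show "integrable lborel (\<lambda>w. E * Zm * Y w)" using Yi by simp
    show "AE w in lborel. norm (U w powr (q - p + 1) * \<zeta> w) \<le> norm (E * Zm * Y w)"
    proof (rule AE_I2)
      fix w
      show "norm (U w powr (q - p + 1) * \<zeta> w) \<le> norm (E * Zm * Y w)"
        using b2[of w] \<zeta>bd(1)[of w] order_trans[OF b2 abs_ge_self, of w] by (simp add: abs_mult)
    qed
  qed measurable
  have "(LINT t|lborel. \<eta> t) * (LINT z|lborel. g z) = (LINT w|lborel. \<eta> (snd w) * g (fst w))"
    by (rule integral_lborel_tensor[OF gi \<eta>i(1), symmetric])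
  also have "\<dots> \<le> (LINT w|lborel. U w powr (1 - p) * (\<zeta> w * f w) - U w powr (1 - p) * (\<zeta>x w \<bullet> H w)
      - (1 - p) * U w powr (- p) * (\<zeta> w * (H w \<bullet> D w)) + \<bar>lam\<bar> * (U w powr (q - p + 1) * \<zeta> w))"
    by (intro integral_mono pw integrable_lborel_tensor gi \<eta>i(1) Bochner_Integration.integrable_add
        Bochner_Integration.integrable_diff integrable_mult_right[OF i5] i1 i2 i3)
  also have "\<dots> = (LINT w|lborel. U w powr (1 - p) * (\<zeta> w * f w)) - (LINT w|lborel. U w powr (1 - p) * (\<zeta>x w \<bullet> H w))
      - (LINT w|lborel. (1 - p) * U w powr (- p) * (\<zeta> w * (H w \<bullet> D w))) + \<bar>lam\<bar> * (LINT w|lborel. U w powr (q - p + 1) * \<zeta> w)"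
    using i1 i2 i3 i5
    by (simp only: Bochner_Integration.integral_add Bochner_Integration.integral_diff Bochner_Integration.integrable_diff
        integrable_mult_right integral_mult_right_zero)
  also have "\<dots> = (LINT w|lborel. - (U w powr (2 - p) / (2 - p) * \<zeta>t w)) + \<bar>lam\<bar> * (LINT w|lborel. U w powr (q - p + 1) * \<zeta> w)"
    unfolding Bochner_Integration.integral_minus ident by simp
  also have "(LINT w|lborel. - (U w powr (2 - p) / (2 - p) * \<zeta>t w)) \<le> (LINT w|lborel. E * Zm / (2 - p) * Y w)"
    by (intro integral_mono b1 Bochner_Integration.integrable_minus i4 integrable_mult_right Yi)
  also have "(LINT w|lborel. U w powr (q - p + 1) * \<zeta> w) \<le> (LINT w|lborel. E * Zm * Y w)"
    by (intro integral_mono b2 i5 integrable_mult_right Yi)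
  finally have "(LINT t|lborel. \<eta> t) * (LINT z|lborel. g z) \<le>
      E * Zm / (2 - p) * (LINT w|lborel. Y w) + \<bar>lam\<bar> * (E * Zm * (LINT w|lborel. Y w))"
    by (simp add: mult_left_mono)
  also have "\<dots> = E * Zm * (1 / (2 - p) + \<bar>lam\<bar>) * (LINT w|lborel. Y w)" by (simp add: algebra_simps)
  also have "\<dots> \<le> C" unfolding C_def using E Zm p by (intro mult_left_mono YB) auto
  finally have "(LINT t|lborel. \<eta> t) * (LINT z|lborel. g z) \<le> C" .
  moreover have "C + 1 \<le> (LINT t|lborel. \<eta> t) * (LINT z|lborel. g z)"
    using gL \<eta>i(2) by (simp add: divide_le_eq mult.commute)
  ultimately show False by linarith
qed

end
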